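(* Assume there exists a sequence $u_r>0$ ($r\ge0$) such that $\sum_{r=1}^\infty u_r^{-1}<\infty$ and $$\sum_{r=1}^\infty p_rN_{r-1}u_{r-1}u_r<\infty.$$ Then: (1) for every $\omega\in\Omega$, the absolutely continuous spectrum of $H_\omega=\Delta+V_\omega$ is empty; (2) if $\mathbb P$ is conditionally absolutely continuous, then for $\mathbb P$-almost every $\omega$ the continuous spectrum of $H_\omega$ is empty (i.e. $H_\omega$ has pure point spectrum).
   Context: $(X,\mathbf P,\mathbf n)$ is a hierarchical structure: $X$ infinite countable, $\mathbf n=(n_r)_{r\ge0}$ positive integers, $\mathcal P_r$ partitions of $X$ ("clusters of rank $r$") with $n_0=1$ and rank-0 clusters singletons, every rank-$r$ cluster ($r\ge1$) a disjoint union of exactly $n_r$ rank-$(r-1)$ clusters, and any two points lying in a common cluster of some rank. $N_r=\prod_{s=0}^rn_s$, $Q_r(x)$ is the rank-$r$ cluster containing $x$, $d(x,y)=\min\{r:y\in Q_r(x)\}$, $(E_r\psi)(x)=\frac1{N_r}\sum_{d(x,y)\le r}\psi(y)$; $(p_r)_{r\ge1}$ positive with $\sum p_r=1$, $p_0=0$, $\Delta=\sum_{r\ge0}p_rE_r$ on $\ell^2(X)$. $\Omega=\mathbb R^X$ with its Borel $\sigma$-algebra and a probability measure $\mathbb P$. For $\omega\in\Omega$, $V_\omega$ is the (possibly unbounded) self-adjoint multiplication operator $(V_\omega\psi)(x)=\omega(x)\psi(x)$, and $H_\omega=\Delta+V_\omega$. For $x\in X$ write $\Omega=\mathbb R\times\tilde\Omega$,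 $\tilde\Omega=\mathbb R^{X\setminus\{x\}}$, with marginal $\tilde{\mathbb P}_x(\tilde B)=\mathbb P(\mathbb R\times\tilde B)$ and conditional measures $\mathbb P_x^{\tilde\omega}$ on $\mathbb R$ such that $\int f\,d\mathbb P=\int_{\tilde\Omega}\int_{\mathbb R}f(\xi,\tilde\omega)\,d\mathbb P_x^{\tilde\omega}(\xi)\,d\tilde{\mathbb P}_x(\tilde\omega)$ for $f\in L^1(\mathbb P)$. $\mathbb P$ is conditionally absolutely continuous if for every $x\in X$, $\mathbb P_x^{\tilde\omega}$ is absolutely continuous w.r.t. Lebesgue measure for $\tilde{\mathbb P}_x$-a.e. $\tilde\omega$ (e.g. a product of absolutely continuous measures). *)

theory Defs
  imports "HOL-Probability.Probability"
begin

text \<open>Q r x is the rank-r cluster containing x; the partition P_r is the set of all Q r x.\<close>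
definition hier_structure :: "(nat \<Rightarrow> 'a \<Rightarrow> 'a set) \<Rightarrow> (nat \<Rightarrow> nat) \<Rightarrow> bool" where
  "hier_structure Q n \<longleftrightarrow>
     infinite (UNIV :: 'a set) \<and>
     (\<forall>r. n r > 0) \<and> n 0 = 1 \<and>
     (\<forall>x. Q 0 x = {x}) \<and>
     (\<forall>r x. x \<in> Q r x) \<and>
     (\<forall>r x y. y \<in> Q r x \<longrightarrow> Q r y = Q r x) \<and>
     (\<forall>r x. 0 < r \<longrightarrow>
        (\<forall>y\<in>Q r x. Q (r - 1) y \<subseteq> Q r x) \<and>
        card ((\<lambda>y. Q (r - 1) y) ` Q r x) = n r) \<and>
     (\<forall>x y. \<exists>r. y \<in> Q r x)"

definition NN :: "(nat \<Rightarrow> nat) \<Rightarrow> nat \<Rightarrow> real" where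
  "NN n r = (\<Prod>s\<le>r. real (n s))"

definition hdist :: "(nat \<Rightarrow> 'a \<Rightarrow> 'a set) \<Rightarrow> 'a \<Rightarrow> 'a \<Rightarrow> nat" where
  "hdist Q x y = (LEAST r. y \<in> Q r x)"

definition Eop :: "(nat \<Rightarrow> 'a \<Rightarrow> 'a set) \<Rightarrow> (nat \<Rightarrow> nat) \<Rightarrow> nat \<Rightarrow> ('a \<Rightarrow> complex) \<Rightarrow> 'a \<Rightarrow> complex" where
  "Eop Q n r \<psi> x = complex_of_real (1 / NN n r) * (\<Sum>y\<in>{y. hdist Q x y \<le> r}. \<psi> y)"

definition Lap :: "(nat \<Rightarrow> 'a \<Rightarrow> 'a set) \<Rightarrow> (nat \<Rightarrow> nat) \<Rightarrow> (nat \<Rightarrow> real) \<Rightarrow> ('a \<Rightarrow> complex) \<Rightarrow> 'a \<Rightarrow> complex" where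
  "Lap Q n p \<psi> x = (\<Sum>r. complex_of_real (p r) * Eop Q n r \<psi> x)"

definition l2 :: "('a \<Rightarrow> complex) \<Rightarrow> bool" where
  "l2 \<psi> \<longleftrightarrow> (\<lambda>x. (cmod (\<psi> x))\<^sup>2) summable_on UNIV"

definition l2inner :: "('a \<Rightarrow> complex) \<Rightarrow> ('a \<Rightarrow> complex) \<Rightarrow> complex" where
  "l2inner \<phi> \<psi> = (\<Sum>\<^sub>\<infinity>x. cnj (\<phi> x) * \<psi> x)"

definition Hdom :: "('a \<Rightarrow> real) \<Rightarrow> ('a \<Rightarrow> complex) set" where
  "Hdom \<omega> = {\<psi>. l2 \<psi> \<and> l2 (\<lambda>x. complex_of_real (\<omega> x) * \<psi> x)}"

definition Hop :: "(nat \<Rightarrow> 'a \<Rightarrow> 'a set) \<Rightarrow> (nat \<Rightarrow> nat) \<Rightarrow> (nat \<Rightarrow> real) \<Rightarrow> ('a \<Rightarrow> real)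
    \<Rightarrow> ('a \<Rightarrow> complex) \<Rightarrow> 'a \<Rightarrow> complex" where
  "Hop Q n p \<omega> \<psi> x = Lap Q n p \<psi> x + complex_of_real (\<omega> x) * \<psi> x"

text \<open>mu is the spectral measure of psi: a finite Borel measure on R whose Borel
  (Stieltjes) transform is the resolvent matrix element
  <psi, (H - z)^(-1) psi> for Im z > 0. The resolvent (H - z)^(-1) psi is the
  unique phi in the domain D with H phi - z phi = psi.\<close>
definition spectral_measure :: "(('a \<Rightarrow> complex) \<Rightarrow> 'a \<Rightarrow> complex) \<Rightarrow> ('a \<Rightarrow> complex) set
    \<Rightarrow> ('a \<Rightarrow> complex) \<Rightarrow> real measure \<Rightarrow> bool" where
  "spectral_measure H D \<psi> \<mu> \<longleftrightarrow>
     finite_measure \<mu> \<and> sets \<mu> = sets borel \<and>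
     (\<forall>z \<phi>. Im z > 0 \<longrightarrow> \<phi> \<in> D \<longrightarrow> (\<lambda>x. H \<phi> x - z * \<phi> x) = \<psi> \<longrightarrow>
        l2inner \<psi> \<phi> = (\<integral>t. 1 / (complex_of_real t - z) \<partial>\<mu>))"

text \<open>Absolutely continuous subspace: vectors whose spectral measure is absolutely
  continuous w.r.t. Lebesgue measure. The ac spectrum is empty iff this is {0}.\<close>
definition ac_subspace :: "(('a \<Rightarrow> complex) \<Rightarrow> 'a \<Rightarrow> complex) \<Rightarrow> ('a \<Rightarrow> complex) set \<Rightarrow> ('a \<Rightarrow> complex) set" where
  "ac_subspace H D = {\<psi>. l2 \<psi> \<and> (\<exists>\<mu>. spectral_measure H D \<psi> \<mu> \<and> absolutely_continuous lborel \<mu>)}"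

text \<open>Continuous subspace: vectors whose spectral measure has no atoms.
  The continuous spectrum is empty (pure point spectrum) iff this is {0}.\<close>
definition cont_subspace :: "(('a \<Rightarrow> complex) \<Rightarrow> 'a \<Rightarrow> complex) \<Rightarrow> ('a \<Rightarrow> complex) set \<Rightarrow> ('a \<Rightarrow> complex) set" where
  "cont_subspace H D = {\<psi>. l2 \<psi> \<and> (\<exists>\<mu>. spectral_measure H D \<psi> \<mu> \<and> (\<forall>t. emeasure \<mu> {t} = 0))}"

definition cond_abs_cont :: "('a \<Rightarrow> real) measure \<Rightarrow> bool" where
  "cond_abs_cont M \<longleftrightarrow>
    (\<forall>x. \<exists>\<kappa> :: ('a \<Rightarrow> real) \<Rightarrow> real measure.
       (\<forall>\<omega>. prob_space (\<kappa> \<omega>) \<and> sets (\<kappa> \<omega>) = sets borel) \<and>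
       (\<forall>\<omega> \<omega>'. (\<forall>y. y \<noteq> x \<longrightarrow> \<omega> y = \<omega>' y) \<longrightarrow> \<kappa> \<omega> = \<kappa> \<omega>') \<and>
       (\<forall>A\<in>sets M.
          (\<lambda>\<omega>. emeasure (\<kappa> \<omega>) {\<xi>. fun_upd \<omega> x \<xi> \<in> A}) \<in> borel_measurable M \<and>
          emeasure M A = (\<integral>\<^sup>+ \<omega>. emeasure (\<kappa> \<omega>) {\<xi>. fun_upd \<omega> x \<xi> \<in> A} \<partial>M)) \<and>
       (AE \<omega> in M. absolutely_continuous lborel (\<kappa> \<omega>)))"

end

(*
Fix a site x0 with clusters A_r of rank r around it, and let G_r be the resolvent of the operator
cut down to A_r. The term p_r E_r that turns rank r - 1 into rank r acts on A_r with rank one, so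
  G_r delta = G_(r-1) delta - (p_r / N_r) (G_(r-1) 1)(x0) G_r 1   on A_r.
A weak-type estimate gives |G_r 1| <= c N_r u_r for all energies outside a set of measure
10 / (c u_r). Under the two summability hypotheses |G_r(E + i eps) delta| is therefore bounded,
uniformly in r and eps, for almost every E. Consequently the spectral measure mu of delta
lives on the Lebesgue null set B of those E for which the integral of (t - E)^(-2) dmu(t) is infinite.

A vector whose spectral measure is singular to mu vanishes at x0; this excludes absolutely
continuous spectrum. For the second claim (Simon-Wolff) vary the potential at x0 only. A rank-one
formula relates the Stieltjes transforms and shows that every mu lives on its atoms together
with the set B that belongs to the potential 0 at x0. Averaging mu over the potential at x0
gives Lebesgue measure, so mu(B) = 0 for almost every value, and then mu is singular
to every measure without atoms.
*)
theory Submission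
  imports Defs
begin

section \<open>Spectral theorem for a symmetric kernel on a finite set\<close>

text \<open>Spectral measures are given only through Stieltjes transforms, and the operator may be
  unbounded. The work is therefore done on the real symmetric matrices of the finite volumes, where
  eigenvectors exist, and transferred by limits: the resolvents of a fixed vector converge in norm
  at each z of positive imaginary part because the omitted ranks carry only a tail of
  \<open>p\<close>, and convergence of transforms gives vague convergence of measures. The two
  series enter through the recursion. One step multiplies p_r / N_r by c N_(r-1) u_(r-1) and by c
  N_r u_r; N_r cancels and c^2 times a term of the second series remains. The first series makes the
  exceptional sets sum to a constant over c, and since c is free, the energies escaping every such
  bound form a null set. In the second claim the measure of a site comes from a compactness argument
  and says nothing about measurability in the potential. Its transform, a limit of continuous
  functions, takes its place in the averaging.\<close>

lemma compact_fun_box: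
  fixes c :: "'a \<Rightarrow> real"
  shows "compact {f :: 'a \<Rightarrow> real. \<forall>x. \<bar>f x\<bar> \<le> c x}"
proof -
  have "compactin (product_topology (\<lambda>_::'a. euclideanreal) UNIV) (PiE UNIV (\<lambda>x. {-c x..c x}))"
    by (subst compactin_PiE) (auto simp: compactin_euclidean_iff)
  moreover have "PiE UNIV (\<lambda>x. {-c x..c x}) = {f :: 'a \<Rightarrow> real. \<forall>x. \<bar>f x\<bar> \<le> c x}"
    by (auto simp: PiE_def Pi_def abs_le_iff)
       (metis minus_le_iff)+
  ultimately show ?thesis
    by (simp add: euclidean_product_topology flip: compactin_euclidean_iff)
qed

text \<open>Rayleigh: the quadratic form of \<open>K\<close> is maximised on the unit sphere of the
  orthogonal complement of the \<open>e j\<close>. That complement is invariant under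
  \<open>K\<close>, so the maximiser solves the full eigenvector equation; \<open>v\<close> ensures
  that the sphere is not empty.\<close>

lemma symmetric_max_eigenvector:
  fixes K :: "'a \<Rightarrow> 'a \<Rightarrow> real" and e :: "nat \<Rightarrow> 'a \<Rightarrow> real"
  assumes fin: "finite A" and sym: "\<And>x y. x \<in> A \<Longrightarrow> y \<in> A \<Longrightarrow> K x y = K y x"
    and eig: "\<And>j x. j < k \<Longrightarrow> x \<in> A \<Longrightarrow> (\<Sum>y\<in>A. K x y * e j y) = l j * e j x"
    and v: "\<And>j. j < k \<Longrightarrow> (\<Sum>x\<in>A. e j x * v x) = 0" "(\<Sum>x\<in>A. (v x)\<^sup>2) \<noteq> (0::real)"
  shows "\<exists>f lam. (\<Sum>x\<in>A. (f x)\<^sup>2) = 1 \<and> (\<forall>j<k. (\<Sum>x\<in>A. e j x * f x) = 0)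
     \<and> (\<forall>x\<in>A. (\<Sum>y\<in>A. K x y * f y) = lam * f x)"
proof -
  define V where "V = {f :: 'a \<Rightarrow> real. \<forall>j<k. (\<Sum>x\<in>A. e j x * f x) = 0}"
  \<comment> \<open>Vectors are functions on the whole type; vanishing off \<open>A\<close> puts the
    sphere inside a compact box.\<close>
  define S where "S = {f \<in> V. (\<Sum>x\<in>A. (f x)\<^sup>2) = 1 \<and> (\<forall>x. x \<notin> A \<longrightarrow> f x = 0)}"
  define B where "B = (\<lambda>f g :: 'a \<Rightarrow> real. \<Sum>x\<in>A. f x * (\<Sum>y\<in>A. K x y * g y))"
  define N where "N = (\<lambda>f :: 'a \<Rightarrow> real. \<Sum>x\<in>A. (f x)\<^sup>2)"
  have cl: "closed S"
    unfolding S_def V_def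
    by (intro closed_Collect_conj closed_Collect_all closed_Collect_imp closed_Collect_eq
        open_Collect_const continuous_intros continuous_on_product_coordinates; simp?)
      (auto intro!: closed_Collect_conj closed_Collect_all closed_Collect_imp closed_Collect_eq
        open_Collect_const continuous_intros continuous_on_product_coordinates)
  have sub: "S \<subseteq> {f. \<forall>x. \<bar>f x\<bar> \<le> 1}"
  proof safe
    fix f x assume f: "f \<in> S"
    show "\<bar>f x\<bar> \<le> 1"
    proof (cases "x \<in> A")
      case True
      then have "(f x)\<^sup>2 \<le> (\<Sum>x\<in>A. (f x)\<^sup>2)"
        by (intro member_le_sum) (auto simp: fin)
      then show ?thesis using f by (simp add: S_def abs_square_le_1)
    qed (use f in \<open>auto simp: S_def\<close>)
  qed
  have "compact S"
    using compact_Int_closed[OF compact_fun_box[of "\<lambda>_. 1"] cl] sub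
    by (simp add: Int_absorb1)
  define w where "w = (\<lambda>x. if x \<in> A then v x / sqrt (N v) else 0)"
  have N0: "N f \<ge> 0" for f by (simp add: N_def sum_nonneg)
  then have Npos: "N v > 0" using v(2) unfolding N_def by (metis order_le_less)
  have "w \<in> S"
    using v(1) Npos
    by (auto simp: S_def V_def w_def power_divide N_def simp flip: sum_divide_distrib)
  then have "S \<noteq> {}" by auto
  have "continuous_on S (\<lambda>f. B f f)"
    unfolding B_def
    by (rule continuous_on_subset[of UNIV])
      (auto intro!: continuous_intros continuous_on_product_coordinates)
  then obtain f where f: "f \<in> S" "\<And>g. g \<in> S \<Longrightarrow> B g g \<le> B f f"
    using continuous_attains_sup[OF \<open>compact S\<close> \<open>S \<noteq> {}\<close>] by blast
  define lam where "lam = B f f"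
  have bound: "B g g \<le> lam * N g" if "g \<in> V" for g
  proof (cases "N g = 0")
    case True
    then have "\<forall>x\<in>A. g x = 0" by (auto simp: N_def sum_nonneg_eq_0_iff fin)
    then show ?thesis using True by (simp add: B_def)
  next
    case False
    with N0 have pos: "N g > 0" by (metis order_le_less)
    define h where "h = (\<lambda>x. if x \<in> A then g x / sqrt (N g) else 0)"
    have "h \<in> S"
      using that pos
      by (auto simp: S_def V_def h_def power_divide N_def simp flip: sum_divide_distrib)
    then have "B h h \<le> lam" using f(2) by (simp add: lam_def)
    moreover have "B h h = B g g / N g"
      using pos by (simp add: B_def h_def sum_divide_distrib[symmetric])
    ultimately show ?thesis using pos by (simp add: field_simps)
  qed
  have fV: "f \<in> V" and Nf: "N f = 1" using f by (auto simp: S_def N_def)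
  \<comment> \<open>The residual of the eigenvector equation. It lies in \<open>V\<close>, so it is
    an admissible direction for varying \<open>f\<close>.\<close>
  define g where "g = (\<lambda>x. (\<Sum>y\<in>A. K x y * f y) - lam * f x)"
  have swap: "B a b = B b a" for a b
    unfolding B_def sum_distrib_left by (subst sum.swap) (auto intro!: sum.cong simp: sym)
  have gV: "g \<in> V"
  proof -
    have "(\<Sum>x\<in>A. e j x * g x) = 0" if "j < k" for j
    proof -
      have "(\<Sum>x\<in>A. e j x * g x) = B (e j) f - lam * (\<Sum>x\<in>A. e j x * f x)"
        by (simp add: g_def B_def algebra_simps sum_subtractf sum_distrib_left)
      also have "B (e j) f = B f (e j)" by (rule swap)
      also have "\<dots> = l j * (\<Sum>x\<in>A. e j x * f x)"
        unfolding B_def by (simp add: eig that sum_distrib_left algebra_simps cong: sum.cong)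
      finally show ?thesis using fV that by (simp add: V_def)
    qed
    then show ?thesis by (simp add: V_def)
  qed
  have Bexp: "B (\<lambda>x. f x + t * g x) (\<lambda>x. f x + t * g x) = B f f + 2 * t * B g f + t\<^sup>2 * B g g" for t
  proof -
    have "B (\<lambda>x. f x + t * g x) (\<lambda>x. f x + t * g x) = B f f + t * B g f + t * B f g + t\<^sup>2 * B g g"
      by (simp add: B_def algebra_simps sum.distrib sum_distrib_left power2_eq_square)
    then show ?thesis by (simp add: swap[of f g])
  qed
  define I where "I = (\<Sum>x\<in>A. g x * f x)"
  have Nexp: "N (\<lambda>x. f x + t * g x) = N f + 2 * t * I + t\<^sup>2 * N g" for t
    by (simp add: N_def I_def algebra_simps sum.distrib sum_distrib_left power2_eq_square)
  have Kf: "(\<Sum>y\<in>A. K x y * f y) = g x + lam * f x" for x by (simp add: g_def)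
  have Ng: "B g f - lam * I = N g"
    unfolding B_def I_def N_def Kf
    by (simp add: algebra_simps sum.distrib sum_distrib_left power2_eq_square)
  \<comment> \<open>Moving by \<open>t\<close> along the residual gains \<open>2 * t * N g\<close>
    at first order; maximality of \<open>lam\<close> leaves only a term of order t^2 to compensate
    for it.\<close>
  have quad: "2 * t * N g \<le> t\<^sup>2 * (lam * N g - B g g)" for t
  proof -
    have "(\<Sum>x\<in>A. e j x * (f x + t * g x)) = (\<Sum>x\<in>A. e j x * f x) + t * (\<Sum>x\<in>A. e j x * g x)" for j
      by (simp add: algebra_simps sum.distrib sum_distrib_left)
    then have "(\<lambda>x. f x + t * g x) \<in> V" using fV gV by (simp add: V_def)
    from bound[OF this] have "lam + 2 * t * B g f + t\<^sup>2 * B g g \<le> lam * (1 + 2 * t * I + t\<^sup>2 * N g)"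
      by (simp add: Bexp Nexp Nf lam_def)
    moreover have "lam * (1 + 2 * t * I + t\<^sup>2 * N g) = lam + 2 * t * (lam * I) + t\<^sup>2 * (lam * N g)"
      by (simp add: algebra_simps)
    moreover have "2 * t * N g = 2 * t * B g f - 2 * t * (lam * I)"
      by (simp add: algebra_simps flip: Ng)
    ultimately show ?thesis by (simp only: right_diff_distrib)
  qed
  have "N g = 0"
  proof (rule ccontr)
    assume "N g \<noteq> 0"
    with N0 have pos: "N g > 0" by (metis order_le_less)
    define C where "C = \<bar>lam * N g - B g g\<bar> + 1"
    \<comment> \<open>With this \<open>t\<close> the bound \<open>2 * N g \<le> t * C\<close> reads
      \<open>2 * N g \<le> N g\<close>.\<close>
    define t where "t = N g / C"
    have C: "C > 0" by (simp add: C_def add_nonneg_pos)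
    then have t: "t > 0" using pos by (simp add: t_def)
    have "2 * t * N g \<le> t\<^sup>2 * C"
      using quad[of t] by (rule order_trans) (auto simp: C_def intro!: mult_left_mono)
    then have "2 * N g \<le> t * C" using t by (simp add: power2_eq_square)
    also have "\<dots> = N g" using C by (simp add: t_def)
    finally show False using pos by simp
  qed
  then have "\<forall>x\<in>A. g x = 0" by (auto simp: N_def sum_nonneg_eq_0_iff fin)
  then show ?thesis
    using fV Nf by (intro exI[of _ f] exI[of _ lam]) (auto simp: V_def N_def g_def)
qed

text \<open>\<open>R\<close> is the kernel of the projection onto the complement of the
  \<open>e j\<close>, so its squared Hilbert-Schmidt norm is its trace. Below full dimension this is
  positive and some row of \<open>R\<close> is a new direction; at full dimension it is 0, which is
  completeness.\<close>

lemma orthonormal_residual: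
  fixes e :: "nat \<Rightarrow> 'a \<Rightarrow> real"
  assumes fin: "finite A"
    and on: "\<And>i j. i < k \<Longrightarrow> j < k \<Longrightarrow> (\<Sum>x\<in>A. e i x * e j x) = (if i = j then 1 else 0)"
  defines "R \<equiv> \<lambda>x y. (if x = y then 1 else 0) - (\<Sum>j<k. e j x * e j y)"
  shows "\<And>j x. j < k \<Longrightarrow> x \<in> A \<Longrightarrow> (\<Sum>y\<in>A. e j y * R x y) = 0"
    and "(\<Sum>x\<in>A. \<Sum>y\<in>A. (R x y)\<^sup>2) = real (card A) - real k"
proof -
  have *: "(\<Sum>y\<in>A. e j y * (\<Sum>i<k. e i x * e i y)) = e j x" if "j < k" for j x
  proof -
    have "(\<Sum>y\<in>A. e j y * (\<Sum>i<k. e i x * e i y)) = (\<Sum>i<k. e i x * (\<Sum>y\<in>A. e j y * e i y))"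
      unfolding sum_distrib_left by (subst sum.swap) (simp add: algebra_simps)
    also have "\<dots> = (\<Sum>i<k. e i x * (if j = i then 1 else 0))"
      using on that by (intro sum.cong) auto
    also have "\<dots> = e j x" using that by (simp add: sum.delta' if_distrib cong: if_cong)
    finally show ?thesis .
  qed
  show orth: "(\<Sum>y\<in>A. e j y * R x y) = 0" if "j < k" "x \<in> A" for j x
  proof -
    have "(\<Sum>y\<in>A. e j y * R x y)
        = (\<Sum>y\<in>A. (if x = y then e j y else 0) - e j y * (\<Sum>i<k. e i x * e i y))"
      by (intro sum.cong) (auto simp: R_def right_diff_distrib)
    then show ?thesis using that fin by (simp only: sum_subtractf * sum.delta') simp
  qed
  have "(\<Sum>y\<in>A. (R x y)\<^sup>2) = R x x" if x: "x \<in> A" for x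
  proof -
    have "(\<Sum>y\<in>A. (\<Sum>j<k. e j x * e j y) * R x y) = (\<Sum>j<k. e j x * (\<Sum>y\<in>A. e j y * R x y))"
      unfolding sum_distrib_left sum_distrib_right by (subst sum.swap) (simp add: algebra_simps)
    also have "\<dots> = 0" using orth x by simp
    finally have 0: "(\<Sum>y\<in>A. (\<Sum>j<k. e j x * e j y) * R x y) = 0" .
    have "(\<Sum>y\<in>A. (R x y)\<^sup>2) = (\<Sum>y\<in>A. (if x = y then R x y else 0) - (\<Sum>j<k. e j x * e j y) * R x y)"
      by (intro sum.cong) (auto simp: power2_eq_square R_def algebra_simps)
    also have "\<dots> = R x x" using 0 fin x by (simp add: sum_subtractf sum.delta')
    finally show ?thesis .
  qed
  then have "(\<Sum>x\<in>A. \<Sum>y\<in>A. (R x y)\<^sup>2) = (\<Sum>x\<in>A. R x x)" by simp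
  also have "\<dots> = real (card A) - (\<Sum>x\<in>A. \<Sum>j<k. e j x * e j x)"
    by (simp add: R_def sum_subtractf)
  also have "(\<Sum>x\<in>A. \<Sum>j<k. e j x * e j x) = (\<Sum>j<k. \<Sum>x\<in>A. e j x * e j x)" by (rule sum.swap)
  also have "\<dots> = real k" using on by simp
  finally show "(\<Sum>x\<in>A. \<Sum>y\<in>A. (R x y)\<^sup>2) = real (card A) - real k" .
qed

lemma finite_spectral_theorem:
  fixes K :: "'a \<Rightarrow> 'a \<Rightarrow> real"
  assumes fin: "finite A" and sym: "\<And>x y. x \<in> A \<Longrightarrow> y \<in> A \<Longrightarrow> K x y = K y x"
    and "k \<le> card A"
  shows "\<exists>(e :: nat \<Rightarrow> 'a \<Rightarrow> real) l.
     (\<forall>i<k. \<forall>j<k. (\<Sum>x\<in>A. e i x * e j x) = (if i = j then 1 else 0)) \<and>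
     (\<forall>j<k. \<forall>x\<in>A. (\<Sum>y\<in>A. K x y * e j y) = l j * e j x)"
  using \<open>k \<le> card A\<close>
proof (induction k)
  case (Suc k)
  then obtain e :: "nat \<Rightarrow> 'a \<Rightarrow> real" and l where
    on: "\<And>i j. i < k \<Longrightarrow> j < k \<Longrightarrow> (\<Sum>x\<in>A. e i x * e j x) = (if i = j then 1 else 0)" and
    eig: "\<And>j x. j < k \<Longrightarrow> x \<in> A \<Longrightarrow> (\<Sum>y\<in>A. K x y * e j y) = l j * e j x"
    by (metis Suc_leD)
  define R where "R = (\<lambda>x y. (if x = y then 1 else 0) - (\<Sum>j<k. e j x * e j y))"
  have "(\<Sum>x\<in>A. \<Sum>y\<in>A. (R x y)\<^sup>2) \<noteq> 0"
    unfolding R_def using orthonormal_residual(2)[OF fin, of k e] on Suc.prems by simp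
  then obtain x where x: "x \<in> A" "(\<Sum>y\<in>A. (R x y)\<^sup>2) \<noteq> 0" by (meson sum.not_neutral_contains_not_neutral)
  have R_orth: "(\<Sum>y\<in>A. e j y * R x y) = 0" if "j < k" for j
    unfolding R_def by (rule orthonormal_residual(1)[OF fin on that x(1)])
  have "\<exists>f lam. (\<Sum>x\<in>A. (f x)\<^sup>2) = 1 \<and> (\<forall>j<k. (\<Sum>x\<in>A. e j x * f x) = 0)
     \<and> (\<forall>x\<in>A. (\<Sum>y\<in>A. K x y * f y) = lam * f x)"
    by (rule symmetric_max_eigenvector[OF fin sym eig R_orth x(2)])
  then obtain f lam where f: "(\<Sum>x\<in>A. (f x)\<^sup>2) = 1" "\<forall>j<k. (\<Sum>x\<in>A. e j x * f x) = 0"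
     "\<forall>x\<in>A. (\<Sum>y\<in>A. K x y * f y) = lam * f x" by blast
  show ?case
    using on eig f
    by (intro exI[of _ "e(k := f)"] exI[of _ "l(k := lam)"])
       (auto simp: less_Suc_eq power2_eq_square mult.commute)
qed simp

definition eigensystem :: "'a set \<Rightarrow> ('a \<Rightarrow> 'a \<Rightarrow> real) \<Rightarrow> (nat \<Rightarrow> 'a \<Rightarrow> real) \<times> (nat \<Rightarrow> real)" where
  "eigensystem A K = (SOME (e, l).
     (\<forall>i<card A. \<forall>j<card A. (\<Sum>x\<in>A. e i x * e j x) = (if i = j then 1 else 0)) \<and>
     (\<forall>j<card A. \<forall>x\<in>A. (\<Sum>y\<in>A. K x y * e j y) = l j * e j x))"

locale finite_symmetric =
  fixes A :: "'a set" and K :: "'a \<Rightarrow> 'a \<Rightarrow> real"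
  assumes fin: "finite A" and sym: "x \<in> A \<Longrightarrow> y \<in> A \<Longrightarrow> K x y = K y x"
begin

definition e where "e = fst (eigensystem A K)"
definition l where "l = snd (eigensystem A K)"

lemma eigensystem_spec:
  "(\<forall>i<card A. \<forall>j<card A. (\<Sum>x\<in>A. e i x * e j x) = (if i = j then 1 else 0)) \<and>
   (\<forall>j<card A. \<forall>x\<in>A. (\<Sum>y\<in>A. K x y * e j y) = l j * e j x)"
proof -
  let ?P = "\<lambda>(e, l). (\<forall>i<card A. \<forall>j<card A. (\<Sum>x\<in>A. e i x * e j x) = (if i = j then 1 else 0)) \<and>
     (\<forall>j<card A. \<forall>x\<in>A. (\<Sum>y\<in>A. K x y * e j y) = l j * e j x)"
  have "\<exists>p. ?P p" using finite_spectral_theorem[where K = K, OF fin sym order_refl] by auto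
  then have "?P (eigensystem A K)" unfolding eigensystem_def by (rule someI_ex)
  then show ?thesis by (simp add: e_def l_def case_prod_beta)
qed

lemma e_complete: assumes "x \<in> A" "y \<in> A"
  shows "(\<Sum>j<card A. e j x * e j y) = (if x = y then 1 else 0)"
proof -
  define R where "R = (\<lambda>x y. (if x = y then 1 else 0) - (\<Sum>j<card A. e j x * e j y))"
  have "(\<Sum>x\<in>A. \<Sum>y\<in>A. (R x y)\<^sup>2) = 0"
    using orthonormal_residual(2)[OF fin, of "card A" e] eigensystem_spec by (simp add: R_def)
  then have "R x y = 0" using assms by (simp add: sum_nonneg_eq_0_iff sum_nonneg fin)
  then show ?thesis by (simp add: R_def)
qed

definition coef :: "('a \<Rightarrow> complex) \<Rightarrow> nat \<Rightarrow> complex" where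
  "coef h j = (\<Sum>y\<in>A. of_real (e j y) * h y)"

text \<open>The resolvent applied to \<open>h\<close>, in the eigenbasis, so that norms and forms
  become sums over eigenvalues. The value 0 off \<open>A\<close> lets resolvents of different
  volumes be compared as functions on all sites.\<close>

definition G :: "complex \<Rightarrow> ('a \<Rightarrow> complex) \<Rightarrow> 'a \<Rightarrow> complex" where
  "G z h x = (if x \<in> A then \<Sum>j<card A. of_real (e j x) * coef h j / (of_real (l j) - z) else 0)"

lemma expansion: assumes "x \<in> A" shows "(\<Sum>j<card A. of_real (e j x) * coef h j) = h x"
proof -
  have "(\<Sum>j<card A. of_real (e j x) * coef h j) = (\<Sum>y\<in>A. of_real (\<Sum>j<card A. e j x * e j y) * h y)"
    unfolding coef_def sum_distrib_left of_real_sum sum_distrib_right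
    by (subst sum.swap) (simp add: algebra_simps)
  also have "\<dots> = (\<Sum>y\<in>A. (if x = y then h y else 0))"
    using e_complete assms by (intro sum.cong) auto
  finally show ?thesis using fin assms by simp
qed

lemma coef_sum_e: assumes "j < card A"
  shows "coef (\<lambda>x. \<Sum>i<card A. of_real (e i x) * c i) j = c j"
proof -
  have "coef (\<lambda>x. \<Sum>i<card A. of_real (e i x) * c i) j = (\<Sum>i<card A. of_real (\<Sum>x\<in>A. e j x * e i x) * c i)"
    unfolding coef_def sum_distrib_left of_real_sum sum_distrib_right
    by (subst sum.swap) (simp add: algebra_simps)
  also have "\<dots> = (\<Sum>i<card A. if j = i then c i else 0)"
    using eigensystem_spec assms by (intro sum.cong) auto
  finally show ?thesis using assms by simp
qed

lemma coef_cong: "(\<And>x. x \<in> A \<Longrightarrow> g x = h x) \<Longrightarrow> coef g j = coef h j"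
  by (simp add: coef_def)

lemma coef_G: assumes "j < card A" shows "coef (G z h) j = coef h j / (of_real (l j) - z)"
proof -
  have "coef (G z h) j = coef (\<lambda>x. \<Sum>i<card A. of_real (e i x) * (coef h i / (of_real (l i) - z))) j"
    by (rule coef_cong) (simp add: G_def)
  then show ?thesis unfolding coef_sum_e[OF assms] .
qed

text \<open>The eigenvectors are real, so the form without conjugation is diagonal too. This yields
  the symmetry of \<open>G\<close>, and with one conjugated argument the usual Parseval
  identity.\<close>

lemma bilinear_parseval: "(\<Sum>x\<in>A. g x * h x) = (\<Sum>j<card A. coef g j * coef h j)"
proof -
  have "(\<Sum>x\<in>A. g x * h x) = (\<Sum>x\<in>A. g x * (\<Sum>j<card A. of_real (e j x) * coef h j))"
    by (simp add: expansion)
  also have "\<dots> = (\<Sum>j<card A. coef g j * coef h j)"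
    unfolding coef_def[of g] sum_distrib_left sum_distrib_right
    by (subst sum.swap) (simp add: algebra_simps)
  finally show ?thesis .
qed

lemma coef_cnj: "coef (\<lambda>x. cnj (g x)) j = cnj (coef g j)"
  by (simp add: coef_def)

lemma parseval: "(\<Sum>x\<in>A. (cmod (g x))\<^sup>2) = (\<Sum>j<card A. (cmod (coef g j))\<^sup>2)"
proof -
  have "complex_of_real (\<Sum>x\<in>A. (cmod (g x))\<^sup>2) = (\<Sum>x\<in>A. cnj (g x) * g x)"
    by (simp add: complex_norm_square mult.commute flip: of_real_power)
  also have "\<dots> = complex_of_real (\<Sum>j<card A. (cmod (coef g j))\<^sup>2)"
    unfolding bilinear_parseval coef_cnj
    by (simp add: complex_norm_square mult.commute flip: of_real_power)
  finally show ?thesis by (simp only: of_real_eq_iff)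
qed

lemma coef_K: assumes "j < card A"
  shows "coef (\<lambda>x. \<Sum>y\<in>A. of_real (K x y) * g y) j = of_real (l j) * coef g j"
proof -
  have "coef (\<lambda>x. \<Sum>y\<in>A. of_real (K x y) * g y) j = (\<Sum>y\<in>A. of_real (\<Sum>x\<in>A. K y x * e j x) * g y)"
    unfolding coef_def sum_distrib_left of_real_sum sum_distrib_right
    by (subst sum.swap) (auto intro!: sum.cong simp: algebra_simps sym)
  also have "\<dots> = (\<Sum>y\<in>A. of_real (l j * e j y) * g y)"
    using eigensystem_spec assms by (intro sum.cong) auto
  finally show ?thesis by (simp add: coef_def sum_distrib_left algebra_simps)
qed

lemma coef_eq_imp: "(\<And>j. j < card A \<Longrightarrow> coef g j = coef h j) \<Longrightarrow> x \<in> A \<Longrightarrow> g x = h x"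
  by (subst (1 2) expansion[symmetric]) auto

lemma nonreal_denominator: "Im z \<noteq> 0 \<Longrightarrow> of_real t - z \<noteq> 0"
  by (metis Im_complex_of_real right_minus_eq)

lemma G_solves:
  assumes "Im z \<noteq> 0" "x \<in> A"
  shows "(\<Sum>y\<in>A. of_real (K x y) * G z h y) - z * G z h x = h x"
proof (rule coef_eq_imp[OF _ assms(2)])
  fix j assume j: "j < card A"
  have "coef (\<lambda>x. (\<Sum>y\<in>A. of_real (K x y) * G z h y) - z * G z h x) j
      = (of_real (l j) - z) * coef (G z h) j"
    using coef_K[OF j, of "G z h"]
    by (simp add: coef_def right_diff_distrib left_diff_distrib sum_subtractf)
       (simp add: sum_distrib_left algebra_simps)
  then show "coef (\<lambda>x. (\<Sum>y\<in>A. of_real (K x y) * G z h y) - z * G z h x) j = coef h j"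
    using coef_G[OF j] nonreal_denominator[OF assms(1)] by simp
qed

text \<open>In the eigenbasis the equation decouples into scalar ones with nonzero factors
  \<open>l j - z\<close>. The resolvent identities of the later sections are proved by checking an
  equation and applying this lemma.\<close>

lemma G_unique:
  assumes "Im z \<noteq> 0" "\<And>x. x \<in> A \<Longrightarrow> (\<Sum>y\<in>A. of_real (K x y) * g y) - z * g x = h x" "x \<in> A"
  shows "g x = G z h x"
proof (rule coef_eq_imp[OF _ assms(3)])
  fix j assume j: "j < card A"
  have "coef h j = coef (\<lambda>x. (\<Sum>y\<in>A. of_real (K x y) * g y) - z * g x) j"
    by (rule coef_cong) (simp add: assms(2))
  also have "\<dots> = (of_real (l j) - z) * coef g j"
    using coef_K[OF j, of g]
    by (simp add: coef_def right_diff_distrib left_diff_distrib sum_subtractf)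
       (simp add: sum_distrib_left algebra_simps)
  finally show "coef g j = coef (G z h) j"
    using coef_G[OF j] nonreal_denominator[OF assms(1)] by simp
qed

lemma norm_G: "(\<Sum>x\<in>A. (cmod (G z h x))\<^sup>2) = (\<Sum>j<card A. (cmod (coef h j))\<^sup>2 / (cmod (of_real (l j) - z))\<^sup>2)"
  unfolding parseval by (simp add: coef_G norm_divide power_divide)

lemma norm_G_le:
  assumes "Im z > 0"
  shows "L2_set (\<lambda>x. cmod (G z h x)) A \<le> L2_set (\<lambda>x. cmod (h x)) A / Im z"
proof -
  have "(\<Sum>x\<in>A. (cmod (G z h x))\<^sup>2) \<le> (\<Sum>j<card A. (cmod (coef h j))\<^sup>2 / (Im z)\<^sup>2)"
    unfolding norm_G
  proof (intro sum_mono divide_left_mono)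
    fix j
    have "\<bar>Im z\<bar> \<le> cmod (of_real (l j) - z)" using abs_Im_le_cmod[of "of_real (l j) - z"] by simp
    then show "(Im z)\<^sup>2 \<le> (cmod (of_real (l j) - z))\<^sup>2" by (metis abs_le_square_iff abs_norm_cancel)
    show "0 < (cmod (of_real (l j) - z))\<^sup>2 * (Im z)\<^sup>2"
      using assms nonreal_denominator[of z "l j"] by simp
  qed auto
  also have "\<dots> = (\<Sum>x\<in>A. (cmod (h x))\<^sup>2) / (Im z)\<^sup>2" by (simp add: parseval sum_divide_distrib)
  finally show ?thesis
    unfolding L2_set_def using assms by (smt (verit) real_sqrt_divide real_sqrt_le_mono real_sqrt_unique)
qed

lemma G_symmetric: "(\<Sum>x\<in>A. k x * G z h x) = (\<Sum>x\<in>A. h x * G z k x)"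
  unfolding bilinear_parseval by (simp add: coef_G) (simp add: mult.commute)

lemma form_G: "(\<Sum>x\<in>A. cnj (h x) * G z h x) = (\<Sum>j<card A. of_real ((cmod (coef h j))\<^sup>2) / (of_real (l j) - z))"
  unfolding bilinear_parseval coef_cnj by (simp add: coef_G complex_norm_square mult.commute del: of_real_power)

text \<open>The spectral measure of \<open>h\<close> for the matrix \<open>K\<close>. As the image
  of a measure on indices it adds up the weights of coinciding eigenvalues.\<close>

definition smeas :: "('a \<Rightarrow> complex) \<Rightarrow> real measure" where
  "smeas h = distr (point_measure {..<card A} (\<lambda>j. ennreal ((cmod (coef h j))\<^sup>2))) borel l"

lemma sets_smeas[simp, measurable_cong]: "sets (smeas h) = sets borel"
  by (simp add: smeas_def)

lemma integral_smeas:
  fixes f :: "real \<Rightarrow> 'b::{banach, second_countable_topology}"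
  assumes "f \<in> borel_measurable borel"
  shows "(\<integral>t. f t \<partial>smeas h) = (\<Sum>j<card A. (cmod (coef h j))\<^sup>2 *\<^sub>R f (l j))"
  unfolding smeas_def using assms by (subst integral_distr) (auto simp: lebesgue_integral_point_measure_finite)

lemma emeasure_smeas_UNIV: "emeasure (smeas h) UNIV = ennreal (\<Sum>x\<in>A. (cmod (h x))\<^sup>2)"
  unfolding smeas_def parseval
  by (subst emeasure_distr) (auto simp: emeasure_point_measure_finite_if space_point_measure)

lemma finite_measure_smeas: "finite_measure (smeas h)"
  by (rule finite_measureI) (simp add: sets_eq_imp_space_eq[OF sets_smeas] emeasure_smeas_UNIV)

lemma stieltjes_smeas: "(\<Sum>x\<in>A. cnj (h x) * G z h x) = (\<integral>t. 1 / (of_real t - z) \<partial>smeas h)"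
  by (subst integral_smeas) (auto simp: form_G scaleR_conv_of_real)

lemma norm_G_smeas: "(\<Sum>x\<in>A. (cmod (G z h x))\<^sup>2) = (\<integral>t. 1 / (cmod (of_real t - z))\<^sup>2 \<partial>smeas h)"
  by (subst integral_smeas) (auto simp: norm_G)

end

section \<open>Stieltjes transforms of measures on the line\<close>

lemma integral_cauchy_kernel:
  shows "integrable lborel (\<lambda>x::real. 1 / (1 + x\<^sup>2))" and "(LBINT x. 1 / (1 + x\<^sup>2)) = pi"
proof -
  have e: "einterval (- \<infinity>) \<infinity> = UNIV" by auto
  show "integrable lborel (\<lambda>x::real. 1 / (1 + x\<^sup>2))"
    using integrable_inverse_1_plus_square by (simp add: e set_integrable_def inverse_eq_divide)
  show "(LBINT x. 1 / (1 + x\<^sup>2)) = pi"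
    using LBINT_inverse_1_plus_square
    by (simp add: e interval_lebesgue_integral_def set_lebesgue_integral_def inverse_eq_divide)
qed

lemma nn_integral_cauchy_kernel: "(\<integral>\<^sup>+x. ennreal (1 / (1 + x\<^sup>2)) \<partial>lborel) = ennreal pi"
  using nn_integral_eq_integral[OF integral_cauchy_kernel(1)] integral_cauchy_kernel(2) by simp

lemma cauchy_kernel_affine:
  assumes "b > 0" shows "b * (b / ((t - (t + b * x))\<^sup>2 + b\<^sup>2)) = 1 / (1 + (x::real)\<^sup>2)"
proof -
  have "(t - (t + b * x))\<^sup>2 + b\<^sup>2 = b\<^sup>2 * (1 + x\<^sup>2)" by (simp add: algebra_simps power2_eq_square)
  then show ?thesis using assms by (simp add: power2_eq_square)
qed

lemma nn_integral_poisson_kernel: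
  assumes "b > 0"
  shows "(\<integral>\<^sup>+E. ennreal (b / ((t - E)\<^sup>2 + b\<^sup>2)) \<partial>lborel) = ennreal pi"
proof -
  have "(\<integral>\<^sup>+E. ennreal (b / ((t - E)\<^sup>2 + b\<^sup>2)) \<partial>lborel)
      = ennreal \<bar>b\<bar> * (\<integral>\<^sup>+x. ennreal (b / ((t - (t + b * x))\<^sup>2 + b\<^sup>2)) \<partial>lborel)"
    using assms by (subst nn_integral_real_affine[where c = b and t = t]) auto
  also have "\<dots> = (\<integral>\<^sup>+x. ennreal (b * (b / ((t - (t + b * x))\<^sup>2 + b\<^sup>2))) \<partial>lborel)"
    using assms by (subst nn_integral_cmult[symmetric]) (auto simp: ennreal_mult[symmetric])
  also have "\<dots> = ennreal pi"
    using assms by (simp only: cauchy_kernel_affine nn_integral_cauchy_kernel)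
  finally show ?thesis .
qed

text \<open>Outside the intervals \<open>\<bar>E - l j\<bar> < \<bar>a j\<bar> s\<close> the sum is at most twice a sum of Poisson
  kernels of widths \<open>\<bar>a j\<bar> s\<close>, to which Chebyshev's inequality applies; \<open>s = 1 / (m u)\<close> balances
  the two contributions.\<close>
lemma small_exceptional_set:
  fixes a l :: "nat \<Rightarrow> real"
  assumes a: "(\<Sum>j<m. (a j)\<^sup>2) = real m" and m: "m > 0" and u: "u > 0"
  shows "\<exists>S\<in>sets borel. emeasure lborel S \<le> ennreal (10 / u) \<and>
    (\<forall>E \<epsilon>. E \<notin> S \<longrightarrow> (\<Sum>j<m. (a j)\<^sup>2 / ((l j - E)\<^sup>2 + \<epsilon>\<^sup>2)) \<le> (real m * u)\<^sup>2)"
proof -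
  define s where "s = 1 / (real m * u)"
  have s: "s > 0" using m u by (simp add: s_def)
  \<comment> \<open>From \<open>2 * \<bar>a j\<bar> \<le> (a j)\<^sup>2 + 1\<close>, summed over the
    \<open>m\<close> indices.\<close>
  have abs_sum: "(\<Sum>j<m. \<bar>a j\<bar>) \<le> real m"
  proof -
    have "0 \<le> (\<Sum>j<m. (\<bar>a j\<bar> - 1)\<^sup>2)" by (simp add: sum_nonneg)
    also have "\<dots> = 2 * real m - 2 * (\<Sum>j<m. \<bar>a j\<bar>)"
      using a by (simp add: power2_diff sum.distrib sum_subtractf sum_distrib_left)
    finally show ?thesis by simp
  qed
  define S1 where "S1 = (\<Union>j<m. {l j - \<bar>a j\<bar> * s <..< l j + \<bar>a j\<bar> * s})"
  define f where "f = (\<lambda>E. \<Sum>j<m. 2 * (a j)\<^sup>2 / ((l j - E)\<^sup>2 + (\<bar>a j\<bar> * s)\<^sup>2))"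
  define S2 where "S2 = {E. (real m * u)\<^sup>2 \<le> f E}"
  have f_meas[measurable]: "f \<in> borel_measurable borel" by (simp add: f_def)
  have S: "S1 \<in> sets borel" "S2 \<in> sets borel" by (auto simp: S1_def S2_def)
  have "emeasure lborel S1 \<le> (\<Sum>j<m. emeasure lborel {l j - \<bar>a j\<bar> * s <..< l j + \<bar>a j\<bar> * s})"
    unfolding S1_def by (rule emeasure_subadditive_finite) auto
  also have "\<dots> = ennreal (2 * s * (\<Sum>j<m. \<bar>a j\<bar>))"
    using s by (simp add: sum_distrib_left algebra_simps flip: sum_ennreal)
  also have "\<dots> \<le> ennreal (2 * s * real m)"
    using s abs_sum by (intro ennreal_leI mult_left_mono) auto
  also have "2 * s * real m = 2 / u" using m by (simp add: s_def)
  finally have m1: "emeasure lborel S1 \<le> ennreal (2 / u)" .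
  have int1: "(\<integral>\<^sup>+E. ennreal (2 * (a j)\<^sup>2 / ((l j - E)\<^sup>2 + (\<bar>a j\<bar> * s)\<^sup>2)) \<partial>lborel)
     = ennreal (2 * pi / s * \<bar>a j\<bar>)" for j
  proof (cases "a j = 0")
    case False
    then have b: "\<bar>a j\<bar> * s > 0" using s by simp
    have eq: "2 * (a j)\<^sup>2 / D = (2 * \<bar>a j\<bar> / s) * (\<bar>a j\<bar> * s / D)" for D
      using s by (simp add: power2_eq_square mult.assoc)
    have "(\<integral>\<^sup>+E. ennreal (2 * (a j)\<^sup>2 / ((l j - E)\<^sup>2 + (\<bar>a j\<bar> * s)\<^sup>2)) \<partial>lborel)
       = (\<integral>\<^sup>+E. ennreal (2 * \<bar>a j\<bar> / s) * ennreal (\<bar>a j\<bar> * s / ((l j - E)\<^sup>2 + (\<bar>a j\<bar> * s)\<^sup>2)) \<partial>lborel)"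
      unfolding eq using s by (intro nn_integral_cong ennreal_mult) auto
    also have "\<dots> = ennreal (2 * \<bar>a j\<bar> / s) * ennreal pi"
      by (subst nn_integral_cmult) (simp_all add: nn_integral_poisson_kernel[OF b])
    also have "\<dots> = ennreal (2 * pi / s * \<bar>a j\<bar>)"
      using s by (simp add: ennreal_mult[symmetric] mult_ac)
    finally show ?thesis .
  qed simp
  have f0: "f E \<ge> 0" for E by (simp add: f_def sum_nonneg)
  have "(\<integral>\<^sup>+E. ennreal (f E) \<partial>lborel)
     = (\<Sum>j<m. \<integral>\<^sup>+E. ennreal (2 * (a j)\<^sup>2 / ((l j - E)\<^sup>2 + (\<bar>a j\<bar> * s)\<^sup>2)) \<partial>lborel)"
    unfolding f_def by (subst nn_integral_sum[symmetric]) (auto simp: sum_ennreal)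
  also have "\<dots> = ennreal (2 * pi / s * (\<Sum>j<m. \<bar>a j\<bar>))"
    unfolding int1 using s by (simp add: sum_distrib_left flip: sum_ennreal)
  also have "\<dots> \<le> ennreal (2 * pi / s * real m)"
    using s abs_sum by (intro ennreal_leI mult_left_mono) auto
  finally have intf: "(\<integral>\<^sup>+E. ennreal (f E) \<partial>lborel) \<le> ennreal (2 * pi / s * real m)" .
  \<comment> \<open>Markov's inequality at the level \<open>(real m * u)\<^sup>2\<close>: the
    integral of \<open>f\<close> is at most 2 pi m / s = 2 pi m^2 u, which leaves 2 pi / u.\<close>
  define c where "c = 1 / (real m * u)\<^sup>2"
  have c: "c > 0" using m u by (simp add: c_def)
  have "emeasure lborel S2 \<le> emeasure lborel {E\<in>UNIV. 1 \<le> ennreal c * ennreal (f E)}"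
  proof (intro emeasure_mono)
    show "S2 \<subseteq> {E\<in>UNIV. 1 \<le> ennreal c * ennreal (f E)}"
      using m u f0 c by (auto simp: S2_def c_def ennreal_mult[symmetric] field_simps simp flip: ennreal_1)
  qed simp
  also have "\<dots> \<le> ennreal c * (\<integral>\<^sup>+E. ennreal (f E) \<partial>lborel)"
    using nn_integral_Markov_inequality[of "\<lambda>E. ennreal (f E)" UNIV lborel "ennreal c"] by simp
  also have "\<dots> \<le> ennreal c * ennreal (2 * pi / s * real m)" using intf by (rule mult_left_mono) simp
  also have "\<dots> = ennreal (2 * pi / u)"
    using m u c s by (simp add: ennreal_mult[symmetric] c_def s_def power2_eq_square)
  finally have m2: "emeasure lborel S2 \<le> ennreal (2 * pi / u)" .
  have "emeasure lborel (S1 \<union> S2) \<le> ennreal (2 / u) + ennreal (2 * pi / u)"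
    using S by (intro order_trans[OF emeasure_subadditive] add_mono m1 m2) auto
  \<comment> \<open>2 + 2 pi is below 10.\<close>
  also have "\<dots> \<le> ennreal (10 / u)"
    using u pi_less_4 by (simp add: ennreal_plus[symmetric] field_simps del: ennreal_plus)
  finally have meas: "emeasure lborel (S1 \<union> S2) \<le> ennreal (10 / u)" .
  have "(\<Sum>j<m. (a j)\<^sup>2 / ((l j - E)\<^sup>2 + \<epsilon>\<^sup>2)) \<le> (real m * u)\<^sup>2" if "E \<notin> S1 \<union> S2" for E \<epsilon>
  proof -
    have "(a j)\<^sup>2 / ((l j - E)\<^sup>2 + \<epsilon>\<^sup>2) \<le> 2 * (a j)\<^sup>2 / ((l j - E)\<^sup>2 + (\<bar>a j\<bar> * s)\<^sup>2)" if j: "j < m" for j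
    proof (cases "a j = 0")
      case False
      have "\<bar>a j\<bar> * s \<le> \<bar>l j - E\<bar>" using \<open>E \<notin> S1 \<union> S2\<close> j by (force simp: S1_def)
      then have sq: "(\<bar>a j\<bar> * s)\<^sup>2 \<le> (l j - E)\<^sup>2" using s by (metis abs_ge_zero abs_le_square_iff abs_of_nonneg less_imp_le mult_nonneg_nonneg)
      have "0 < (\<bar>a j\<bar> * s)\<^sup>2" using False s by simp
      then have "(a j)\<^sup>2 / ((l j - E)\<^sup>2 + \<epsilon>\<^sup>2) \<le> (a j)\<^sup>2 / (l j - E)\<^sup>2"
        using sq by (intro divide_left_mono) (auto intro!: mult_pos_pos add_pos_nonneg)
      also have "\<dots> = 2 * (a j)\<^sup>2 / (2 * (l j - E)\<^sup>2)" by simp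
      also have "\<dots> \<le> 2 * (a j)\<^sup>2 / ((l j - E)\<^sup>2 + (\<bar>a j\<bar> * s)\<^sup>2)"
        using sq \<open>0 < (\<bar>a j\<bar> * s)\<^sup>2\<close> by (intro divide_left_mono) (auto intro!: mult_pos_pos add_nonneg_pos)
      finally show ?thesis .
    qed simp
    then have "(\<Sum>j<m. (a j)\<^sup>2 / ((l j - E)\<^sup>2 + \<epsilon>\<^sup>2)) \<le> f E" unfolding f_def by (intro sum_mono) auto
    also have "\<dots> \<le> (real m * u)\<^sup>2" using that by (simp add: S2_def)
    finally show ?thesis .
  qed
  then show ?thesis using S meas by (intro bexI[of _ "S1 \<union> S2"]) auto
qed

definition stieltjes :: "real measure \<Rightarrow> complex \<Rightarrow> complex" where
  "stieltjes \<mu> z = (\<integral>t. 1 / (of_real t - z) \<partial>\<mu>)"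

text \<open>For \<open>smeas\<close> this is the squared norm of the resolvent vector
  (\<open>norm_G_smeas\<close>), and in general \<open>Im (stieltjes \<mu> z) / Im z\<close>. The
  two readings connect resolvent bounds with boundary values of transforms.\<close>

definition res2 :: "real measure \<Rightarrow> complex \<Rightarrow> real" where
  "res2 \<mu> z = (\<integral>t. 1 / (cmod (of_real t - z))\<^sup>2 \<partial>\<mu>)"

text \<open>The energies \<open>E\<close> at which \<open>\<integral> (t - E)\<^sup>-\<^sup>2 d\<mu>(t)\<close> diverges: \<open>res2 \<mu> (Complex E b)\<close> increases to
  this integral as \<open>b\<close> decreases to \<open>0\<close>.\<close>
definition singular_part :: "real measure \<Rightarrow> real set" where
  "singular_part \<mu> = {E. \<not> (\<exists>C::nat. \<forall>n. res2 \<mu> (Complex E (1 / Suc n)) \<le> real C)}"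

lemma Im_le_cmod_diff: "Im z > 0 \<Longrightarrow> Im z \<le> cmod (of_real t - z)"
  using abs_Im_le_cmod[of "of_real t - z"] by simp

lemma cmod_diff_Complex: "(cmod (of_real t - Complex E b))\<^sup>2 = (t - E)\<^sup>2 + b\<^sup>2"
  by (simp add: cmod_power2)

locale finite_borel = finite_measure \<mu> for \<mu> :: "real measure" +
  assumes sets_eq[measurable_cong, simp]: "sets \<mu> = sets borel"
begin

lemma space_eq[simp]: "space \<mu> = UNIV" using sets_eq_imp_space_eq[OF sets_eq] by simp

lemma norm_kernel_le: "Im z > 0 \<Longrightarrow> cmod (1 / (of_real t - z)) \<le> 1 / Im z"
  using Im_le_cmod_diff[of z t] by (simp add: norm_divide divide_simps mult_ac)

lemma kernel2_le: assumes "Im z > 0" shows "1 / (cmod (of_real t - z))\<^sup>2 \<le> 1 / (Im z)\<^sup>2"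
proof -
  have "(Im z)\<^sup>2 \<le> (cmod (of_real t - z))\<^sup>2" using Im_le_cmod_diff[of z t] assms by (intro power_mono) auto
  then show ?thesis using assms by (intro divide_left_mono) (auto intro!: mult_pos_pos intro: order_less_le_trans[of _ "(Im z)\<^sup>2"])
qed

lemma integrable_kernel: "Im z > 0 \<Longrightarrow> integrable \<mu> (\<lambda>t. 1 / (of_real t - z))"
  by (rule integrable_const_bound[of _ "1 / Im z"]) (auto intro: norm_kernel_le)

lemma integrable_kernel2: "Im z > 0 \<Longrightarrow> integrable \<mu> (\<lambda>t. 1 / (cmod (of_real t - z))\<^sup>2)"
  by (rule integrable_const_bound[of _ "1 / (Im z)\<^sup>2"]) (auto intro: kernel2_le)

lemma Im_stieltjes: assumes "Im z > 0" shows "Im (stieltjes \<mu> z) = Im z * res2 \<mu> z"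
proof -
  have "Im (stieltjes \<mu> z) = (\<integral>t. Im (1 / (of_real t - z)) \<partial>\<mu>)"
    unfolding stieltjes_def using integrable_kernel[OF assms] by (rule integral_Im[symmetric])
  also have "\<dots> = (\<integral>t. Im z * (1 / (cmod (of_real t - z))\<^sup>2) \<partial>\<mu>)"
    by (intro Bochner_Integration.integral_cong) (auto simp: Im_divide cmod_power2)
  also have "\<dots> = Im z * res2 \<mu> z" unfolding res2_def by (rule integral_mult_right_zero)
  finally show ?thesis .
qed

lemma res2_nonneg: "res2 \<mu> z \<ge> 0" by (simp add: res2_def)

lemma measurable_res2[measurable]: "(\<lambda>E. res2 \<mu> (Complex E b)) \<in> borel_measurable borel"
  unfolding res2_def cmod_diff_Complex by measurable

lemma singular_part_sets[measurable]: "singular_part \<mu> \<in> sets borel"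
proof -
  have "singular_part \<mu> = UNIV - (\<Union>C::nat. \<Inter>n. {E. res2 \<mu> (Complex E (1 / Suc n)) \<le> real C})"
    by (auto simp: singular_part_def)
  then show ?thesis by simp
qed

text \<open>Within distance b of \<open>E\<close> the kernel is at least 1 / (2 b^2), so a bound on
  \<open>res2\<close> makes the mass near \<open>E\<close> quadratic in the length.\<close>

lemma measure_near_le:
  assumes "\<And>t. t \<in> I \<Longrightarrow> \<bar>t - E\<bar> \<le> 1 / Suc n" "I \<in> sets borel"
  shows "measure \<mu> I \<le> 2 * res2 \<mu> (Complex E (1 / Suc n)) / (Suc n)\<^sup>2"
proof -
  define b where "b = 1 / real (Suc n)"
  have b: "b > 0" by (simp add: b_def)
  have "measure \<mu> I * (1 / (2 * b\<^sup>2)) = (\<integral>t. indicator I t * (1 / (2 * b\<^sup>2)) \<partial>\<mu>)"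
    using assms(2) by simp
  also have "\<dots> \<le> res2 \<mu> (Complex E b)"
    unfolding res2_def
  proof (rule integral_mono)
    show "integrable \<mu> (\<lambda>t. indicator I t * (1 / (2 * b\<^sup>2)))"
      using assms(2) by (intro integrable_mult_left integrable_real_indicator) (auto simp: less_top[symmetric])
    show "integrable \<mu> (\<lambda>t. 1 / (cmod (of_real t - Complex E b))\<^sup>2)"
      by (rule integrable_kernel2) (use b in simp)
    fix t
    show "indicator I t * (1 / (2 * b\<^sup>2)) \<le> 1 / (cmod (of_real t - Complex E b))\<^sup>2"
    proof (cases "t \<in> I")
      case True
      then have "(t - E)\<^sup>2 \<le> b\<^sup>2" using assms(1) b unfolding b_def by (metis abs_le_square_iff abs_of_pos)
      then show ?thesis unfolding cmod_diff_Complex using True b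
        by (auto intro!: divide_left_mono mult_pos_pos add_nonneg_pos)
    qed simp
  qed
  finally have "measure \<mu> I \<le> res2 \<mu> (Complex E b) * (2 * b\<^sup>2)" using b by (simp add: field_simps)
  also have "\<dots> = 2 * res2 \<mu> (Complex E b) / (Suc n)\<^sup>2" by (simp add: b_def power_divide)
  finally show ?thesis by (simp add: b_def)
qed

text \<open>A cell of length \<open>1 / n\<close> that meets the set has mass \<open>O(1 / n\<^sup>2)\<close>, and \<open>O(n)\<close> cells suffice.\<close>
lemma null_bounded_res2:
  "emeasure \<mu> {E \<in> {-real K..real K}. \<forall>n. res2 \<mu> (Complex E (1 / Suc n)) \<le> real C} = 0" (is "emeasure \<mu> ?T = 0")
proof -
  have T: "?T \<in> sets borel" by measurable
  have bound: "measure \<mu> ?T \<le> (2 * real K + 1) * 2 * real C / Suc n" for n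
  proof -
    define I where "I = (\<lambda>j. {-real K + real j / Suc n .. -real K + real (Suc j) / Suc n})"
    have cell: "measure \<mu> (I j \<inter> ?T) \<le> 2 * real C / (Suc n)\<^sup>2" for j
    proof (cases "I j \<inter> ?T = {}")
      case False
      then obtain E where E: "E \<in> I j" "E \<in> ?T" by auto
      have "\<bar>t - E\<bar> \<le> 1 / Suc n" if "t \<in> I j" for t
        using that E(1) by (auto simp: I_def abs_le_iff add_divide_distrib)
      then have "measure \<mu> (I j) \<le> 2 * res2 \<mu> (Complex E (1 / Suc n)) / (Suc n)\<^sup>2"
        by (rule measure_near_le) (auto simp: I_def)
      also have "\<dots> \<le> 2 * real C / (Suc n)\<^sup>2"
        using E(2) by (intro divide_right_mono mult_left_mono) auto
      finally show ?thesis using T finite_measure_mono[of "I j \<inter> ?T" "I j"] by (simp add: I_def)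
    next
      case True
      then show ?thesis by (simp only: measure_empty) simp
    qed
    \<comment> \<open>The cells with index below 2 K (n + 1) end at K; the surplus takes care of the
      right endpoint, where the floor reaches that number.\<close>
    have cov: "?T \<subseteq> (\<Union>j<(2 * K + 1) * Suc n. I j \<inter> ?T)"
    proof
      fix E assume E: "E \<in> ?T"
      define j where "j = nat \<lfloor>(E + K) * Suc n\<rfloor>"
      have nn: "(E + K) * Suc n \<ge> 0" using E by simp
      then have j: "real j \<le> (E + K) * Suc n" "(E + K) * Suc n < real j + 1"
        unfolding j_def by (simp_all add: of_nat_nat)
      have "(E + K) * Suc n \<le> (2 * real K) * Suc n" using E by (intro mult_right_mono) auto
      then have "real j \<le> (2 * real K) * Suc n" using j by linarith
      also have "\<dots> < real ((2 * K + 1) * Suc n)" by (simp add: algebra_simps)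
      finally have "j < (2 * K + 1) * Suc n" by (simp only: of_nat_less_iff)
      moreover have "E \<in> I j" using j by (simp add: I_def field_simps)
      ultimately show "E \<in> (\<Union>j<(2 * K + 1) * Suc n. I j \<inter> ?T)" using E by blast
    qed
    have "measure \<mu> ?T \<le> measure \<mu> (\<Union>j<(2 * K + 1) * Suc n. I j \<inter> ?T)"
      using T by (intro finite_measure_mono cov) (auto simp: I_def)
    also have "\<dots> \<le> (\<Sum>j<(2 * K + 1) * Suc n. measure \<mu> (I j \<inter> ?T))"
      using T by (intro finite_measure_subadditive_finite) (auto simp: I_def)
    also have "\<dots> \<le> (\<Sum>j<(2 * K + 1) * Suc n. 2 * real C / (Suc n)\<^sup>2)"
      by (intro sum_mono cell)
    also have "\<dots> = (2 * real K + 1) * real (Suc n) * (2 * real C / (real (Suc n) * real (Suc n)))"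
      by (simp add: power2_eq_square algebra_simps)
    also have "\<dots> = (2 * real K + 1) * 2 * real C / Suc n"
      by (simp del: of_nat_Suc)
    finally show ?thesis .
  qed
  have "(\<lambda>n. (2 * real K + 1) * 2 * real C / Suc n) \<longlonglongrightarrow> 0"
    by (rule LIMSEQ_Suc[OF lim_const_over_n])
  then have "measure \<mu> ?T \<le> 0"
    by (rule LIMSEQ_le_const) (use bound in auto)
  then have "measure \<mu> ?T = 0" by (simp add: order_antisym)
  then show ?thesis by (simp add: emeasure_eq_measure)
qed

text \<open>The complement is a countable union, over windows and bounds, of sets on which masses
  are too small to add up to anything.\<close>

lemma concentrated_on_singular_part: "emeasure \<mu> (- singular_part \<mu>) = 0"
proof -
  have "- singular_part \<mu> = (\<Union>K. \<Union>C. {E \<in> {-real K..real K}. \<forall>n. res2 \<mu> (Complex E (1 / Suc n)) \<le> real C})"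
    unfolding singular_part_def
    by (auto simp: abs_le_iff) (metis abs_le_iff minus_le_iff real_arch_simple)
  then show ?thesis
    using null_bounded_res2 by (auto intro!: emeasure_UN_eq_0)
qed

end

section \<open>Rank-one perturbation at a regular energy\<close>

text \<open>At such an \<open>E\<close> the transform of \<open>\<mu>0\<close> has a boundary value
  \<open>G\<close>, and the rank-one formula divides \<open>res2 \<mu>0\<close> by |1 + \<xi> g|^2.
  The quotient stays bounded unless 1 + \<xi> G = 0, and in that case \<open>E\<close> would be an
  atom of \<open>\<mu>\<close>.\<close>

lemma (in finite_borel) simon_wolff:
  assumes \<mu>0: "finite_borel \<mu>0"
    and F: "\<And>z. Im z > 0 \<Longrightarrow> stieltjes \<mu> z * (1 + of_real \<xi> * stieltjes \<mu>0 z) = stieltjes \<mu>0 z"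
    and E: "E \<notin> singular_part \<mu>0" and no_atom: "emeasure \<mu> {E} = 0"
  shows "E \<notin> singular_part \<mu>"
proof -
  interpret m0: finite_borel \<mu>0 by fact
  define \<epsilon> where "\<epsilon> = (\<lambda>n. 1 / real (Suc n))"
  define z where "z = (\<lambda>n. Complex E (\<epsilon> n))"
  define g where "g = (\<lambda>n. stieltjes \<mu>0 (z n))"
  have \<epsilon>: "\<epsilon> n > 0" for n by (simp add: \<epsilon>_def)
  have \<epsilon>0: "\<epsilon> \<longlonglongrightarrow> 0" unfolding \<epsilon>_def by (rule LIMSEQ_Suc[OF lim_const_over_n])
  have Imz: "Im (z n) > 0" for n by (simp add: z_def \<epsilon>)
  obtain C where C: "\<And>n. res2 \<mu>0 (z n) \<le> real C"
    using E by (auto simp: singular_part_def z_def \<epsilon>_def)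
  \<comment> \<open>1 / x - 1 / y = (y - x) / (x y), and 1 / |x y| is at most the mean of |x|^(-2)
    and |y|^(-2), whose integrals are values of \<open>res2\<close>.\<close>
  have lip: "cmod (g n - g m) \<le> C * \<bar>\<epsilon> n - \<epsilon> m\<bar>" for n m
  proof -
    have "g n - g m = (\<integral>t. 1 / (of_real t - z n) - 1 / (of_real t - z m) \<partial>\<mu>0)"
      unfolding g_def stieltjes_def by (rule Bochner_Integration.integral_diff[symmetric]) (rule m0.integrable_kernel, rule Imz)+
    also have "cmod \<dots> \<le> (\<integral>t. \<bar>\<epsilon> n - \<epsilon> m\<bar> * ((1 / (cmod (of_real t - z n))\<^sup>2 + 1 / (cmod (of_real t - z m))\<^sup>2) / 2) \<partial>\<mu>0)"
    proof (rule Bochner_Integration.integral_norm_bound_integral)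
      show "integrable \<mu>0 (\<lambda>t. 1 / (of_real t - z n) - 1 / (of_real t - z m))"
        by (intro Bochner_Integration.integrable_diff m0.integrable_kernel Imz)
      show "integrable \<mu>0 (\<lambda>t. \<bar>\<epsilon> n - \<epsilon> m\<bar> * ((1 / (cmod (of_real t - z n))\<^sup>2 + 1 / (cmod (of_real t - z m))\<^sup>2) / 2))"
        by (intro integrable_mult_right integrable_divide Bochner_Integration.integrable_add m0.integrable_kernel2 Imz)
      fix t
      define x y where "x = of_real t - z n" and "y = of_real t - z m"
      have xy: "x \<noteq> 0" "y \<noteq> 0" using Im_le_cmod_diff[OF Imz, of n t] Im_le_cmod_diff[OF Imz, of m t] Imz[of n] Imz[of m]
        by (auto simp: x_def y_def)
      have "1 / x - 1 / y = (y - x) / (x * y)" using xy by (simp add: field_simps)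
      moreover have "y - x = Complex 0 (\<epsilon> n - \<epsilon> m)" by (simp add: x_def y_def z_def complex_eq_iff)
      moreover have "cmod (Complex 0 (\<epsilon> n - \<epsilon> m)) = \<bar>\<epsilon> n - \<epsilon> m\<bar>" by (simp add: cmod_def)
      ultimately have "cmod (1 / x - 1 / y) = \<bar>\<epsilon> n - \<epsilon> m\<bar> * ((1 / cmod x) * (1 / cmod y))"
        by (simp add: norm_divide norm_mult)
      also have "\<dots> \<le> \<bar>\<epsilon> n - \<epsilon> m\<bar> * (((1 / cmod x)\<^sup>2 + (1 / cmod y)\<^sup>2) / 2)"
        using sum_squares_bound[of "1 / cmod x" "1 / cmod y"] by (intro mult_left_mono) auto
      finally show "cmod (1 / (of_real t - z n) - 1 / (of_real t - z m))
         \<le> \<bar>\<epsilon> n - \<epsilon> m\<bar> * ((1 / (cmod (of_real t - z n))\<^sup>2 + 1 / (cmod (of_real t - z m))\<^sup>2) / 2)"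
        by (simp add: x_def y_def power_divide)
    qed
    also have "\<dots> = \<bar>\<epsilon> n - \<epsilon> m\<bar> * ((res2 \<mu>0 (z n) + res2 \<mu>0 (z m)) / 2)"
      unfolding res2_def using m0.integrable_kernel2[OF Imz, of n] m0.integrable_kernel2[OF Imz, of m]
      by (subst integral_mult_right_zero, subst integral_divide_zero, subst Bochner_Integration.integral_add) auto
    also have "\<dots> \<le> \<bar>\<epsilon> n - \<epsilon> m\<bar> * C"
      using C[of n] C[of m] by (intro mult_left_mono) auto
    finally show ?thesis by (simp add: mult.commute)
  qed
  have "Cauchy g"
  proof (rule metric_CauchyI)
    fix e :: real assume "e > 0"
    define d where "d = e / (real C + 1)"
    have d: "d > 0" using \<open>e > 0\<close> by (simp add: d_def)
    obtain M where M: "\<And>n m. n \<ge> M \<Longrightarrow> m \<ge> M \<Longrightarrow> dist (\<epsilon> n) (\<epsilon> m) < d"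
      using metric_CauchyD[OF LIMSEQ_imp_Cauchy[OF \<epsilon>0] d] by blast
    have "dist (g m) (g n) < e" if "m \<ge> M" "n \<ge> M" for m n
    proof -
      have "dist (g m) (g n) \<le> C * dist (\<epsilon> m) (\<epsilon> n)" using lip[of m n] by (simp add: dist_norm)
      also have "\<dots> \<le> C * d" using M[OF that] by (intro mult_left_mono) auto
      also have "\<dots> < (real C + 1) * d" using d by simp
      also have "\<dots> = e" by (simp add: d_def)
      finally show ?thesis .
    qed
    then show "\<exists>M. \<forall>m\<ge>M. \<forall>n\<ge>M. dist (g m) (g n) < e" by blast
  qed
  then obtain G where G: "g \<longlonglongrightarrow> G" using Cauchy_convergent convergent_def by blast
  have gG: "cmod (g n - G) \<le> C * \<epsilon> n" for n
  proof (rule LIMSEQ_le)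
    show "(\<lambda>m. cmod (g n - g m)) \<longlonglongrightarrow> cmod (g n - G)" by (intro tendsto_intros G)
    show "(\<lambda>m. C * \<bar>\<epsilon> n - \<epsilon> m\<bar>) \<longlonglongrightarrow> C * \<epsilon> n"
      using tendsto_mult[OF tendsto_const[of "real C"] tendsto_rabs[OF tendsto_diff[OF tendsto_const[of "\<epsilon> n"] \<epsilon>0]]] \<epsilon>[of n]
      by simp
  qed (use lip in auto)
  define w where "w = (\<lambda>n. 1 + of_real \<xi> * g n)"
  have Fw: "stieltjes \<mu> (z n) * w n = g n" for n using F[OF Imz] by (simp add: w_def g_def)
  \<comment> \<open>If \<open>w n\<close> were 0, \<open>Fw\<close> would give
    \<open>g n = 0\<close> and thereby \<open>w n = 1\<close>.\<close>
  have w0: "w n \<noteq> 0" for n using Fw[of n] by (auto simp: w_def)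
  have res: "res2 \<mu> (z n) = res2 \<mu>0 (z n) * inverse ((cmod (w n))\<^sup>2)" for n
  proof -
    have "stieltjes \<mu> (z n) = g n / w n" using Fw[of n] w0[of n] by (simp add: field_simps)
    moreover have "Im (g n / w n) = Im (g n) / (cmod (w n))\<^sup>2"
      by (simp add: Im_divide cmod_power2 w_def) (simp add: algebra_simps)
    ultimately have "Im (stieltjes \<mu> (z n)) = Im (g n) / (cmod (w n))\<^sup>2" by simp
    then have "Im (z n) * res2 \<mu> (z n) = Im (z n) * res2 \<mu>0 (z n) / (cmod (w n))\<^sup>2"
      unfolding g_def Im_stieltjes[OF Imz] m0.Im_stieltjes[OF Imz] .
    then show ?thesis using Imz[of n] by (simp add: divide_inverse)
  qed
  have wG: "w \<longlonglongrightarrow> 1 + of_real \<xi> * G" unfolding w_def by (intro tendsto_intros G)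
  have "1 + of_real \<xi> * G \<noteq> 0"
  proof \<comment> \<open>otherwise \<open>\<epsilon> n * stieltjes \<mu> (z n)\<close> stays away from \<open>0\<close>, so that \<open>E\<close> is an atom of \<open>\<mu>\<close>\<close>
    assume 0: "1 + of_real \<xi> * G = 0"
    have "cmod (w n) \<le> \<bar>\<xi>\<bar> * (C * \<epsilon> n)" for n
    proof -
      have "w n = of_real \<xi> * (g n - G)" using 0 by (simp add: w_def algebra_simps)
      then show ?thesis using gG[of n] by (simp add: norm_mult mult_left_mono)
    qed
    then have le: "cmod (g n) \<le> \<bar>\<xi>\<bar> * C * cmod (\<epsilon> n * stieltjes \<mu> (z n))" for n
    proof -
      have "cmod (g n) = cmod (stieltjes \<mu> (z n)) * cmod (w n)" by (simp add: norm_mult flip: Fw)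
      also have "\<dots> \<le> cmod (stieltjes \<mu> (z n)) * (\<bar>\<xi>\<bar> * (C * \<epsilon> n))"
        using \<open>cmod (w n) \<le> _\<close> by (intro mult_left_mono) auto
      finally show ?thesis using \<epsilon>[of n] by (simp add: norm_mult mult_ac)
    qed
    have "(\<lambda>n. (\<integral>t. \<epsilon> n * (1 / (of_real t - z n)) \<partial>\<mu>)) \<longlonglongrightarrow> (\<integral>t. 0 \<partial>\<mu>)"
    proof (rule integral_dominated_convergence[where w = "\<lambda>_. 1"])
      have "AE t in \<mu>. t \<noteq> E"
        using no_atom by (intro AE_I[of _ _ "{E}"]) auto
      then show "AE t in \<mu>. (\<lambda>n. \<epsilon> n * (1 / (of_real t - z n))) \<longlonglongrightarrow> 0"
      proof eventually_elim
        case (elim t)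
        have z: "z \<longlonglongrightarrow> Complex E 0" unfolding z_def by (intro tendsto_intros \<epsilon>0)
        have "(\<lambda>n. of_real (\<epsilon> n) * (1 / (of_real t - z n))) \<longlonglongrightarrow> of_real 0 * (1 / (of_real t - Complex E 0))"
          using elim by (intro tendsto_intros \<epsilon>0 z) (auto simp: complex_eq_iff)
        then show ?case by simp
      qed
      show "AE t in \<mu>. norm (\<epsilon> n * (1 / (of_real t - z n))) \<le> 1" for n
      proof (rule AE_I2)
        fix t show "norm (\<epsilon> n * (1 / (of_real t - z n))) \<le> 1"
          using mult_left_mono[OF norm_kernel_le[OF Imz, of t n], of "\<epsilon> n"] \<epsilon>[of n]
          by (simp add: norm_mult norm_divide z_def)
      qed
    qed (auto)
    then have "(\<lambda>n. \<epsilon> n * stieltjes \<mu> (z n)) \<longlonglongrightarrow> 0" by (simp add: stieltjes_def del: times_divide_eq_right)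
    from tendsto_mult[OF tendsto_const[of "\<bar>\<xi>\<bar> * C"] tendsto_norm[OF this]]
    have lim0: "(\<lambda>n. \<bar>\<xi>\<bar> * C * cmod (\<epsilon> n * stieltjes \<mu> (z n))) \<longlonglongrightarrow> 0" by simp
    \<comment> \<open>The bound in \<open>le\<close> tends to 0, so \<open>G = 0\<close>, against 1
      + \<xi> G = 0.\<close>
    have "cmod G \<le> 0"
      by (rule LIMSEQ_le[OF tendsto_norm[OF G] lim0]) (use le in auto)
    then show False using 0 by simp
  qed
  then have "(\<lambda>n. inverse ((cmod (w n))\<^sup>2)) \<longlonglongrightarrow> inverse ((cmod (1 + of_real \<xi> * G))\<^sup>2)"
    by (intro tendsto_intros wG) auto
  then have "Bseq (\<lambda>n. inverse ((cmod (w n))\<^sup>2))" by (intro convergent_imp_Bseq) (auto simp: convergent_def)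
  then obtain B where B: "\<And>n. norm (inverse ((cmod (w n))\<^sup>2)) \<le> B" by (auto simp: Bseq_def)
  have "res2 \<mu> (z n) \<le> C * B" for n
    unfolding res using C[of n] B[of n] m0.res2_nonneg[of "z n"] by (intro mult_mono) auto
  moreover obtain k where "C * B \<le> real k" using real_arch_simple by blast
  ultimately have "\<forall>n. res2 \<mu> (z n) \<le> real k" by (meson order_trans)
  then show ?thesis by (auto simp: singular_part_def z_def \<epsilon>_def)
qed

section \<open>Poisson integrals: mass of open sets, spectral averaging, vague convergence\<close>

text \<open>Im stieltjes / pi is the density of \<open>\<mu>\<close> smoothed by Poisson kernels. A
  point of an open set keeps the whole unit mass of its kernel in the limit; Fatou's lemma, used
  over the kernel variable and again over \<open>\<mu>\<close>, gives the inequality. It bounds mass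
  by means of the transform alone.\<close>

lemma (in finite_borel) open_le_liminf_stieltjes:
  assumes S: "open S"
  shows "emeasure \<mu> S \<le> liminf (\<lambda>n. \<integral>\<^sup>+E. indicator S E * ennreal (Im (stieltjes \<mu> (Complex E (1 / Suc n))) / pi) \<partial>lborel)"
proof -
  have [measurable]: "S \<in> sets borel" using S by simp
  define p where "p = (\<lambda>n t E. ennreal ((1 / Suc n) / ((t - E)\<^sup>2 + (1 / Suc n)\<^sup>2)))"
  have [measurable]: "(\<lambda>(t, E). p n t E) \<in> borel_measurable (\<mu> \<Otimes>\<^sub>M lborel)"
     "(\<lambda>(E, t). p n t E) \<in> borel_measurable (lborel \<Otimes>\<^sub>M \<mu>)" for n
    unfolding p_def by measurable
  interpret P: pair_sigma_finite \<mu> lborel ..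
  have Im: "ennreal (Im (stieltjes \<mu> (Complex E (1 / Suc n))) / pi) = ennreal (1 / pi) * (\<integral>\<^sup>+t. p n t E \<partial>\<mu>)" for n E
  proof -
    have "(\<integral>\<^sup>+t. p n t E \<partial>\<mu>) = (\<integral>\<^sup>+t. ennreal (1 / Suc n) * ennreal (1 / (cmod (of_real t - Complex E (1 / Suc n)))\<^sup>2) \<partial>\<mu>)"
      unfolding p_def cmod_diff_Complex by (intro nn_integral_cong) (simp add: ennreal_mult[symmetric] del: of_nat_Suc)
    also have "\<dots> = ennreal (1 / Suc n) * (\<integral>\<^sup>+t. ennreal (1 / (cmod (of_real t - Complex E (1 / Suc n)))\<^sup>2) \<partial>\<mu>)"
      by (rule nn_integral_cmult) measurable
    also have "(\<integral>\<^sup>+t. ennreal (1 / (cmod (of_real t - Complex E (1 / Suc n)))\<^sup>2) \<partial>\<mu>) = ennreal (res2 \<mu> (Complex E (1 / Suc n)))"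
      unfolding res2_def by (intro nn_integral_eq_integral integrable_kernel2) auto
    finally show ?thesis
      by (simp add: Im_stieltjes res2_nonneg ennreal_mult[symmetric] del: of_nat_Suc)
  qed
  \<comment> \<open>Rescaling by the width fixes the kernel and moves \<open>n\<close> into the
    indicator, where openness of \<open>S\<close> settles the limit.\<close>
  have inner: "(\<integral>\<^sup>+E. indicator S E * p n t E \<partial>lborel)
     = (\<integral>\<^sup>+x. indicator S (t + 1 / Suc n * x) * ennreal (1 / (1 + x\<^sup>2)) \<partial>lborel)" for n t
  proof -
    define b where "b = 1 / real (Suc n)"
    have b: "b > 0" by (simp add: b_def)
    have "(\<integral>\<^sup>+E. indicator S E * p n t E \<partial>lborel)
      = ennreal \<bar>b\<bar> * (\<integral>\<^sup>+x. indicator S (t + b * x) * p n t (t + b * x) \<partial>lborel)"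
      using b by (subst nn_integral_real_affine[where c = b and t = t]) auto
    also have "\<dots> = (\<integral>\<^sup>+x. indicator S (t + b * x) * ennreal (b * (b / ((t - (t + b * x))\<^sup>2 + b\<^sup>2))) \<partial>lborel)"
      using b unfolding p_def b_def[symmetric]
      by (subst nn_integral_cmult[symmetric]) (auto simp: mult.left_commute[of "ennreal b"] ennreal_mult[symmetric] intro!: nn_integral_cong)
    finally show ?thesis by (simp only: cauchy_kernel_affine[OF b]) (simp only: b_def)
  qed
  have lim: "(\<lambda>n. indicator S (t + 1 / Suc n * x)  * c) \<longlonglongrightarrow> c" if "t \<in> S" for t x and c :: ennreal
  proof (rule tendsto_eventually)
    have "(\<lambda>n. t + 1 / real (Suc n) * x) \<longlonglongrightarrow> t + 0 * x"
      by (intro tendsto_intros LIMSEQ_Suc[OF lim_const_over_n])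
    then have "eventually (\<lambda>n. t + 1 / real (Suc n) * x \<in> S) sequentially"
      using S that by (simp add: tendsto_def)
    then show "eventually (\<lambda>n. indicator S (t + 1 / Suc n * x) * c = c) sequentially"
      by eventually_elim simp
  qed
  have low: "indicator S t \<le> ennreal (1 / pi) * liminf (\<lambda>n. \<integral>\<^sup>+E. indicator S E * p n t E \<partial>lborel)" for t
  proof (cases "t \<in> S")
    case True
    have "ennreal pi = (\<integral>\<^sup>+x. liminf (\<lambda>n. indicator S (t + 1 / Suc n * x) * ennreal (1 / (1 + x\<^sup>2))) \<partial>lborel)"
      unfolding nn_integral_cauchy_kernel[symmetric]
    proof (intro nn_integral_cong)
      fix x :: real
      have "(\<lambda>n. indicator S (t + 1 / Suc n * x) * ennreal (1 / (1 + x\<^sup>2))) \<longlonglongrightarrow> ennreal (1 / (1 + x\<^sup>2))"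
        by (rule lim[OF True])
      then show "ennreal (1 / (1 + x\<^sup>2)) = liminf (\<lambda>n. indicator S (t + 1 / Suc n * x) * ennreal (1 / (1 + x\<^sup>2)))"
        using lim_imp_Liminf[OF sequentially_bot] by fastforce
    qed
    also have "\<dots> \<le> liminf (\<lambda>n. \<integral>\<^sup>+x. indicator S (t + 1 / Suc n * x) * ennreal (1 / (1 + x\<^sup>2)) \<partial>lborel)"
      by (rule nn_integral_liminf) measurable
    finally have "ennreal (1 / pi) * ennreal pi \<le> ennreal (1 / pi) * liminf (\<lambda>n. \<integral>\<^sup>+E. indicator S E * p n t E \<partial>lborel)"
      unfolding inner by (rule mult_left_mono) simp
    then show ?thesis using True by (simp add: ennreal_mult[symmetric])
  qed simp
  have "emeasure \<mu> S = (\<integral>\<^sup>+t. indicator S t \<partial>\<mu>)" by simp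
  also have "\<dots> \<le> (\<integral>\<^sup>+t. ennreal (1 / pi) * liminf (\<lambda>n. \<integral>\<^sup>+E. indicator S E * p n t E \<partial>lborel) \<partial>\<mu>)"
    by (intro nn_integral_mono low)
  also have "\<dots> = ennreal (1 / pi) * (\<integral>\<^sup>+t. liminf (\<lambda>n. \<integral>\<^sup>+E. indicator S E * p n t E \<partial>lborel) \<partial>\<mu>)"
    by (rule nn_integral_cmult) measurable
  also have "\<dots> \<le> ennreal (1 / pi) * liminf (\<lambda>n. \<integral>\<^sup>+t. \<integral>\<^sup>+E. indicator S E * p n t E \<partial>lborel \<partial>\<mu>)"
    by (intro mult_left_mono nn_integral_liminf) auto
  also have "\<dots> = liminf (\<lambda>n. ennreal (1 / pi) * (\<integral>\<^sup>+t. \<integral>\<^sup>+E. indicator S E * p n t E \<partial>lborel \<partial>\<mu>))"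
    by (rule Liminf_compose_continuous_mono[where f = "\<lambda>x. ennreal (1 / pi) * x", symmetric])
      (auto intro!: continuous_intros ennreal_continuous_on_cmult monoI mult_left_mono)
  also have "(\<lambda>n. ennreal (1 / pi) * (\<integral>\<^sup>+t. \<integral>\<^sup>+E. indicator S E * p n t E \<partial>lborel \<partial>\<mu>))
     = (\<lambda>n. \<integral>\<^sup>+E. indicator S E * ennreal (Im (stieltjes \<mu> (Complex E (1 / Suc n))) / pi) \<partial>lborel)"
  proof
    fix n
    have "(\<integral>\<^sup>+t. \<integral>\<^sup>+E. indicator S E * p n t E \<partial>lborel \<partial>\<mu>) = (\<integral>\<^sup>+E. \<integral>\<^sup>+t. indicator S E * p n t E \<partial>\<mu> \<partial>lborel)"
      by (rule P.Fubini'[symmetric]) measurable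
    also have "\<dots> = (\<integral>\<^sup>+E. indicator S E * (\<integral>\<^sup>+t. p n t E \<partial>\<mu>) \<partial>lborel)"
      by (intro nn_integral_cong nn_integral_cmult) measurable
    finally have *: "(\<integral>\<^sup>+t. \<integral>\<^sup>+E. indicator S E * p n t E \<partial>lborel \<partial>\<mu>)
      = (\<integral>\<^sup>+E. indicator S E * (\<integral>\<^sup>+t. p n t E \<partial>\<mu>) \<partial>lborel)" .
    show "ennreal (1 / pi) * (\<integral>\<^sup>+t. \<integral>\<^sup>+E. indicator S E * p n t E \<partial>lborel \<partial>\<mu>)
     = (\<integral>\<^sup>+E. indicator S E * ennreal (Im (stieltjes \<mu> (Complex E (1 / Suc n))) / pi) \<partial>lborel)"
      unfolding * Im
      by (subst nn_integral_cmult[symmetric]) (auto simp: mult_ac)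
  qed
  finally show ?thesis .
qed

text \<open>Spectral averaging: F \<xi> = 1 / (1 / g + \<xi>), whose imaginary part is a Poisson
  kernel in \<xi> of width - Im (1 / g), with integral pi whatever \<open>g\<close> is.\<close>

lemma nn_integral_rank_one_average:
  assumes g: "Im g > 0" and F: "\<And>\<xi>::real. F \<xi> * (1 + of_real \<xi> * g) = g"
  shows "(\<integral>\<^sup>+\<xi>. ennreal (Im (F \<xi>) / pi) \<partial>lborel) = 1"
proof -
  have g0: "g \<noteq> 0" using g by auto
  define w where "w = 1 / g"
  define b where "b = - Im w"
  have b: "b > 0" using g g0 by (simp add: b_def w_def Im_divide divide_neg_pos complex_neq_0)
  have "ennreal (Im (F \<xi>) / pi) = ennreal (1 / pi) * ennreal (b / ((- Re w - \<xi>)\<^sup>2 + b\<^sup>2))" for \<xi>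
  proof -
    have nz: "1 + of_real \<xi> * g \<noteq> 0" using F[of \<xi>] g0 by auto
    have "F \<xi> = 1 / (w + of_real \<xi>)"
      using F[of \<xi>] nz g0 by (simp add: w_def field_simps)
    then have "Im (F \<xi>) = b / ((Re w + \<xi>)\<^sup>2 + b\<^sup>2)" by (simp add: Im_divide b_def)
    moreover have "(- Re w - \<xi>)\<^sup>2 = (Re w + \<xi>)\<^sup>2" by (simp add: power2_eq_square algebra_simps)
    ultimately show ?thesis using b by (simp add: ennreal_mult[symmetric])
  qed
  then have "(\<integral>\<^sup>+\<xi>. ennreal (Im (F \<xi>) / pi) \<partial>lborel) = ennreal (1 / pi) * ennreal pi"
    by (simp add: nn_integral_cmult nn_integral_poisson_kernel[OF b] del: ennreal_1)
  then show ?thesis by (simp add: ennreal_mult[symmetric])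
qed

text \<open>Inner regularity puts almost all of \<open>\<mu>\<close> on a compact subset
  \<open>K\<close> of \<open>T\<close>, which is null for \<open>\<nu>\<close>; tents over
  \<open>K\<close> shrink to its indicator, so their \<open>\<nu>\<close>-integrals tend to 0.
  Lipschitz continuity and bounded support are what \<open>stieltjes_imp_vague\<close> asks of a
  test function.\<close>

lemma (in finite_borel) separating_function:
  assumes \<nu>: "finite_borel \<nu>" and T: "T \<in> sets borel"
    and null: "emeasure \<mu> (- T) = 0" "emeasure \<nu> T = 0" and \<tau>: "\<tau> > 0"
  shows "\<exists>f D R. (\<forall>x. 0 \<le> f x \<and> f x \<le> 1) \<and> (\<forall>x y. \<bar>f x - f y\<bar> \<le> D * \<bar>x - y\<bar>) \<and> (\<forall>x. \<bar>x\<bar> > R \<longrightarrow> f x = 0)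
     \<and> measure \<mu> UNIV - \<tau> \<le> (\<integral>t. f t \<partial>\<mu>) \<and> (\<integral>t. f t \<partial>\<nu>) \<le> \<tau>"
proof (cases "measure \<mu> UNIV \<le> \<tau>")
  case True
  then show ?thesis using \<tau> by (intro exI[of _ "\<lambda>_. 0"] exI[of _ 0] exI[of _ "0::real"]) auto
next
  case False
  interpret \<nu>: finite_borel \<nu> by fact
  have "emeasure \<mu> T + emeasure \<mu> (- T) = emeasure \<mu> UNIV"
    using T by (subst plus_emeasure) (auto simp: Compl_partition)
  then have muT: "emeasure \<mu> T = ennreal (measure \<mu> UNIV)" using null by (simp add: emeasure_eq_measure)
  have "ennreal (measure \<mu> UNIV - \<tau>) < emeasure \<mu> T"
    unfolding muT using \<tau> False by (intro ennreal_lessI) auto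
  also have "\<dots> = (SUP K \<in> {K. K \<subseteq> T \<and> compact K}. emeasure \<mu> K)"
    by (rule inner_regular) (use T in \<open>auto simp: emeasure_eq_measure\<close>)
  finally obtain K where K: "K \<subseteq> T" "compact K" "ennreal (measure \<mu> UNIV - \<tau>) < emeasure \<mu> K"
    by (auto simp: less_SUP_iff)
  have [measurable]: "K \<in> sets borel" using K(2) by (simp add: borel_compact)
  have mK: "measure \<mu> UNIV - \<tau> \<le> measure \<mu> K"
    using K(3) False by (simp add: emeasure_eq_measure ennreal_less_iff)
  \<comment> \<open>The distance to an empty set would be 0 by convention, and the tents would not
    localise.\<close>
  have "K \<noteq> {}" using K(3) by auto
  have \<nu>K: "measure \<nu> K = 0"
    using emeasure_mono[of K T \<nu>] K(1) T null(2) by (simp add: \<nu>.emeasure_eq_measure measure_le_0_iff)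
  define f where "f = (\<lambda>n x. max 0 (1 - real n * infdist x K))"
  have f01: "0 \<le> f n x" "f n x \<le> 1" for n x by (auto simp: f_def infdist_nonneg)
  have [measurable]: "f n \<in> borel_measurable borel" for n
    unfolding f_def by (intro borel_measurable_continuous_onI continuous_intros)
  have lip: "\<bar>f n x - f n y\<bar> \<le> real n * \<bar>x - y\<bar>" for n x y
  proof -
    have "\<bar>infdist x K - infdist y K\<bar> \<le> \<bar>x - y\<bar>"
      using infdist_triangle_abs[of x K y] by (simp add: dist_real_def)
    then have "real n * \<bar>infdist x K - infdist y K\<bar> \<le> real n * \<bar>x - y\<bar>" by (rule mult_left_mono) simp
    moreover have "\<bar>f n x - f n y\<bar> \<le> \<bar>real n * (infdist x K - infdist y K)\<bar>"
      unfolding f_def right_diff_distrib by linarith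
    ultimately show ?thesis by (simp add: abs_mult)
  qed
  have "(\<lambda>n. \<integral>t. f n t \<partial>\<nu>) \<longlonglongrightarrow> (\<integral>t. indicator K t \<partial>\<nu>)"
  proof (rule integral_dominated_convergence[where w = "\<lambda>_. 1"])
    show "AE x in \<nu>. (\<lambda>n. f n x) \<longlonglongrightarrow> indicator K x"
    proof (rule AE_I2)
      fix x
      show "(\<lambda>n. f n x) \<longlonglongrightarrow> indicator K x"
      proof (cases "x \<in> K")
        case True
        then show ?thesis by (simp add: f_def)
      next
        case False
        then have pos: "infdist x K > 0"
          using K(2) \<open>K \<noteq> {}\<close> in_closed_iff_infdist_zero[of K x] infdist_nonneg[of x K]
          by (metis compact_imp_closed order_le_less)
        obtain N where N: "1 / infdist x K < real N" using reals_Archimedean2 by blast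
        have "f n x = 0" if "n \<ge> N" for n
        proof -
          have "1 / infdist x K \<le> real n" using N that by (meson less_imp_le of_nat_mono order_trans)
          then show ?thesis using pos by (simp add: f_def divide_le_eq)
        qed
        then have "eventually (\<lambda>n. f n x = indicator K x) sequentially"
          using False by (auto simp: eventually_sequentially)
        then show ?thesis by (rule tendsto_eventually)
      qed
    qed
  qed (auto simp: f01 abs_le_iff intro: order_trans[OF _ f01(2)])
  then have "(\<lambda>n. \<integral>t. f n t \<partial>\<nu>) \<longlonglongrightarrow> 0" using \<nu>K by simp
  then have "eventually (\<lambda>n. (\<integral>t. f n t \<partial>\<nu>) < \<tau>) sequentially" using \<tau> by (rule order_tendstoD)
  with eventually_gt_at_top[of 0] have "eventually (\<lambda>n. n > 0 \<and> (\<integral>t. f n t \<partial>\<nu>) < \<tau>) sequentially"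
    by eventually_elim auto
  then obtain n where n: "n > 0" "(\<integral>t. f n t \<partial>\<nu>) < \<tau>" by (auto simp: eventually_sequentially)
  obtain R where R: "\<And>x. x \<in> K \<Longrightarrow> \<bar>x\<bar> \<le> R" using compact_imp_bounded[OF K(2)] by (auto simp: bounded_iff)
  \<comment> \<open>\<open>K\<close> lies in [-R, R]; beyond R + 1 its distance is at least 1, and
    \<open>n > 0\<close> makes the tent vanish there.\<close>
  have supp: "f n x = 0" if "\<bar>x\<bar> > R + 1" for x
  proof -
    have "1 \<le> infdist x K"
      unfolding infdist_notempty[OF \<open>K \<noteq> {}\<close>]
      by (intro cINF_greatest \<open>K \<noteq> {}\<close>) (use R that in \<open>force simp: dist_real_def\<close>)
    moreover have "1 * 1 \<le> real n * infdist x K" using n(1) calculation by (intro mult_mono) auto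
    ultimately show ?thesis by (simp add: f_def)
  qed
  have "measure \<mu> K \<le> (\<integral>t. f n t \<partial>\<mu>)"
  proof -
    have "measure \<mu> K = (\<integral>t. indicator K t \<partial>\<mu>)" by simp
    also have "\<dots> \<le> (\<integral>t. f n t \<partial>\<mu>)"
    proof (rule integral_mono)
      show "integrable \<mu> (f n)" by (rule integrable_const_bound[of _ 1]) (auto simp: f01)
      show "integrable \<mu> (indicator K :: real \<Rightarrow> real)" by (intro integrable_real_indicator) (auto simp: emeasure_eq_measure)
      show "indicator K t \<le> f n t" for t using f01 by (auto simp: indicator_def f_def)
    qed
    finally show ?thesis .
  qed
  then show ?thesis using f01 lip supp n(2) mK
    by (intro exI[of _ "f n"] exI[of _ "real n"] exI[of _ "R + 1"]) (auto simp: less_imp_le intro: order_trans)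
qed

text \<open>The Poisson integral of \<open>f\<close> at the point t + i b, in the variable x = (E -
  t) / b, in which the kernel does not depend on \<open>t\<close> and \<open>b\<close>.\<close>

definition poisson :: "(real \<Rightarrow> real) \<Rightarrow> real \<Rightarrow> real \<Rightarrow> real" where
  "poisson f b t = (LBINT x. f (t + b * x) / (1 + x\<^sup>2)) / pi"

lemma poisson_approx:
  fixes f :: "real \<Rightarrow> real"
  assumes f01: "\<And>x. 0 \<le> f x" "\<And>x. f x \<le> 1" and lip: "\<And>x y. \<bar>f x - f y\<bar> \<le> D * \<bar>x - y\<bar>"
    and [measurable]: "f \<in> borel_measurable borel" and e: "e > 0"
  shows "\<exists>b>0. \<forall>t. \<bar>poisson f b t - f t\<bar> \<le> e"
proof -
  have D: "D \<ge> 0" using lip[of 1 0] by (simp add: order_trans[OF abs_ge_zero])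
  \<comment> \<open>Since |x| / (1 + x^2) is not integrable, the Lipschitz bound is capped by 1,
    which also bounds the increment as \<open>f\<close> takes values in [0, 1]. The bound is free of
    \<open>t\<close>, whence the uniformity.\<close>
  define h where "h = (\<lambda>b x. min 1 (D * b * \<bar>x\<bar>) / (1 + x\<^sup>2) :: real)"
  have pos: "1 + x\<^sup>2 > (0::real)" for x by (rule add_pos_nonneg) auto
  have hle: "norm (h b x) \<le> 1 / (1 + x\<^sup>2)" if "b \<ge> 0" for b x
    using D that pos[of x] by (auto simp: h_def intro!: divide_right_mono)
  have h_int: "integrable lborel (h b)" if "b \<ge> 0" for b
    by (rule Bochner_Integration.integrable_bound[OF integral_cauchy_kernel(1)])
      (use hle[OF that] pos in \<open>auto simp: h_def intro!: less_imp_le\<close>)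
  have f_int: "integrable lborel (\<lambda>x. f (t + b * x) / (1 + x\<^sup>2))" for t b
    by (rule Bochner_Integration.integrable_bound[OF integral_cauchy_kernel(1)])
      (use f01 pos in \<open>auto intro!: divide_right_mono simp: less_imp_le\<close>)
  have "(\<lambda>n. LBINT x. h (1 / Suc n) x) \<longlonglongrightarrow> (LBINT x::real. 0)"
  proof (rule integral_dominated_convergence[OF _ _ integral_cauchy_kernel(1)])
    show "AE x in lborel. (\<lambda>n. h (1 / Suc n) x) \<longlonglongrightarrow> 0"
    proof (rule AE_I2)
      fix x
      have "(\<lambda>n. h (1 / real (Suc n)) x) \<longlonglongrightarrow> min 1 (D * 0 * \<bar>x\<bar>) / (1 + x\<^sup>2)"
        unfolding h_def using pos[of x] by (intro tendsto_intros LIMSEQ_Suc[OF lim_const_over_n]) auto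
      then show "(\<lambda>n. h (1 / Suc n) x) \<longlonglongrightarrow> 0" by simp
    qed
    show "AE x in lborel. norm (h (1 / Suc n) x) \<le> 1 / (1 + x\<^sup>2)" for n
      by (rule AE_I2, rule hle) simp
  qed (auto simp: h_def)
  then have "eventually (\<lambda>n. (LBINT x. h (1 / Suc n) x) < e * pi) sequentially"
    using e by (intro order_tendstoD) auto
  then obtain n where n: "(LBINT x. h (1 / Suc n) x) < e * pi" by (auto simp: eventually_sequentially)
  define b where "b = 1 / real (Suc n)"
  have b: "b > 0" by (simp add: b_def)
  have "\<bar>poisson f b t - f t\<bar> \<le> e" for t
  proof -
    have "pi * (poisson f b t - f t) = (LBINT x. f (t + b * x) / (1 + x\<^sup>2)) - f t * pi"
      by (simp add: poisson_def algebra_simps)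
    also have "\<dots> = (LBINT x. f (t + b * x) / (1 + x\<^sup>2)) - (LBINT x. f t * (1 / (1 + x\<^sup>2)))"
      by (simp only: integral_mult_right_zero integral_cauchy_kernel(2))
    also have "\<dots> = (LBINT x. f (t + b * x) / (1 + x\<^sup>2) - f t * (1 / (1 + x\<^sup>2)))"
      by (rule Bochner_Integration.integral_diff[symmetric, OF f_int]) (intro integrable_mult_right integral_cauchy_kernel(1))
    finally have "\<bar>pi * (poisson f b t - f t)\<bar> = norm (LBINT x. f (t + b * x) / (1 + x\<^sup>2) - f t * (1 / (1 + x\<^sup>2)))"
      by simp
    also have "\<dots> \<le> (LBINT x. h b x)"
    proof (rule Bochner_Integration.integral_norm_bound_integral)
      show "integrable lborel (\<lambda>x. f (t + b * x) / (1 + x\<^sup>2) - f t * (1 / (1 + x\<^sup>2)))"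
        by (intro Bochner_Integration.integrable_diff f_int integrable_mult_right integral_cauchy_kernel(1))
      show "integrable lborel (h b)" using b by (intro h_int) simp
      fix x
      have "\<bar>f (t + b * x) - f t\<bar> \<le> D * b * \<bar>x\<bar>" using lip[of "t + b * x" t] b by (simp add: abs_mult mult_ac)
      moreover have "\<bar>f (t + b * x) - f t\<bar> \<le> 1" using f01[of "t + b * x"] f01[of t] by linarith
      ultimately have "\<bar>f (t + b * x) - f t\<bar> / (1 + x\<^sup>2) \<le> h b x"
        unfolding h_def using pos[of x] by (intro divide_right_mono) auto
      then show "norm (f (t + b * x) / (1 + x\<^sup>2) - f t * (1 / (1 + x\<^sup>2))) \<le> h b x"
        using pos[of x] by (simp add: abs_divide flip: diff_divide_distrib)
    qed
    also have "\<dots> \<le> e * pi" using n by (simp add: b_def)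
    finally show ?thesis by (simp add: abs_mult mult.commute)
  qed
  then show ?thesis using b by blast
qed

text \<open>Fubini for the Poisson kernel, which is symmetric in \<open>t\<close> and
  \<open>E\<close>. Bounded support of \<open>f\<close> and \<open>b > 0\<close> keep the integrand
  bounded on a strip of finite measure.\<close>

lemma (in finite_borel) integral_poisson:
  fixes f :: "real \<Rightarrow> real"
  assumes f01: "\<And>x. 0 \<le> f x" "\<And>x. f x \<le> 1" and supp: "\<And>x. \<bar>x\<bar> > R \<Longrightarrow> f x = 0"
    and [measurable]: "f \<in> borel_measurable borel" and b: "b > 0"
  shows "(\<integral>t. poisson f b t \<partial>\<mu>) = (LBINT E. f E * (Im (stieltjes \<mu> (Complex E b)) / pi))"
proof -
  define k where "k = (\<lambda>E t. f E * (b / ((t - E)\<^sup>2 + b\<^sup>2) / pi))"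
  interpret P: pair_sigma_finite lborel \<mu> ..
  have [measurable]: "(\<lambda>(E, t). k E t) \<in> borel_measurable (lborel \<Otimes>\<^sub>M \<mu>)"
    unfolding k_def by measurable
  have den: "(t - E)\<^sup>2 + b\<^sup>2 > 0" for t E using b by (intro add_nonneg_pos) auto
  have kb: "b / ((t - E)\<^sup>2 + b\<^sup>2) \<le> 1 / b" for t E
  proof -
    have "b / ((t - E)\<^sup>2 + b\<^sup>2) \<le> b / b\<^sup>2" using b by (intro divide_left_mono) (auto intro!: mult_pos_pos den)
    then show ?thesis using b by (simp add: power2_eq_square)
  qed
  have "integrable (lborel \<Otimes>\<^sub>M \<mu>) (\<lambda>x. indicator ({-R..R} \<times> UNIV) x *\<^sub>R (\<lambda>(E, t). k E t) x)"
  proof (rule integrableI_bounded_set_indicator[where B = "1 / b / pi"])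
    show "emeasure (lborel \<Otimes>\<^sub>M \<mu>) ({-R..R} \<times> UNIV) < \<infinity>"
      by (subst emeasure_pair_measure_Times) (auto simp: emeasure_eq_measure ennreal_mult_less_top emeasure_lborel_Icc_eq)
    show "AE x in lborel \<Otimes>\<^sub>M \<mu>. x \<in> {-R..R} \<times> UNIV \<longrightarrow> norm ((\<lambda>(E, t). k E t) x) \<le> 1 / b / pi"
    proof (rule AE_I2, clarify)
      fix E t :: real
      have "f E * (b / ((t - E)\<^sup>2 + b\<^sup>2) / pi) \<le> 1 * (1 / b / pi)"
        using f01 b den[of t E] by (intro mult_mono divide_right_mono kb) auto
      then show "norm (k E t) \<le> 1 / b / pi" using f01 b den[of t E] by (simp add: k_def less_imp_le)
    qed
  qed auto
  also have "(\<lambda>x. indicator ({-R..R} \<times> UNIV) x *\<^sub>R (\<lambda>(E, t). k E t) x) = (\<lambda>(E, t). k E t)"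
    using supp by (force simp: k_def indicator_def)
  finally have int: "integrable (lborel \<Otimes>\<^sub>M \<mu>) (\<lambda>(E, t). k E t)" .
  have "poisson f b t = (LBINT E. k E t)" for t
  proof -
    have "(LBINT E. k E t) = \<bar>b\<bar> *\<^sub>R (LBINT x. k (t + b * x) t)"
      using b by (intro lborel_integral_real_affine) auto
    also have "\<dots> = (LBINT x. b * k (t + b * x) t)" using b by simp
    also have "\<dots> = (LBINT x. f (t + b * x) / (1 + x\<^sup>2) / pi)"
    proof (intro Bochner_Integration.integral_cong refl)
      fix x
      have "b * k (t + b * x) t = f (t + b * x) * (b * (b / ((t - (t + b * x))\<^sup>2 + b\<^sup>2))) / pi"
        by (simp add: k_def)
      then show "b * k (t + b * x) t = f (t + b * x) / (1 + x\<^sup>2) / pi"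
        by (simp only: cauchy_kernel_affine[OF b]) simp
    qed
    also have "\<dots> = poisson f b t" unfolding poisson_def by (rule integral_divide_zero)
    finally show ?thesis by simp
  qed
  then have "(\<integral>t. poisson f b t \<partial>\<mu>) = (\<integral>t. (LBINT E. k E t) \<partial>\<mu>)" by simp
  also have "\<dots> = (LBINT E. (\<integral>t. k E t \<partial>\<mu>))" by (rule P.Fubini_integral[OF int])
  also have "\<dots> = (LBINT E. f E * (Im (stieltjes \<mu> (Complex E b)) / pi))"
  proof (intro Bochner_Integration.integral_cong refl)
    fix E
    have "(\<integral>t. k E t \<partial>\<mu>) = (\<integral>t. f E * b / pi * (1 / (cmod (of_real t - Complex E b))\<^sup>2) \<partial>\<mu>)"
      unfolding k_def cmod_diff_Complex by (simp add: mult.commute[of pi])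
    also have "\<dots> = f E * b / pi * res2 \<mu> (Complex E b)" unfolding res2_def by (rule integral_mult_right_zero)
    finally show "(\<integral>t. k E t \<partial>\<mu>) = f E * (Im (stieltjes \<mu> (Complex E b)) / pi)"
      using b by (simp add: Im_stieltjes)
  qed
  finally show ?thesis .
qed

lemma (in finite_borel) norm_stieltjes_le:
  assumes "Im z > 0" shows "cmod (stieltjes \<mu> z) \<le> measure \<mu> UNIV / Im z"
proof -
  have "cmod (stieltjes \<mu> z) \<le> (\<integral>t. 1 / Im z \<partial>\<mu>)"
    unfolding stieltjes_def
    by (rule Bochner_Integration.integral_norm_bound_integral)
      (use assms in \<open>auto intro: integrable_kernel norm_kernel_le\<close>)
  then show ?thesis by simp
qed

text \<open>After Poisson smoothing, the integral of \<open>f\<close> is an integral of Im stieltjes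
  at a fixed height over a bounded interval, where convergence is dominated by mass / b. Smoothing
  changes \<open>f\<close> uniformly little, and the masses are bounded.\<close>

lemma stieltjes_imp_vague:
  fixes \<mu> :: "nat \<Rightarrow> real measure"
  assumes fb: "\<And>r. finite_borel (\<mu> r)" "finite_borel \<nu>" and mass: "\<And>r. measure (\<mu> r) UNIV \<le> L"
    and conv: "\<And>z. Im z > 0 \<Longrightarrow> (\<lambda>r. stieltjes (\<mu> r) z) \<longlonglongrightarrow> stieltjes \<nu> z"
    and f01: "\<And>x. 0 \<le> f x" "\<And>x. f x \<le> 1" and lip: "\<And>x y. \<bar>f x - f y\<bar> \<le> D * \<bar>x - y\<bar>"
    and supp: "\<And>x. \<bar>x\<bar> > R \<Longrightarrow> f x = 0"
    and f[measurable]: "f \<in> borel_measurable borel"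
  shows "(\<lambda>r. \<integral>t. f t \<partial>\<mu> r) \<longlonglongrightarrow> (\<integral>t. f t \<partial>\<nu>)"
proof (rule LIMSEQ_I)
  fix e :: real assume e: "e > 0"
  interpret \<nu>: finite_borel \<nu> by fact
  \<comment> \<open>A positive bound for the masses of \<open>\<nu>\<close> and of all
    \<open>\<mu> r\<close>; three errors of size e / 4 then stay below e.\<close>
  define L' where "L' = \<bar>L\<bar> + measure \<nu> UNIV + 1"
  have L': "L' > 0" by (simp add: L'_def add_nonneg_pos)
  have mass': "measure (\<mu> r) UNIV \<le> L'" for r
    using mass[of r] measure_nonneg[of \<nu> UNIV] unfolding L'_def by linarith
  obtain b where b: "b > 0" "\<And>t. \<bar>poisson f b t - f t\<bar> \<le> e / (4 * L')"
    using poisson_approx[OF f01 lip f, of "e / (4 * L')"] e L' by auto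
  have [measurable]: "poisson f b \<in> borel_measurable borel"
    unfolding poisson_def by measurable
  have close: "\<bar>(\<integral>t. poisson f b t \<partial>m) - (\<integral>t. f t \<partial>m)\<bar> \<le> e / 4"
    if "finite_borel m" "measure m UNIV \<le> L'" for m
  proof -
    interpret m: finite_borel m by fact
    have fi: "integrable m f" by (rule m.integrable_const_bound[of _ 1]) (auto simp: f01)
    have di: "integrable m (\<lambda>t. poisson f b t - f t)"
      by (rule m.integrable_const_bound[of _ "e / (4 * L')"]) (use b in auto)
    have pi: "integrable m (poisson f b)"
      using Bochner_Integration.integrable_add[OF di fi] by simp
    have "(\<integral>t. poisson f b t \<partial>m) - (\<integral>t. f t \<partial>m) = (\<integral>t. poisson f b t - f t \<partial>m)"
      by (rule Bochner_Integration.integral_diff[symmetric, OF pi fi])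
    also have "norm \<dots> \<le> (\<integral>t. e / (4 * L') \<partial>m)"
      by (rule Bochner_Integration.integral_norm_bound_integral[OF di]) (use b in auto)
    also have "\<dots> = measure m UNIV * (e / (4 * L'))" by simp
    also have "\<dots> \<le> L' * (e / (4 * L'))" using that(2) e L' by (intro mult_right_mono) auto
    also have "\<dots> = e / 4" using L' by simp
    finally show ?thesis by simp
  qed
  have "(\<lambda>r. LBINT E. f E * (Im (stieltjes (\<mu> r) (Complex E b)) / pi)) \<longlonglongrightarrow>
        (LBINT E. f E * (Im (stieltjes \<nu> (Complex E b)) / pi))"
  proof (rule integral_dominated_convergence[where w = "\<lambda>E. indicator {-R..R} E * (L' / b / pi)"])
    have meas: "(\<lambda>E. f E * (Im (stieltjes m (Complex E b)) / pi)) \<in> borel_measurable lborel"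
      if "finite_borel m" for m
    proof -
      interpret m: finite_borel m by fact
      show ?thesis using b by (simp add: m.Im_stieltjes)
    qed
    show "(\<lambda>E. f E * (Im (stieltjes \<nu> (Complex E b)) / pi)) \<in> borel_measurable lborel"
      "\<And>r. (\<lambda>E. f E * (Im (stieltjes (\<mu> r) (Complex E b)) / pi)) \<in> borel_measurable lborel"
      using meas fb by auto
    show "integrable lborel (\<lambda>E. indicator {-R..R} E * (L' / b / pi))"
      by (intro integrable_mult_left integrable_real_indicator) (auto simp: emeasure_lborel_Icc_eq)
    show "AE E in lborel. (\<lambda>r. f E * (Im (stieltjes (\<mu> r) (Complex E b)) / pi)) \<longlonglongrightarrow> f E * (Im (stieltjes \<nu> (Complex E b)) / pi)"
      using b by (intro AE_I2 tendsto_intros conv) auto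
    show "AE E in lborel. norm (f E * (Im (stieltjes (\<mu> r) (Complex E b)) / pi)) \<le> indicator {-R..R} E * (L' / b / pi)" for r
    proof (rule AE_I2)
      fix E
      interpret m: finite_borel "\<mu> r" by fact
      show "norm (f E * (Im (stieltjes (\<mu> r) (Complex E b)) / pi)) \<le> indicator {-R..R} E * (L' / b / pi)"
      proof (cases "\<bar>E\<bar> > R")
        case False
        have "\<bar>Im (stieltjes (\<mu> r) (Complex E b))\<bar> \<le> measure (\<mu> r) UNIV / b"
          using order_trans[OF abs_Im_le_cmod m.norm_stieltjes_le, of "Complex E b"] b by simp
        also have "\<dots> \<le> L' / b" using mass'[of r] b by (intro divide_right_mono) auto
        finally have "\<bar>f E\<bar> * (\<bar>Im (stieltjes (\<mu> r) (Complex E b))\<bar> / pi) \<le> 1 * (L' / b / pi)"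
          using f01 by (intro mult_mono divide_right_mono) auto
        moreover have "E \<in> {-R..R}" using False by (simp add: abs_le_iff not_less)
        ultimately show ?thesis by (simp add: abs_mult abs_divide)
      qed (use supp in \<open>auto simp: indicator_def\<close>)
    qed
  qed
  then have "(\<lambda>r. \<integral>t. poisson f b t \<partial>\<mu> r) \<longlonglongrightarrow> (\<integral>t. poisson f b t \<partial>\<nu>)"
    using b(1) by (simp only: finite_borel.integral_poisson[OF fb(1) f01 supp f] finite_borel.integral_poisson[OF fb(2) f01 supp f])
  then obtain N where N: "\<And>r. r \<ge> N \<Longrightarrow> \<bar>(\<integral>t. poisson f b t \<partial>\<mu> r) - (\<integral>t. poisson f b t \<partial>\<nu>)\<bar> < e / 4"
    using LIMSEQ_D[of _ _ "e / 4"] e by force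
  have "norm ((\<integral>t. f t \<partial>\<mu> r) - (\<integral>t. f t \<partial>\<nu>)) < e" if "r \<ge> N" for r
  proof -
    have "measure (\<mu> r) UNIV \<le> L'" by (rule mass')
    moreover have "measure \<nu> UNIV \<le> L'" by (simp add: L'_def)
    ultimately show ?thesis
      using close[OF fb(1), of r] close[OF fb(2)] N[OF that] e unfolding real_norm_def by linarith
  qed
  then show "\<exists>N. \<forall>r\<ge>N. norm ((\<integral>t. f t \<partial>\<mu> r) - (\<integral>t. f t \<partial>\<nu>)) < e" by blast
qed

section \<open>Hierarchical operators in finite volume\<close>

lemma L2_set_sum_le: "finite T \<Longrightarrow> L2_set (\<lambda>i. \<Sum>t\<in>T. f t i) A \<le> (\<Sum>t\<in>T. L2_set (f t) A)"
proof (induction T rule: finite_induct)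
  case (insert t T)
  then show ?case
    using L2_set_triangle_ineq[of "f t" "\<lambda>i. \<Sum>t\<in>T. f t i" A] by simp
qed (simp add: L2_set_0')

lemma L2_set_cmod_sum_le:
  "finite T \<Longrightarrow> L2_set (\<lambda>i. cmod (\<Sum>t\<in>T. f t i)) A \<le> (\<Sum>t\<in>T. L2_set (\<lambda>i. cmod (f t i)) A)"
  by (rule order_trans[OF L2_set_mono L2_set_sum_le]) (auto intro: norm_sum)

lemma L2_set_cmod_triangle:
  "L2_set (\<lambda>i. cmod (f i + g i)) A \<le> L2_set (\<lambda>i. cmod (f i)) A + L2_set (\<lambda>i. cmod (g i)) A"
  by (rule order_trans[OF L2_set_mono L2_set_triangle_ineq]) (auto intro: norm_triangle_ineq)

lemma L2_set_cmod_cmult: "L2_set (\<lambda>i. cmod (c * f i)) A = cmod c * L2_set (\<lambda>i. cmod (f i)) A"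
  by (simp add: norm_mult L2_set_right_distrib)

lemma L2_set_subset_mono: "finite B \<Longrightarrow> A \<subseteq> B \<Longrightarrow> L2_set f A \<le> L2_set f B"
  by (auto simp: L2_set_def intro!: real_sqrt_le_mono sum_mono2)

lemma norm_sum_mult_le:
  "cmod (\<Sum>i\<in>A. f i * g i) \<le> L2_set (\<lambda>i. cmod (f i)) A * L2_set (\<lambda>i. cmod (g i)) A"
  by (rule order_trans[OF norm_sum]) (simp add: norm_mult order_trans[OF _ L2_set_mult_ineq])

lemma norm_sum_le_L2:
  "cmod (\<Sum>i\<in>A. f i) \<le> sqrt (card A) * L2_set (\<lambda>i. cmod (f i)) A"
  using norm_sum_mult_le[of "\<lambda>_. 1" f A] by (simp add: L2_set_constant)

locale hierarchical =
  fixes Q :: "nat \<Rightarrow> 'a::countable \<Rightarrow> 'a set" and n :: "nat \<Rightarrow> nat" and p u :: "nat \<Rightarrow> real" and x0 :: 'a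
  assumes hier: "hier_structure Q n"
    and p_pos: "r \<ge> 1 \<Longrightarrow> p r > 0" and p0: "p 0 = 0" and p_sum: "p sums 1"
    and u_pos: "u r > 0"
    and u_inv: "summable (\<lambda>r. 1 / u (Suc r))"
    and u_cond: "summable (\<lambda>r. p (Suc r) * NN n r * u r * u (Suc r))"
begin

lemma Q_0: "Q 0 x = {x}" using hier by (simp add: hier_structure_def)
lemma Q_refl: "x \<in> Q r x" using hier by (simp add: hier_structure_def)
lemma Q_eq: "y \<in> Q r x \<Longrightarrow> Q r y = Q r x" using hier unfolding hier_structure_def by metis
lemma Q_ex: "\<exists>r. y \<in> Q r x" using hier by (simp add: hier_structure_def)
lemma n_pos: "n r > 0" using hier by (simp add: hier_structure_def)
lemma n_0: "n 0 = 1" using hier by (simp add: hier_structure_def)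

lemma Q_Suc: "y \<in> Q (Suc r) x \<Longrightarrow> Q r y \<subseteq> Q (Suc r) x"
  using hier unfolding hier_structure_def by (metis diff_Suc_1 zero_less_Suc)

lemma card_classes: "card (Q r ` Q (Suc r) x) = n (Suc r)"
  using hier unfolding hier_structure_def by (metis diff_Suc_1 zero_less_Suc)

lemma Q_sym: "y \<in> Q r x \<longleftrightarrow> x \<in> Q r y"
  using Q_eq Q_refl by blast

lemma Q_mono: "r \<le> s \<Longrightarrow> Q r x \<subseteq> Q s x"
proof (induction s rule: dec_induct)
  case (step s)
  then show ?case using Q_Suc[OF Q_refl] by blast
qed simp

lemma finite_card_Q: "finite (Q r x) \<and> card (Q r x) = (\<Prod>s\<le>r. n s)"
proof (induction r arbitrary: x)
  case (Suc r)
  let ?C = "Q r ` Q (Suc r) x"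
  \<comment> \<open>An infinite set has \<open>card\<close> 0, so positivity of
    \<open>n (Suc r)\<close> yields finiteness.\<close>
  have "card ?C > 0" by (simp only: card_classes n_pos)
  then have fin: "finite ?C" by (rule card_ge_0_finite)
  have U: "\<Union>?C = Q (Suc r) x"
    by (intro equalityI Union_least subsetI) (auto intro: Q_refl dest: Q_Suc[THEN subsetD])
  have fin': "finite (Q (Suc r) x)" using fin Suc by (subst U[symmetric]) blast
  have "(\<Prod>s\<le>r. n s) * card ?C = card (\<Union>?C)"
  proof (rule card_partition[OF fin])
    show "finite (\<Union>?C)" using fin' U by simp
    show "\<And>c. c \<in> ?C \<Longrightarrow> card c = (\<Prod>s\<le>r. n s)" using Suc by blast
    show "c1 \<inter> c2 = {}" if "c1 \<in> ?C" "c2 \<in> ?C" "c1 \<noteq> c2" for c1 c2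
      using that Q_eq by (metis disjoint_iff imageE)
  qed
  then have "card (Q (Suc r) x) = (\<Prod>s\<le>r. n s) * n (Suc r)" using U by (simp only: card_classes)
  then show ?case using fin' by simp
qed (simp add: Q_0 n_0)

lemma finite_Q: "finite (Q r x)" and card_Q: "real (card (Q r x)) = NN n r"
  using finite_card_Q by (auto simp: NN_def)

lemma N_pos: "NN n r > 0"
  unfolding NN_def by (intro prod_pos) (simp add: n_pos)

lemma hdist_le: "hdist Q x y \<le> r \<longleftrightarrow> y \<in> Q r x"
  unfolding hdist_def using Q_mono by (metis (mono_tags, lifting) LeastI_ex Least_le Q_ex subsetD)

definition av :: "nat \<Rightarrow> ('a \<Rightarrow> complex) \<Rightarrow> 'a \<Rightarrow> complex" where
  "av r f x = (\<Sum>y\<in>Q r x. f y) / of_real (NN n r)"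

lemma Eop_av: "Eop Q n r f x = av r f x"
  by (simp add: Eop_def av_def hdist_le)

lemma av_norm_le: assumes "\<And>y. cmod (f y) \<le> c" shows "cmod (av r f x) \<le> c"
proof -
  have "cmod (\<Sum>y\<in>Q r x. f y) \<le> (\<Sum>y\<in>Q r x. c)" by (rule sum_norm_le) (rule assms)
  also have "\<dots> = NN n r * c" by (simp add: card_Q)
  finally show ?thesis using N_pos[of r] by (simp add: av_def norm_divide divide_le_eq mult.commute)
qed

lemma av_diff: "av r (\<lambda>x. f x - g x) x = av r f x - av r g x"
  by (simp add: av_def sum_subtractf diff_divide_distrib)

abbreviation A where "A r \<equiv> Q r x0"

lemma A_mono: "r \<le> s \<Longrightarrow> A r \<subseteq> A s" by (rule Q_mono)

lemma Q_subset_A: "x \<in> A r \<Longrightarrow> s \<le> r \<Longrightarrow> Q s x \<subseteq> A r"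
  using Q_mono Q_eq by blast

lemma Q_disjoint_A: "x \<notin> A r \<Longrightarrow> s \<le> r \<Longrightarrow> Q s x \<inter> A r = {}"
  using Q_mono Q_eq Q_sym by blast

lemma eventually_A: "finite B \<Longrightarrow> eventually (\<lambda>r. B \<subseteq> A r) sequentially"
proof (induction B rule: finite_induct)
  case (insert x B)
  obtain s where "x \<in> A s" using Q_ex by blast
  then have "eventually (\<lambda>r. x \<in> A r) sequentially"
    using A_mono by (auto simp: eventually_sequentially)
  with insert.IH show ?case by eventually_elim simp
qed simp

lemma filterlim_A: "filterlim A (finite_subsets_at_top UNIV) sequentially"
  unfolding filterlim_finite_subsets_at_top using eventually_A finite_Q by simp

text \<open>Cauchy-Schwarz on each cluster, then interchange of sums: every y is counted by the N_s
  points of its cluster with weight 1 / N_s. As s is at most r, no cluster crosses the boundary of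
  \<open>A r\<close>.\<close>

lemma av_contraction:
  assumes "s \<le> r"
  shows "L2_set (\<lambda>x. cmod (av s f x)) (A r) \<le> L2_set (\<lambda>x. cmod (f x)) (A r)"
  unfolding L2_set_def
proof (intro real_sqrt_le_mono)
  have "(cmod (av s f x))\<^sup>2 \<le> (\<Sum>y\<in>Q s x. (cmod (f y))\<^sup>2) / NN n s" for x
  proof -
    have "(cmod (\<Sum>y\<in>Q s x. f y))\<^sup>2 \<le> (sqrt (card (Q s x)) * L2_set (\<lambda>i. cmod (f i)) (Q s x))\<^sup>2"
      by (intro power_mono norm_sum_le_L2) auto
    also have "\<dots> = NN n s * (\<Sum>y\<in>Q s x. (cmod (f y))\<^sup>2)"
      using N_pos[of s] by (simp add: power_mult_distrib L2_set_def sum_nonneg card_Q)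
    finally show ?thesis using N_pos[of s]
      by (simp add: av_def norm_divide power_divide power2_eq_square[of "NN n s"] divide_simps mult_ac)
  qed
  then have "(\<Sum>x\<in>A r. (cmod (av s f x))\<^sup>2) \<le> (\<Sum>x\<in>A r. (\<Sum>y\<in>Q s x. (cmod (f y))\<^sup>2) / NN n s)"
    by (intro sum_mono)
  also have "\<dots> = (\<Sum>x\<in>A r. \<Sum>y\<in>A r. if y \<in> Q s x then (cmod (f y))\<^sup>2 / NN n s else 0)"
  proof (intro sum.cong refl)
    fix x assume "x \<in> A r"
    then have "A r \<inter> Q s x = Q s x" using Q_subset_A assms by blast
    then show "(\<Sum>y\<in>Q s x. (cmod (f y))\<^sup>2) / NN n s = (\<Sum>y\<in>A r. if y \<in> Q s x then (cmod (f y))\<^sup>2 / NN n s else 0)"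
      by (simp add: sum_divide_distrib finite_Q flip: sum.inter_restrict)
  qed
  also have "\<dots> = (\<Sum>y\<in>A r. \<Sum>x\<in>A r. if x \<in> Q s y then (cmod (f y))\<^sup>2 / NN n s else 0)"
    by (subst sum.swap) (simp add: Q_sym)
  also have "\<dots> = (\<Sum>y\<in>A r. (cmod (f y))\<^sup>2)"
  proof (intro sum.cong refl)
    fix y assume "y \<in> A r"
    then have "A r \<inter> Q s y = Q s y" using Q_subset_A assms by blast
    then show "(\<Sum>x\<in>A r. if x \<in> Q s y then (cmod (f y))\<^sup>2 / NN n s else 0) = (cmod (f y))\<^sup>2"
      using N_pos[of s] by (simp add: finite_Q card_Q flip: sum.inter_restrict)
  qed
  finally show "(\<Sum>x\<in>A r. (cmod (av s f x))\<^sup>2) \<le> (\<Sum>x\<in>A r. (cmod (f x))\<^sup>2)" .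
qed

lemma p_nonneg: "p r \<ge> 0" using p_pos[of r] p0 by (cases r) auto
lemma p_summable: "summable p" using p_sum by (rule sums_summable)
lemma p_partial: "sum p B \<le> 1" if "finite B"
  using sum_le_suminf[OF p_summable that] p_nonneg p_sum by (simp add: sums_iff)

section \<open>Truncated operators on growing clusters\<close>

text \<open>Ranks above r are dropped, and ranks up to r never connect different clusters of rank r.
  On \<open>A (Suc r)\<close> the next kernel is thus block diagonal over these clusters, plus one
  constant matrix from the new rank.\<close>

definition K :: "('a \<Rightarrow> real) \<Rightarrow> nat \<Rightarrow> 'a \<Rightarrow> 'a \<Rightarrow> real" where
  "K \<omega> r x y = (\<Sum>s\<le>r. p s / NN n s * of_bool (y \<in> Q s x)) + (if x = y then \<omega> x else 0)"

sublocale F: finite_symmetric "A r" "K \<omega> r" for \<omega> r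
  by unfold_locales (auto simp: finite_Q K_def Q_sym)

lemma K_apply:
  assumes "x \<in> A r"
  shows "(\<Sum>y\<in>A r. of_real (K \<omega> r x y) * g y) = (\<Sum>s\<le>r. of_real (p s) * av s g x) + of_real (\<omega> x) * g x"
proof -
  have "(\<Sum>y\<in>A r. of_real (K \<omega> r x y) * g y)
     = (\<Sum>y\<in>A r. (\<Sum>s\<le>r. of_real (p s / NN n s * of_bool (y \<in> Q s x)) * g y) + (if x = y then of_real (\<omega> x) * g y else 0))"
    by (intro sum.cong) (auto simp: K_def algebra_simps sum_distrib_right sum_distrib_left)
  also have "\<dots> = (\<Sum>s\<le>r. \<Sum>y\<in>A r. of_real (p s / NN n s * of_bool (y \<in> Q s x)) * g y) + of_real (\<omega> x) * g x"
    using assms by (simp add: sum.distrib finite_Q sum.delta') (rule sum.swap)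
  also have "(\<Sum>s\<le>r. \<Sum>y\<in>A r. of_real (p s / NN n s * of_bool (y \<in> Q s x)) * g y) = (\<Sum>s\<le>r. of_real (p s) * av s g x)"
  proof (intro sum.cong refl)
    fix s assume "s \<in> {..r}"
    then have "A r \<inter> Q s x = Q s x" using Q_subset_A assms by auto
    moreover have "(\<Sum>y\<in>A r. of_real (p s / NN n s * of_bool (y \<in> Q s x)) * g y)
       = (\<Sum>y\<in>A r. if y \<in> Q s x then of_real (p s / NN n s) * g y else 0)"
      by (intro sum.cong) auto
    ultimately show "(\<Sum>y\<in>A r. of_real (p s / NN n s * of_bool (y \<in> Q s x)) * g y) = of_real (p s) * av s g x"
      by (simp add: av_def finite_Q sum_distrib_left sum_divide_distrib flip: sum.inter_restrict)
  qed
  finally show ?thesis .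
qed

text \<open>The action of the ranks in (r, s] on a function supported in \<open>A r\<close>: each of
  them sees only the total sum of \<open>g\<close> and spreads it evenly over
  \<open>A t\<close>.\<close>

definition tail :: "nat \<Rightarrow> nat \<Rightarrow> ('a \<Rightarrow> complex) \<Rightarrow> 'a \<Rightarrow> complex" where
  "tail r s g x = (\<Sum>t\<in>{r<..s}. of_real (p t / NN n t * of_bool (x \<in> A t)) * (\<Sum>y\<in>A r. g y))"

lemma K_extend:
  assumes g: "\<And>x. x \<notin> A r \<Longrightarrow> g x = 0" and rs: "r \<le> s" and x: "x \<in> A s"
  shows "(\<Sum>y\<in>A s. of_real (K \<omega> s x y) * g y)
     = (if x \<in> A r then \<Sum>y\<in>A r. of_real (K \<omega> r x y) * g y else 0) + tail r s g x"
proof -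
  have *: "{..s} = {..r} \<union> {r<..s}" using rs by auto
  \<comment> \<open>For t > r the cluster of x is either \<open>A t\<close>, which contains the
    support of \<open>g\<close>, or disjoint from it.\<close>
  have "(\<Sum>t\<in>{r<..s}. of_real (p t) * av t g x) = tail r s g x"
    unfolding tail_def
  proof (intro sum.cong refl)
    fix t assume t: "t \<in> {r<..s}"
    show "of_real (p t) * av t g x = of_real (p t / NN n t * of_bool (x \<in> A t)) * (\<Sum>y\<in>A r. g y)"
    proof (cases "x \<in> A t")
      case True
      then have "Q t x = A t" by (rule Q_eq)
      moreover have "(\<Sum>y\<in>A t. g y) = (\<Sum>y\<in>A r. g y)"
        by (rule sum.mono_neutral_right) (use t A_mono[of r t] g finite_Q in auto)
      ultimately show ?thesis using True by (simp add: av_def)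
    next
      case False
      then have "Q t x \<inter> A t = {}" using Q_disjoint_A by blast
      then have "(\<Sum>y\<in>Q t x. g y) = 0" using t A_mono[of r t] by (intro sum.neutral) (auto intro!: g)
      then show ?thesis using False by (simp add: av_def)
    qed
  qed
  moreover have "(\<Sum>t\<le>r. of_real (p t) * av t g x) = 0" "g x = 0" if "x \<notin> A r"
  proof -
    have "av t g x = 0" if "t \<le> r" for t
      using Q_disjoint_A[OF \<open>x \<notin> A r\<close> that] by (auto simp: av_def intro!: sum.neutral g)
    then show "(\<Sum>t\<le>r. of_real (p t) * av t g x) = 0" by simp
  qed (rule g, rule that)
  ultimately show ?thesis
    unfolding K_apply[OF x] * by (subst sum.union_disjoint) (auto simp: K_apply)
qed

text \<open>The sum over \<open>A r\<close> costs at most sqrt N_t by Cauchy-Schwarz, the indicator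
  of \<open>A t\<close> contributes another sqrt N_t, and the factor 1 / N_t cancels both, leaving
  p_t.\<close>

lemma tail_norm_le:
  "L2_set (\<lambda>x. cmod (tail r s g x)) B \<le> (\<Sum>t\<in>{r<..s}. p t) * L2_set (\<lambda>x. cmod (g x)) (A r)" if B: "finite B"
proof -
  have "L2_set (\<lambda>x. cmod (tail r s g x)) B
     \<le> (\<Sum>t\<in>{r<..s}. L2_set (\<lambda>x. cmod (of_real (p t / NN n t * of_bool (x \<in> A t)) * (\<Sum>y\<in>A r. g y))) B)"
    unfolding tail_def
    by (rule L2_set_cmod_sum_le[where f = "\<lambda>t x. of_real (p t / NN n t * of_bool (x \<in> A t)) * (\<Sum>y\<in>A r. g y)"]) simp
  also have "\<dots> \<le> (\<Sum>t\<in>{r<..s}. p t * L2_set (\<lambda>x. cmod (g x)) (A r))"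
  proof (rule sum_mono)
    fix t assume t: "t \<in> {r<..s}"
    define c where "c = cmod (\<Sum>y\<in>A r. g y)"
    have "c \<le> sqrt (NN n r) * L2_set (\<lambda>x. cmod (g x)) (A r)"
      unfolding c_def using norm_sum_le_L2[of g "A r"] by (simp add: card_Q)
    also have "\<dots> \<le> sqrt (NN n t) * L2_set (\<lambda>x. cmod (g x)) (A r)"
      using t A_mono[of r t] by (intro mult_right_mono) (auto simp: finite_Q intro!: card_mono simp flip: card_Q[of _ x0])
    finally have c: "c \<le> sqrt (NN n t) * L2_set (\<lambda>x. cmod (g x)) (A r)" .
    have ind: "L2_set (\<lambda>x. of_bool (x \<in> A t)) B \<le> sqrt (NN n t)"
    proof -
      have "(\<Sum>x\<in>B. (of_bool (x \<in> A t))\<^sup>2) = (\<Sum>x\<in>B. if x \<in> A t then 1 else 0 :: real)"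
        by (intro sum.cong) auto
      also have "\<dots> = real (card (B \<inter> A t))" using B by (simp flip: sum.inter_restrict)
      also have "\<dots> \<le> NN n t" unfolding card_Q[of t x0, symmetric] using finite_Q by (intro of_nat_mono card_mono) auto
      finally show ?thesis by (simp add: L2_set_def)
    qed
    have "L2_set (\<lambda>x. cmod (of_real (p t / NN n t * of_bool (x \<in> A t)) * (\<Sum>y\<in>A r. g y))) B
       = L2_set (\<lambda>x. (p t / NN n t * c) * of_bool (x \<in> A t)) B"
      using N_pos[of t] p_nonneg[of t] by (simp add: norm_mult norm_divide c_def mult_ac)
    also have "\<dots> = (p t / NN n t * c) * L2_set (\<lambda>x. of_bool (x \<in> A t)) B"
      using N_pos[of t] p_nonneg[of t] by (intro L2_set_right_distrib[symmetric]) (simp add: c_def)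
    also have "\<dots> \<le> (p t / NN n t * c) * sqrt (NN n t)"
      using N_pos[of t] p_nonneg[of t] by (intro mult_left_mono ind) (auto simp: c_def)
    also have "\<dots> \<le> (p t / NN n t * (sqrt (NN n t) * L2_set (\<lambda>x. cmod (g x)) (A r))) * sqrt (NN n t)"
      using N_pos[of t] p_nonneg[of t] by (intro mult_right_mono mult_left_mono c) auto
    also have "\<dots> = p t / NN n t * (sqrt (NN n t) * sqrt (NN n t)) * L2_set (\<lambda>x. cmod (g x)) (A r)"
      by (simp add: mult_ac)
    also have "\<dots> = p t * L2_set (\<lambda>x. cmod (g x)) (A r)"
      using N_pos[of t] by simp
    finally show "L2_set (\<lambda>x. cmod (of_real (p t / NN n t * of_bool (x \<in> A t)) * (\<Sum>y\<in>A r. g y))) B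
       \<le> p t * L2_set (\<lambda>x. cmod (g x)) (A r)" .
  qed
  finally show ?thesis by (simp add: sum_distrib_right)
qed

lemma G_outside: "x \<notin> A r \<Longrightarrow> F.G r \<omega> z h x = 0"
  by (simp add: F.G_def)

text \<open>Extended by zero, the smaller resolvent solves the larger equation up to the part of
  \<open>h\<close> off \<open>A r\<close> and the \<open>tail\<close> of the additional ranks. For s
  = r + 1 and \<open>h = delta\<close> this is the rank-one recursion; for arbitrary s it drives the
  limit of infinite volume.\<close>

lemma G_residual:
  assumes z: "Im z > 0" and rs: "r \<le> s" and x: "x \<in> A s"
  shows "F.G s \<omega> z h x - F.G r \<omega> z h x
     = F.G s \<omega> z (\<lambda>x. (if x \<in> A r then 0 else h x) - tail r s (F.G r \<omega> z h) x) x"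
proof (rule F.G_unique[OF _ _ x])
  fix x assume x: "x \<in> A s"
  have "(\<Sum>y\<in>A s. of_real (K \<omega> s x y) * (F.G s \<omega> z h y - F.G r \<omega> z h y)) - z * (F.G s \<omega> z h x - F.G r \<omega> z h x)
     = ((\<Sum>y\<in>A s. of_real (K \<omega> s x y) * F.G s \<omega> z h y) - z * F.G s \<omega> z h x)
     - ((\<Sum>y\<in>A s. of_real (K \<omega> s x y) * F.G r \<omega> z h y) - z * F.G r \<omega> z h x)"
    by (simp add: algebra_simps sum_subtractf)
  also have "(\<Sum>y\<in>A s. of_real (K \<omega> s x y) * F.G s \<omega> z h y) - z * F.G s \<omega> z h x = h x"
    using z x by (intro F.G_solves) auto
  also have "(\<Sum>y\<in>A s. of_real (K \<omega> s x y) * F.G r \<omega> z h y) - z * F.G r \<omega> z h x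
     = (if x \<in> A r then h x else 0) + tail r s (F.G r \<omega> z h) x"
    using F.G_solves[of z x r \<omega> h] z by (auto simp: K_extend[OF G_outside rs x] G_outside)
  finally show "(\<Sum>y\<in>A s. of_real (K \<omega> s x y) * (F.G s \<omega> z h y - F.G r \<omega> z h y)) - z * (F.G s \<omega> z h x - F.G r \<omega> z h x)
     = (if x \<in> A r then 0 else h x) - tail r s (F.G r \<omega> z h) x" by simp
qed (use z in simp)

end

section \<open>The resolvent in infinite volume\<close>

lemma l2I:
  assumes "\<And>B. finite B \<Longrightarrow> L2_set (\<lambda>x. cmod (f x)) B \<le> c"
  shows "l2 f"
  unfolding l2_def
proof (rule nonneg_bdd_above_summable_on)
  show "bdd_above (sum (\<lambda>x. (cmod (f x))\<^sup>2) ` {F. F \<subseteq> UNIV \<and> finite F})"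
  proof (rule bdd_aboveI2)
    fix B assume "B \<in> {F. F \<subseteq> (UNIV :: 'a set) \<and> finite F}"
    then have "sqrt (\<Sum>x\<in>B. (cmod (f x))\<^sup>2) \<le> c" using assms by (auto simp: L2_set_def)
    then show "(\<Sum>x\<in>B. (cmod (f x))\<^sup>2) \<le> c\<^sup>2" using real_sqrt_le_iff sqrt_le_D by blast
  qed
qed simp

definition l2norm :: "('a \<Rightarrow> complex) \<Rightarrow> real" where
  "l2norm f = sqrt (\<Sum>\<^sub>\<infinity>x. (cmod (f x))\<^sup>2)"

lemma l2norm_nonneg: "l2norm f \<ge> 0" by (simp add: l2norm_def infsum_nonneg)

lemma l2norm_sq: "(l2norm f)\<^sup>2 = (\<Sum>\<^sub>\<infinity>x. (cmod (f x))\<^sup>2)" by (simp add: l2norm_def infsum_nonneg)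

lemma sum_le_l2norm: "l2 f \<Longrightarrow> finite B \<Longrightarrow> (\<Sum>x\<in>B. (cmod (f x))\<^sup>2) \<le> (l2norm f)\<^sup>2"
  unfolding l2norm_sq l2_def by (rule finite_sum_le_infsum) auto

lemma L2_le_l2norm: "l2 f \<Longrightarrow> finite B \<Longrightarrow> L2_set (\<lambda>x. cmod (f x)) B \<le> l2norm f"
  using real_sqrt_le_mono[OF sum_le_l2norm] by (simp add: L2_set_def l2norm_nonneg)

lemma L2_set_tendsto:
  assumes "\<And>x. x \<in> B \<Longrightarrow> (\<lambda>s. f s x) \<longlonglongrightarrow> (g x :: complex)"
  shows "(\<lambda>s. L2_set (\<lambda>x. cmod (f s x)) B) \<longlonglongrightarrow> L2_set (\<lambda>x. cmod (g x)) B"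
  unfolding L2_set_def by (intro tendsto_intros assms)

context hierarchical
begin

text \<open>The error bound of the volume \<open>A r\<close> (\<open>G_cauchy\<close>): the norm of
  \<open>h\<close> outside \<open>A r\<close>, plus the weight of the omitted ranks times the
  resolvent bound, all passed through one more resolvent, hence the outer
  \<open>/ Im z\<close>.\<close>

definition kappa :: "complex \<Rightarrow> ('a \<Rightarrow> complex) \<Rightarrow> nat \<Rightarrow> real" where
  "kappa z h r = (sqrt ((l2norm h)\<^sup>2 - (\<Sum>x\<in>A r. (cmod (h x))\<^sup>2)) + (1 - (\<Sum>t\<le>r. p t)) * (l2norm h / Im z)) / Im z"

lemma sum_A_tendsto:
  assumes "f summable_on UNIV" shows "(\<lambda>r. \<Sum>x\<in>A r. f x) \<longlonglongrightarrow> infsum f UNIV"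
  using filterlim_compose[OF infsum_tendsto[OF assms] filterlim_A] by simp

lemma kappa_tendsto: assumes "l2 h" shows "kappa z h \<longlonglongrightarrow> 0"
proof (cases "Im z = 0")
  case False
  have "(\<lambda>r. \<Sum>t\<le>r. p t) \<longlonglongrightarrow> 1" using p_sum by (simp add: sums_def_le)
  moreover have "(\<lambda>r. \<Sum>x\<in>A r. (cmod (h x))\<^sup>2) \<longlonglongrightarrow> (l2norm h)\<^sup>2"
    using sum_A_tendsto assms by (simp add: l2_def l2norm_sq)
  ultimately have "kappa z h \<longlonglongrightarrow> (sqrt ((l2norm h)\<^sup>2 - (l2norm h)\<^sup>2) + (1 - 1) * (l2norm h / Im z)) / Im z"
    unfolding kappa_def using False by (intro tendsto_intros)
  then show ?thesis by simp
next
  case True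
  then have "kappa z h = (\<lambda>_. 0)" by (auto simp: kappa_def)
  then show ?thesis by simp
qed

lemma G_norm_le: assumes "l2 h" "Im z > 0" "finite B"
  shows "L2_set (\<lambda>x. cmod (F.G r \<omega> z h x)) B \<le> l2norm h / Im z"
proof -
  have "L2_set (\<lambda>x. cmod (F.G r \<omega> z h x)) B = L2_set (\<lambda>x. cmod (F.G r \<omega> z h x)) (B \<inter> A r)"
    unfolding L2_set_def by (intro arg_cong[of _ _ sqrt] sum.mono_neutral_right) (auto simp: assms G_outside)
  also have "\<dots> \<le> L2_set (\<lambda>x. cmod (F.G r \<omega> z h x)) (A r)" by (intro L2_set_subset_mono finite_Q) auto
  also have "\<dots> \<le> L2_set (\<lambda>x. cmod (h x)) (A r) / Im z" by (rule F.norm_G_le) fact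
  also have "\<dots> \<le> l2norm h / Im z" using assms by (intro divide_right_mono L2_le_l2norm finite_Q) auto
  finally show ?thesis .
qed

lemma G_cauchy:
  assumes h: "l2 h" and z: "Im z > 0" and rs: "r \<le> s"
  shows "L2_set (\<lambda>x. cmod (F.G s \<omega> z h x - F.G r \<omega> z h x)) (A s) \<le> kappa z h r"
proof -
  let ?g = "F.G r \<omega> z h"
  define k where "k = (\<lambda>x. (if x \<in> A r then 0 else h x) - tail r s ?g x)"
  have "L2_set (\<lambda>x. cmod (F.G s \<omega> z h x - ?g x)) (A s) = L2_set (\<lambda>x. cmod (F.G s \<omega> z k x)) (A s)"
    by (rule L2_set_cong) (auto simp: G_residual[OF z rs] k_def)
  also have "\<dots> \<le> L2_set (\<lambda>x. cmod (k x)) (A s) / Im z" by (rule F.norm_G_le[OF z])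
  also have "L2_set (\<lambda>x. cmod (k x)) (A s) \<le> L2_set (\<lambda>x. cmod (if x \<in> A r then 0 else h x)) (A s) + L2_set (\<lambda>x. cmod (tail r s ?g x)) (A s)"
    using L2_set_cmod_triangle[of "\<lambda>x. if x \<in> A r then 0 else h x" "\<lambda>x. - tail r s ?g x" "A s"] by (simp add: k_def)
  also have "L2_set (\<lambda>x. cmod (if x \<in> A r then 0 else h x)) (A s) \<le> sqrt ((l2norm h)\<^sup>2 - (\<Sum>x\<in>A r. (cmod (h x))\<^sup>2))"
    unfolding L2_set_def
  proof (rule real_sqrt_le_mono)
    have "(\<Sum>x\<in>A s. (cmod (if x \<in> A r then 0 else h x))\<^sup>2) = (\<Sum>x\<in>A s - A r. (cmod (h x))\<^sup>2)"
      using A_mono[OF rs] by (intro sum.mono_neutral_cong_right finite_Q) auto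
    also have "\<dots> = (\<Sum>x\<in>A s. (cmod (h x))\<^sup>2) - (\<Sum>x\<in>A r. (cmod (h x))\<^sup>2)"
      by (rule sum_diff) (auto simp: finite_Q A_mono[OF rs])
    also have "\<dots> \<le> (l2norm h)\<^sup>2 - (\<Sum>x\<in>A r. (cmod (h x))\<^sup>2)" using sum_le_l2norm[OF h finite_Q] by simp
    finally show "(\<Sum>x\<in>A s. (cmod (if x \<in> A r then 0 else h x))\<^sup>2) \<le> (l2norm h)\<^sup>2 - (\<Sum>x\<in>A r. (cmod (h x))\<^sup>2)" .
  qed
  also have "L2_set (\<lambda>x. cmod (tail r s ?g x)) (A s) \<le> (1 - (\<Sum>t\<le>r. p t)) * (l2norm h / Im z)"
  proof -
    have "{..s} = {..r} \<union> {r<..s}" using rs by auto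
    then have "(\<Sum>t\<le>r. p t) + (\<Sum>t\<in>{r<..s}. p t) \<le> 1"
      using p_partial[of "{..s}"] by (simp add: sum.union_disjoint ivl_disj_int)
    then show ?thesis
      using sum_nonneg[of "{r<..s}" p] p_nonneg
      by (intro order_trans[OF tail_norm_le[OF finite_Q]] mult_mono G_norm_le h z finite_Q) auto
  qed
  finally show ?thesis using z by (simp add: kappa_def divide_right_mono)
qed

definition G_inf :: "('a \<Rightarrow> real) \<Rightarrow> complex \<Rightarrow> ('a \<Rightarrow> complex) \<Rightarrow> 'a \<Rightarrow> complex" where
  "G_inf \<omega> z h x = lim (\<lambda>r. F.G r \<omega> z h x)"

context
  fixes h :: "'a \<Rightarrow> complex" and z :: complex and \<omega> :: "'a \<Rightarrow> real"
  assumes h: "l2 h" and z: "Im z > 0"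
begin

lemma G_tendsto: "(\<lambda>r. F.G r \<omega> z h x) \<longlonglongrightarrow> G_inf \<omega> z h x"
proof -
  obtain k where k: "x \<in> A k" using Q_ex by blast
  have "Cauchy (\<lambda>r. F.G r \<omega> z h x)"
  proof (rule CauchyI')
    fix e :: real assume "e > 0"
    then obtain N where N: "\<And>r. r \<ge> N \<Longrightarrow> norm (kappa z h r) < e"
      using LIMSEQ_D[OF kappa_tendsto[OF h]] by fastforce
    have "norm (F.G r \<omega> z h x - F.G s \<omega> z h x) < e" if "r \<ge> max N k" "r < s" for r s
    proof -
      have "x \<in> A s" using k A_mono[of k s] that by auto
      then have "norm (F.G s \<omega> z h x - F.G r \<omega> z h x) \<le> kappa z h r"
        using that by (intro order_trans[OF member_le_L2_set[OF finite_Q] G_cauchy[OF h z]]) auto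
      then show ?thesis using N[of r] that by (simp add: norm_minus_commute)
    qed
    then show "\<exists>M. \<forall>m\<ge>M. \<forall>n>m. dist (F.G m \<omega> z h x) (F.G n \<omega> z h x) < e"
      unfolding dist_norm by blast
  qed
  then show ?thesis unfolding G_inf_def by (simp add: Cauchy_convergent convergent_LIMSEQ_iff[symmetric])
qed

lemma G_inf_diff: assumes "finite B" shows "L2_set (\<lambda>x. cmod (G_inf \<omega> z h x - F.G r \<omega> z h x)) B \<le> kappa z h r"
proof (rule LIMSEQ_le_const2)
  show "(\<lambda>s. L2_set (\<lambda>x. cmod (F.G s \<omega> z h x - F.G r \<omega> z h x)) B) \<longlonglongrightarrow> L2_set (\<lambda>x. cmod (G_inf \<omega> z h x - F.G r \<omega> z h x)) B"
    by (intro L2_set_tendsto tendsto_intros G_tendsto)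
  have "eventually (\<lambda>s. B \<subseteq> A s) sequentially" using assms by (rule eventually_A)
  with eventually_ge_at_top[of r] have "eventually (\<lambda>s. L2_set (\<lambda>x. cmod (F.G s \<omega> z h x - F.G r \<omega> z h x)) B \<le> kappa z h r) sequentially"
    by eventually_elim (rule order_trans[OF L2_set_subset_mono[OF finite_Q] G_cauchy[OF h z]])
  then show "\<exists>N. \<forall>s\<ge>N. L2_set (\<lambda>x. cmod (F.G s \<omega> z h x - F.G r \<omega> z h x)) B \<le> kappa z h r"
    by (simp add: eventually_sequentially)
qed

lemma G_inf_norm: "finite B \<Longrightarrow> L2_set (\<lambda>x. cmod (G_inf \<omega> z h x)) B \<le> l2norm h / Im z"
  by (rule LIMSEQ_le_const2[OF L2_set_tendsto[OF G_tendsto]]) (use G_norm_le[OF h z] in blast)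

lemma G_inf_l2: "l2 (G_inf \<omega> z h)"
  by (rule l2I) (rule G_inf_norm)

text \<open>Both the number of ranks and the function vary with r. Changing the function costs at
  most \<open>kappa\<close>, because averages do not increase a uniform bound and the weights sum to
  at most 1.\<close>

lemma partial_Lap_tendsto:
  "(\<lambda>r. \<Sum>t\<le>r. of_real (p t) * av t (F.G r \<omega> z h) x) \<longlonglongrightarrow> Lap Q n p (G_inf \<omega> z h) x"
proof -
  let ?g = "G_inf \<omega> z h"
  have le: "cmod (av t ?g x) \<le> l2norm h / Im z" for t
    by (rule av_norm_le) (use G_inf_norm[of "{_}"] in \<open>simp add: L2_set_def\<close>)
  have sm: "summable (\<lambda>t. of_real (p t) * av t ?g x)"
  proof (rule summable_comparison_test)
    show "\<exists>N. \<forall>t\<ge>N. norm (of_real (p t) * av t ?g x) \<le> p t * (l2norm h / Im z)"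
      using mult_left_mono[OF le p_nonneg] by (simp add: norm_mult p_nonneg)
    show "summable (\<lambda>t. p t * (l2norm h / Im z))" by (intro summable_mult2 p_summable)
  qed
  have S: "(\<lambda>r. \<Sum>t\<le>r. of_real (p t) * av t ?g x) \<longlonglongrightarrow> Lap Q n p ?g x"
    using summable_sums[OF sm] by (simp add: sums_def_le Lap_def Eop_av)
  have D: "(\<lambda>r. (\<Sum>t\<le>r. of_real (p t) * av t ?g x) - (\<Sum>t\<le>r. of_real (p t) * av t (F.G r \<omega> z h) x)) \<longlonglongrightarrow> 0"
  proof (rule Lim_null_comparison[OF always_eventually kappa_tendsto[OF h]], intro allI)
    fix r
    define c where "c = kappa z h r"
    have le: "cmod (av t (\<lambda>x. ?g x - F.G r \<omega> z h x) x) \<le> c" for t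
      by (rule av_norm_le) (use G_inf_diff[of "{_}" r] in \<open>simp add: L2_set_def c_def\<close>)
    have c0: "c \<ge> 0" using le[of 0] by (rule order_trans[OF norm_ge_zero])
    have "(\<Sum>t\<le>r. of_real (p t) * av t ?g x) - (\<Sum>t\<le>r. of_real (p t) * av t (F.G r \<omega> z h) x)
       = (\<Sum>t\<le>r. of_real (p t) * av t (\<lambda>x. ?g x - F.G r \<omega> z h x) x)"
      by (simp add: av_diff algebra_simps sum_subtractf)
    also have "norm \<dots> \<le> (\<Sum>t\<le>r. p t * c)"
      using p_nonneg le by (intro sum_norm_le) (auto simp: norm_mult intro!: mult_left_mono)
    also have "\<dots> = (\<Sum>t\<le>r. p t) * c" by (simp add: sum_distrib_right)
    also have "\<dots> \<le> 1 * c" using c0 by (intro mult_right_mono p_partial) auto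
    finally show "norm ((\<Sum>t\<le>r. of_real (p t) * av t ?g x) - (\<Sum>t\<le>r. of_real (p t) * av t (F.G r \<omega> z h) x)) \<le> kappa z h r"
      by (simp add: c_def)
  qed
  show ?thesis using tendsto_diff[OF S D] by simp
qed

lemma G_inf_solves: "Hop Q n p \<omega> (G_inf \<omega> z h) x - z * G_inf \<omega> z h x = h x"
proof -
  have "(\<lambda>r. (\<Sum>t\<le>r. of_real (p t) * av t (F.G r \<omega> z h) x) + of_real (\<omega> x) * F.G r \<omega> z h x - z * F.G r \<omega> z h x)
     \<longlonglongrightarrow> Lap Q n p (G_inf \<omega> z h) x + of_real (\<omega> x) * G_inf \<omega> z h x - z * G_inf \<omega> z h x"
    by (intro tendsto_intros partial_Lap_tendsto G_tendsto)
  moreover have "eventually (\<lambda>r. (\<Sum>t\<le>r. of_real (p t) * av t (F.G r \<omega> z h) x) + of_real (\<omega> x) * F.G r \<omega> z h x - z * F.G r \<omega> z h x = h x) sequentially"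
    using eventually_A[of "{x}"]
  proof (rule eventually_mono)
    fix r assume "{x} \<subseteq> A r"
    then show "(\<Sum>t\<le>r. of_real (p t) * av t (F.G r \<omega> z h) x) + of_real (\<omega> x) * F.G r \<omega> z h x - z * F.G r \<omega> z h x = h x"
      using F.G_solves[of z x r \<omega> h] z by (simp add: K_apply)
  qed simp
  ultimately show ?thesis
    unfolding Hop_def by (rule LIMSEQ_unique[OF _ tendsto_eventually])
qed

text \<open>The potential may be unbounded, so its product with the resolvent is not estimated
  directly; the resolvent equation expresses it by \<open>h\<close>, a multiple of the resolvent and
  the bounded hierarchical part.\<close>

lemma G_inf_dom: "G_inf \<omega> z h \<in> Hdom \<omega>"
proof -
  have "L2_set (\<lambda>x. cmod (of_real (\<omega> x) * G_inf \<omega> z h x)) B \<le> l2norm h + cmod z * (l2norm h / Im z) + l2norm h / Im z" if B: "finite B" for B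
  proof (rule LIMSEQ_le_const2)
    show "(\<lambda>r. L2_set (\<lambda>x. cmod (of_real (\<omega> x) * F.G r \<omega> z h x)) B) \<longlonglongrightarrow> L2_set (\<lambda>x. cmod (of_real (\<omega> x) * G_inf \<omega> z h x)) B"
      by (intro L2_set_tendsto tendsto_intros G_tendsto)
    have "eventually (\<lambda>r. L2_set (\<lambda>x. cmod (of_real (\<omega> x) * F.G r \<omega> z h x)) B \<le> l2norm h + cmod z * (l2norm h / Im z) + l2norm h / Im z) sequentially"
      using eventually_A[OF B]
    proof (rule eventually_mono)
      fix r assume BA: "B \<subseteq> A r"
      let ?g = "F.G r \<omega> z h"
      have "L2_set (\<lambda>x. cmod (of_real (\<omega> x) * ?g x)) B \<le> L2_set (\<lambda>x. cmod (of_real (\<omega> x) * ?g x)) (A r)"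
        by (rule L2_set_subset_mono[OF finite_Q BA])
      also have "\<dots> = L2_set (\<lambda>x. cmod ((h x + z * ?g x) + - (\<Sum>t\<le>r. of_real (p t) * av t ?g x))) (A r)"
      proof (rule L2_set_cong[OF refl])
        fix x assume "x \<in> A r"
        then have "of_real (\<omega> x) * ?g x = (h x + z * ?g x) + - (\<Sum>t\<le>r. of_real (p t) * av t ?g x)"
          using F.G_solves[of z x r \<omega> h] z by (simp add: K_apply algebra_simps)
        then show "cmod (of_real (\<omega> x) * ?g x) = cmod ((h x + z * ?g x) + - (\<Sum>t\<le>r. of_real (p t) * av t ?g x))" by simp
      qed
      also have "\<dots> \<le> L2_set (\<lambda>x. cmod (h x + z * ?g x)) (A r) + L2_set (\<lambda>x. cmod (- (\<Sum>t\<le>r. of_real (p t) * av t ?g x))) (A r)"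
        by (rule L2_set_cmod_triangle)
      also have "\<dots> \<le> (l2norm h + cmod z * (l2norm h / Im z)) + l2norm h / Im z"
      proof (rule add_mono)
        have "L2_set (\<lambda>x. cmod (h x + z * ?g x)) (A r) \<le> L2_set (\<lambda>x. cmod (h x)) (A r) + L2_set (\<lambda>x. cmod (z * ?g x)) (A r)"
          by (rule L2_set_cmod_triangle)
        also have "\<dots> \<le> l2norm h + cmod z * (l2norm h / Im z)"
          unfolding L2_set_cmod_cmult by (intro add_mono mult_left_mono L2_le_l2norm G_norm_le h z finite_Q) auto
        finally show "L2_set (\<lambda>x. cmod (h x + z * ?g x)) (A r) \<le> l2norm h + cmod z * (l2norm h / Im z)" .
        have "L2_set (\<lambda>x. cmod (\<Sum>t\<le>r. of_real (p t) * av t ?g x)) (A r) \<le> (\<Sum>t\<le>r. L2_set (\<lambda>x. cmod (of_real (p t) * av t ?g x)) (A r))"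
          by (rule L2_set_cmod_sum_le) simp
        also have "\<dots> \<le> (\<Sum>t\<le>r. p t * (l2norm h / Im z))"
        proof (rule sum_mono)
          fix t assume "t \<in> {..r}"
          then have "L2_set (\<lambda>x. cmod (av t ?g x)) (A r) \<le> l2norm h / Im z"
            by (intro order_trans[OF av_contraction G_norm_le] h z finite_Q) auto
          then show "L2_set (\<lambda>x. cmod (of_real (p t) * av t ?g x)) (A r) \<le> p t * (l2norm h / Im z)"
            unfolding L2_set_cmod_cmult using p_nonneg[of t] mult_left_mono by fastforce
        qed
        also have "\<dots> = (\<Sum>t\<le>r. p t) * (l2norm h / Im z)" by (rule sum_distrib_right[symmetric])
        also have "\<dots> \<le> 1 * (l2norm h / Im z)" using z l2norm_nonneg[of h] by (intro mult_right_mono p_partial) auto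
        finally show "L2_set (\<lambda>x. cmod (- (\<Sum>t\<le>r. of_real (p t) * av t ?g x))) (A r) \<le> l2norm h / Im z" by simp
      qed
      finally show "L2_set (\<lambda>x. cmod (of_real (\<omega> x) * ?g x)) B \<le> l2norm h + cmod z * (l2norm h / Im z) + l2norm h / Im z" .
    qed
    then show "\<exists>N. \<forall>r\<ge>N. L2_set (\<lambda>x. cmod (of_real (\<omega> x) * F.G r \<omega> z h x)) B \<le> l2norm h + cmod z * (l2norm h / Im z) + l2norm h / Im z"
      by (simp add: eventually_sequentially)
  qed
  then have "l2 (\<lambda>x. of_real (\<omega> x) * G_inf \<omega> z h x)" by (rule l2I)
  then show ?thesis using G_inf_l2 by (simp add: Hdom_def)
qed

lemma form_tendsto: "(\<lambda>r. stieltjes (F.smeas r \<omega> h) z) \<longlonglongrightarrow> l2inner h (G_inf \<omega> z h)"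
proof -
  let ?g = "G_inf \<omega> z h"
  have "(\<lambda>x. cnj (h x) * ?g x) summable_on UNIV"
  proof (rule abs_summable_summable, rule summable_on_comparison_test)
    show "(\<lambda>x. (cmod (h x))\<^sup>2 + (cmod (?g x))\<^sup>2) summable_on UNIV"
      using h G_inf_l2 unfolding l2_def by (rule summable_on_add)
    show "norm (cnj (h x) * ?g x) \<le> (cmod (h x))\<^sup>2 + (cmod (?g x))\<^sup>2" for x
    proof -
      have "0 \<le> cmod (h x) * cmod (?g x)" by simp
      then show ?thesis
        using sum_squares_bound[of "cmod (h x)" "cmod (?g x)"]
        unfolding norm_mult complex_mod_cnj by linarith
    qed
  qed simp
  then have S: "(\<lambda>r. \<Sum>x\<in>A r. cnj (h x) * ?g x) \<longlonglongrightarrow> l2inner h ?g"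
    unfolding l2inner_def by (rule sum_A_tendsto)
  have D: "(\<lambda>r. (\<Sum>x\<in>A r. cnj (h x) * ?g x) - stieltjes (F.smeas r \<omega> h) z) \<longlonglongrightarrow> 0"
  proof (rule Lim_null_comparison)
    show "(\<lambda>r. l2norm h * kappa z h r) \<longlonglongrightarrow> 0"
      using tendsto_mult[OF tendsto_const[of "l2norm h"] kappa_tendsto[OF h]] by simp
    have "norm ((\<Sum>x\<in>A r. cnj (h x) * ?g x) - stieltjes (F.smeas r \<omega> h) z) \<le> l2norm h * kappa z h r" for r
    proof -
      have "(\<Sum>x\<in>A r. cnj (h x) * ?g x) - stieltjes (F.smeas r \<omega> h) z
        = (\<Sum>x\<in>A r. cnj (h x) * (?g x - F.G r \<omega> z h x))"
        unfolding stieltjes_def F.stieltjes_smeas[symmetric] by (simp add: algebra_simps sum_subtractf)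
      also have "norm \<dots> \<le> L2_set (\<lambda>x. cmod (cnj (h x))) (A r) * L2_set (\<lambda>x. cmod (?g x - F.G r \<omega> z h x)) (A r)"
        by (rule norm_sum_mult_le)
      also have "\<dots> \<le> l2norm h * kappa z h r"
        using L2_le_l2norm[OF h finite_Q] G_inf_diff[OF finite_Q] l2norm_nonneg by (intro mult_mono) auto
      finally show ?thesis .
    qed
    then show "eventually (\<lambda>r. norm ((\<Sum>x\<in>A r. cnj (h x) * ?g x) - stieltjes (F.smeas r \<omega> h) z) \<le> l2norm h * kappa z h r) sequentially" by simp
  qed
  show ?thesis using tendsto_diff[OF S D] by simp
qed

end

text \<open>\<open>spectral_measure\<close> constrains \<open>\<mu>\<close> at every solution of the
  resolvent equation in the domain, so exhibiting the solution \<open>G_inf\<close> identifies its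
  transform as a limit of finite-volume ones.\<close>

lemma spectral_measure_limit:
  assumes "spectral_measure (Hop Q n p \<omega>) (Hdom \<omega>) \<psi> \<mu>" "l2 \<psi>" "Im z > 0"
  shows "(\<lambda>r. stieltjes (F.smeas r \<omega> \<psi>) z) \<longlonglongrightarrow> stieltjes \<mu> z"
proof -
  have "(\<lambda>x. Hop Q n p \<omega> (G_inf \<omega> z \<psi>) x - z * G_inf \<omega> z \<psi> x) = \<psi>"
    by (rule ext) (rule G_inf_solves[OF assms(2,3)])
  then have "l2inner \<psi> (G_inf \<omega> z \<psi>) = stieltjes \<mu> z"
    using assms(1) G_inf_dom[OF assms(2,3), of \<omega>] assms(3)
    unfolding spectral_measure_def stieltjes_def by blast
  then show ?thesis using form_tendsto[OF assms(2,3), of \<omega>] by simp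
qed

section \<open>The spectral measure of a site\<close>

definition delta :: "'a \<Rightarrow> complex" where "delta x = of_bool (x = x0)"

lemma x0_A: "x0 \<in> A r" by (rule Q_refl)

lemma sum_delta_A: "(\<Sum>x\<in>A r. delta x * f x) = f x0" "(\<Sum>x\<in>A r. f x * delta x) = f x0"
  using x0_A[of r] by (simp_all add: delta_def of_bool_def if_distrib[of "\<lambda>x. x * _"] if_distrib[of "\<lambda>x. _ * x"] sum.delta finite_Q cong: if_cong)

lemma L2_delta_le: "finite B \<Longrightarrow> L2_set (\<lambda>x. cmod (delta x)) B \<le> 1"
proof -
  assume "finite B"
  then have "(\<Sum>x\<in>B. (cmod (delta x))\<^sup>2) = (\<Sum>x\<in>B. if x = x0 then 1 else 0)"
    by (intro sum.cong) (auto simp: delta_def)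
  also have "\<dots> \<le> 1" using \<open>finite B\<close> by simp
  finally show ?thesis by (simp add: L2_set_def)
qed

lemma delta_l2: "l2 delta" by (rule l2I[OF L2_delta_le])

lemma coef_delta: "F.coef r \<omega> delta j = of_real (F.e r \<omega> j x0)"
  unfolding F.coef_def by (rule sum_delta_A(2))

text \<open>The Green function at \<open>x0\<close>, which is the transform of the spectral measure
  of \<open>delta\<close> (\<open>ex_delta_measure\<close>).\<close>

definition m :: "('a \<Rightarrow> real) \<Rightarrow> complex \<Rightarrow> complex" where
  "m \<omega> z = G_inf \<omega> z delta x0"

lemma stieltjes_delta: "stieltjes (F.smeas r \<omega> delta) z = F.G r \<omega> z delta x0"
proof -
  have "stieltjes (F.smeas r \<omega> delta) z = (\<Sum>x\<in>A r. delta x * F.G r \<omega> z delta x)"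
    unfolding stieltjes_def F.stieltjes_smeas[symmetric] by (intro sum.cong) (auto simp: delta_def)
  then show ?thesis by (simp add: sum_delta_A)
qed

lemma m_tendsto: "Im z > 0 \<Longrightarrow> (\<lambda>r. F.G r \<omega> z delta x0) \<longlonglongrightarrow> m \<omega> z"
  unfolding m_def by (rule G_tendsto[OF delta_l2])

lemma finite_borel_smeas: "finite_borel (F.smeas r \<omega> h)"
  by (intro finite_borel.intro finite_borel_axioms.intro F.finite_measure_smeas F.sets_smeas)

lemma measure_smeas: "measure (F.smeas r \<omega> h) UNIV = (\<Sum>x\<in>A r. (cmod (h x))\<^sup>2)"
  by (simp add: measure_def F.emeasure_smeas_UNIV sum_nonneg)

lemma measure_smeas_delta: "measure (F.smeas r \<omega> delta) UNIV = 1"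
proof -
  have "(\<Sum>x\<in>A r. (cmod (delta x))\<^sup>2) = (\<Sum>x\<in>A r. if x = x0 then 1 else 0)"
    by (intro sum.cong) (auto simp: delta_def)
  then show ?thesis using x0_A[of r] by (simp add: measure_smeas finite_Q)
qed

text \<open>This is the squared norm of the matrix applied to \<open>delta\<close>. The averages are
  contractions of total weight at most 1 and the potential is felt only at \<open>x0\<close>, so the
  bound is uniform in r and yields tightness.\<close>

lemma second_moment:
  "(\<integral>t. t\<^sup>2 \<partial>F.smeas r \<omega> delta) \<le> (1 + \<bar>\<omega> x0\<bar>)\<^sup>2"
proof -
  let ?k = "\<lambda>x. \<Sum>y\<in>A r. of_real (K \<omega> r x y) * delta y"
  have "(\<integral>t. t\<^sup>2 \<partial>F.smeas r \<omega> delta) = (\<Sum>j<card (A r). (cmod (F.coef r \<omega> ?k j))\<^sup>2)"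
    by (subst F.integral_smeas) (auto intro!: sum.cong simp: F.coef_K norm_mult power_mult_distrib)
  also have "\<dots> = (\<Sum>x\<in>A r. (cmod (?k x))\<^sup>2)" by (rule F.parseval[symmetric])
  also have "\<dots> = (L2_set (\<lambda>x. cmod (?k x)) (A r))\<^sup>2" by (simp add: L2_set_def sum_nonneg)
  also have "\<dots> \<le> (1 + \<bar>\<omega> x0\<bar>)\<^sup>2"
  proof (rule power_mono)
    have "L2_set (\<lambda>x. cmod (?k x)) (A r) = L2_set (\<lambda>x. cmod ((\<Sum>s\<le>r. of_real (p s) * av s delta x) + of_real (\<omega> x0) * delta x)) (A r)"
    proof (rule L2_set_cong[OF refl])
      fix x assume "x \<in> A r"
      moreover have "of_real (\<omega> x) * delta x = of_real (\<omega> x0) * delta x"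
        by (cases "x = x0") (auto simp: delta_def)
      ultimately show "cmod (?k x) = cmod ((\<Sum>s\<le>r. of_real (p s) * av s delta x) + of_real (\<omega> x0) * delta x)"
        by (simp only: K_apply)
    qed
    also have "\<dots> \<le> L2_set (\<lambda>x. cmod (\<Sum>s\<le>r. of_real (p s) * av s delta x)) (A r) + L2_set (\<lambda>x. cmod (of_real (\<omega> x0) * delta x)) (A r)"
      by (rule L2_set_cmod_triangle)
    also have "\<dots> \<le> 1 + \<bar>\<omega> x0\<bar>"
    proof (rule add_mono)
      have "L2_set (\<lambda>x. cmod (\<Sum>s\<le>r. of_real (p s) * av s delta x)) (A r) \<le> (\<Sum>s\<le>r. L2_set (\<lambda>x. cmod (of_real (p s) * av s delta x)) (A r))"
        by (rule L2_set_cmod_sum_le) simp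
      also have "\<dots> \<le> (\<Sum>s\<le>r. p s)"
      proof (rule sum_mono)
        fix s assume "s \<in> {..r}"
        then have "L2_set (\<lambda>x. cmod (av s delta x)) (A r) \<le> 1"
          by (intro order_trans[OF av_contraction L2_delta_le] finite_Q) auto
        then show "L2_set (\<lambda>x. cmod (of_real (p s) * av s delta x)) (A r) \<le> p s"
          unfolding L2_set_cmod_cmult using p_nonneg[of s] mult_left_mono by fastforce
      qed
      also have "\<dots> \<le> 1" by (rule p_partial) simp
      finally show "L2_set (\<lambda>x. cmod (\<Sum>s\<le>r. of_real (p s) * av s delta x)) (A r) \<le> 1" .
      show "L2_set (\<lambda>x. cmod (of_real (\<omega> x0) * delta x)) (A r) \<le> \<bar>\<omega> x0\<bar>"
        unfolding L2_set_cmod_cmult using mult_left_mono[OF L2_delta_le[OF finite_Q, of r x0], of "\<bar>\<omega> x0\<bar>"] by simp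
    qed
    finally show "L2_set (\<lambda>x. cmod (?k x)) (A r) \<le> 1 + \<bar>\<omega> x0\<bar>" .
  qed simp
  finally show ?thesis .
qed

lemma real_distribution_smeas_delta: "real_distribution (F.smeas r \<omega> delta)"
proof (intro real_distribution.intro real_distribution_axioms.intro prob_spaceI)
  interpret f: finite_borel "F.smeas r \<omega> delta" by (rule finite_borel_smeas)
  show "emeasure (F.smeas r \<omega> delta) (space (F.smeas r \<omega> delta)) = 1"
    using measure_smeas_delta[of r \<omega>] by (simp add: f.emeasure_eq_measure)
qed simp

lemma smeas_delta_tight: "tight (\<lambda>r. F.smeas r \<omega> delta)"
  unfolding tight_def
proof (intro conjI allI impI real_distribution_smeas_delta)
  fix \<epsilon> :: real assume \<epsilon>: "\<epsilon> > 0"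
  define b where "b = (1 + \<bar>\<omega> x0\<bar>)\<^sup>2"
  have b: "b > 0" by (simp add: b_def add_pos_nonneg)
  \<comment> \<open>Chebyshev with the second moment bound \<open>b\<close>: this radius leaves mass
    at most \<open>\<epsilon> / 2\<close> outside.\<close>
  define a where "a = sqrt (2 * b / \<epsilon>)"
  have a: "a > 0" "a\<^sup>2 = 2 * b / \<epsilon>" using b \<epsilon> by (auto simp: a_def)
  have "measure (F.smeas r \<omega> delta) {-a<..a} > 1 - \<epsilon>" for r
  proof -
    interpret f: finite_borel "F.smeas r \<omega> delta" by (rule finite_borel_smeas)
    have int: "integrable (F.smeas r \<omega> delta) (\<lambda>t. indicator (- {-a<..a}) t :: real)"
      by (intro integrable_real_indicator) (auto simp: f.emeasure_eq_measure)
    have "measure (F.smeas r \<omega> delta) (- {-a<..a}) = (\<integral>t. indicator (- {-a<..a}) t \<partial>F.smeas r \<omega> delta)" by simp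
    also have "\<dots> = (\<Sum>j<card (A r). (cmod (F.coef r \<omega> delta j))\<^sup>2 *\<^sub>R indicator (- {-a<..a}) (F.l r \<omega> j))"
      by (rule F.integral_smeas) auto
    also have "\<dots> \<le> (\<Sum>j<card (A r). (cmod (F.coef r \<omega> delta j))\<^sup>2 *\<^sub>R ((F.l r \<omega> j)\<^sup>2 / a\<^sup>2))"
    proof (intro sum_mono scaleR_left_mono)
      fix t :: real
      show "indicator (- {-a<..a}) t \<le> t\<^sup>2 / a\<^sup>2"
      proof (cases "t \<in> {-a<..a}")
        case False
        then have "\<bar>a\<bar> \<le> \<bar>t\<bar>" using a(1) by auto
        then have "a\<^sup>2 \<le> t\<^sup>2" by (simp add: abs_le_square_iff)
        then show ?thesis using a(1) False by (simp add: le_divide_eq)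
      qed simp
    qed simp
    also have "\<dots> = (\<integral>t. t\<^sup>2 / a\<^sup>2 \<partial>F.smeas r \<omega> delta)" by (rule F.integral_smeas[symmetric]) auto
    also have "\<dots> = (\<integral>t. t\<^sup>2 \<partial>F.smeas r \<omega> delta) / a\<^sup>2" by (rule integral_divide_zero)
    also have "\<dots> \<le> b / a\<^sup>2" using second_moment by (intro divide_right_mono) (auto simp: b_def)
    also have "\<dots> = \<epsilon> / 2" using a b \<epsilon> by simp
    finally have "measure (F.smeas r \<omega> delta) (- {-a<..a}) < \<epsilon>" using \<epsilon> by simp
    moreover have "measure (F.smeas r \<omega> delta) (- {-a<..a}) = 1 - measure (F.smeas r \<omega> delta) {-a<..a}"
      using f.finite_measure_compl[of "{-a<..a}"] measure_smeas_delta[of r \<omega>] by (simp add: Compl_eq_Diff_UNIV)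
    ultimately show ?thesis by simp
  qed
  then show "\<exists>a b. a < b \<and> (\<forall>r. 1 - \<epsilon> < measure (F.smeas r \<omega> delta) {a<..b})"
    using a(1) by (intro exI[of _ "-a"] exI[of _ a]) auto
qed

text \<open>Tightness gives a weakly convergent subsequence without loss of mass. Its limit has the
  transform \<open>m\<close>, since the whole sequence of transforms converges to
  \<open>m\<close>.\<close>

lemma ex_delta_measure:
  "\<exists>\<mu>. finite_borel \<mu> \<and> measure \<mu> UNIV = 1 \<and> (\<forall>z. Im z > 0 \<longrightarrow> stieltjes \<mu> z = m \<omega> z)"
proof -
  obtain r \<mu> where r: "strict_mono r" and \<mu>: "real_distribution \<mu>"
    and wc: "weak_conv_m ((\<lambda>r. F.smeas r \<omega> delta) \<circ> id \<circ> r) \<mu>"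
    using tight_imp_convergent_subsubsequence[OF smeas_delta_tight strict_mono_id] by blast
  interpret \<mu>: real_distribution \<mu> by fact
  have fb: "finite_borel \<mu>" by (intro finite_borel.intro finite_borel_axioms.intro \<mu>.finite_measure_axioms) simp
  interpret fb: finite_borel \<mu> by fact
  have "stieltjes \<mu> z = m \<omega> z" if z: "Im z > 0" for z
  proof -
    have "(\<lambda>k. \<integral>t. 1 / (of_real t - z) \<partial>((\<lambda>r. F.smeas r \<omega> delta) \<circ> id \<circ> r) k) \<longlonglongrightarrow> (\<integral>t. 1 / (of_real t - z) \<partial>\<mu>)"
    proof (rule weak_conv_imp_integral_bdd_continuous_conv[OF _ \<mu> wc])
      show "isCont (\<lambda>t. 1 / (of_real t - z)) t" for t
        using z by (intro continuous_intros) (auto simp: complex_eq_iff)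
      show "norm (1 / (of_real t - z)) \<le> 1 / Im z" for t by (rule fb.norm_kernel_le[OF z])
    qed (simp add: real_distribution_smeas_delta)
    then have "(\<lambda>k. F.G (r k) \<omega> z delta x0) \<longlonglongrightarrow> stieltjes \<mu> z"
      by (simp add: stieltjes_def[symmetric] stieltjes_delta)
    moreover have "(\<lambda>k. F.G (r k) \<omega> z delta x0) \<longlonglongrightarrow> m \<omega> z"
      using LIMSEQ_subseq_LIMSEQ[OF m_tendsto[OF z] r] by (simp add: o_def)
    ultimately show ?thesis by (rule LIMSEQ_unique)
  qed
  then show ?thesis using fb \<mu>.prob_space by auto
qed

section \<open>Resolvent bounds for almost every energy\<close>

text \<open>The coefficients of the constant 1 in the real eigenbasis have square sum
  \<open>card (A r)\<close>, the normalisation of \<open>small_exceptional_set\<close>. One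
  exceptional set serves all heights \<open>\<epsilon>\<close>.\<close>

lemma G_one_bound:
  assumes c: "c > 0"
  shows "\<exists>S\<in>sets borel. emeasure lborel S \<le> ennreal (10 / (c * u r)) \<and>
     (\<forall>E \<epsilon>. E \<notin> S \<longrightarrow> L2_set (\<lambda>x. cmod (F.G r \<omega> (Complex E \<epsilon>) (\<lambda>_. 1) x)) (A r) \<le> NN n r * (c * u r))"
proof -
  define a where "a = (\<lambda>j. \<Sum>y\<in>A r. F.e r \<omega> j y)"
  have coef: "F.coef r \<omega> (\<lambda>_. 1) j = of_real (a j)" for j by (simp add: F.coef_def a_def)
  have "(\<Sum>j<card (A r). (a j)\<^sup>2) = real (card (A r))"
    using F.parseval[of "\<lambda>_. 1" r \<omega>] by (simp add: coef)
  moreover have "card (A r) > 0" using x0_A finite_Q by (auto simp: card_gt_0_iff)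
  moreover have "c * u r > 0" using c u_pos by simp
  ultimately obtain S where S: "S \<in> sets borel" "emeasure lborel S \<le> ennreal (10 / (c * u r))"
    "\<And>E \<epsilon>. E \<notin> S \<Longrightarrow> (\<Sum>j<card (A r). (a j)\<^sup>2 / ((F.l r \<omega> j - E)\<^sup>2 + \<epsilon>\<^sup>2)) \<le> (real (card (A r)) * (c * u r))\<^sup>2"
    using small_exceptional_set[where a = a and m = "card (A r)" and u = "c * u r" and l = "F.l r \<omega>"] by blast
  have "L2_set (\<lambda>x. cmod (F.G r \<omega> (Complex E \<epsilon>) (\<lambda>_. 1) x)) (A r) \<le> NN n r * (c * u r)" if "E \<notin> S" for E \<epsilon>
  proof -
    have "(\<Sum>x\<in>A r. (cmod (F.G r \<omega> (Complex E \<epsilon>) (\<lambda>_. 1) x))\<^sup>2) \<le> (NN n r * (c * u r))\<^sup>2"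
      unfolding F.norm_G cmod_diff_Complex coef using S(3)[OF that, of \<epsilon>] by (simp add: card_Q)
    then show ?thesis unfolding L2_set_def using N_pos[of r] c u_pos[of r]
      by (intro real_le_lsqrt) auto
  qed
  then show ?thesis using S by blast
qed

text \<open>In \<open>G_residual\<close> the new tail is constant on \<open>A (Suc r)\<close>, so
  the correction is a multiple of the resolvent of the constant 1.\<close>

lemma G_delta_step:
  assumes z: "Im z > 0"
  shows "L2_set (\<lambda>x. cmod (F.G (Suc r) \<omega> z delta x)) (A (Suc r))
    \<le> L2_set (\<lambda>x. cmod (F.G r \<omega> z delta x)) (A r) + p (Suc r) / NN n (Suc r) * L2_set (\<lambda>x. cmod (F.G r \<omega> z (\<lambda>_. 1) x)) (A r) * L2_set (\<lambda>x. cmod (F.G (Suc r) \<omega> z (\<lambda>_. 1) x)) (A (Suc r))"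
proof -
  define k where "k = - of_real (p (Suc r) / NN n (Suc r)) * (\<Sum>y\<in>A r. F.G r \<omega> z delta y)"
  have "F.G (Suc r) \<omega> z delta x = F.G r \<omega> z delta x + k * F.G (Suc r) \<omega> z (\<lambda>_. 1) x" if x: "x \<in> A (Suc r)" for x
  proof -
    have I: "{r<..Suc r} = {Suc r}" by auto
    have "tail r (Suc r) (F.G r \<omega> z delta) y = - k" if "y \<in> A (Suc r)" for y
      unfolding tail_def k_def I using that by simp
    moreover have "(if y \<in> A r then 0 else delta y) = 0" for y using x0_A[of r] by (auto simp: delta_def)
    ultimately have "F.coef (Suc r) \<omega> (\<lambda>x. (if x \<in> A r then 0 else delta x) - tail r (Suc r) (F.G r \<omega> z delta) x) j
       = F.coef (Suc r) \<omega> (\<lambda>_. k) j" for j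
      by (intro F.coef_cong) simp
    moreover have "F.coef (Suc r) \<omega> (\<lambda>_. k) j = k * F.coef (Suc r) \<omega> (\<lambda>_. 1) j" for j
      by (simp add: F.coef_def sum_distrib_left mult.commute)
    ultimately have "F.G (Suc r) \<omega> z (\<lambda>x. (if x \<in> A r then 0 else delta x) - tail r (Suc r) (F.G r \<omega> z delta) x) x
       = k * F.G (Suc r) \<omega> z (\<lambda>_. 1) x"
      by (simp add: F.G_def sum_distrib_left mult_ac)
    then show ?thesis using G_residual[OF z le_SucI[OF order_refl] x, of \<omega> delta] by (simp add: algebra_simps)
  qed
  then have "L2_set (\<lambda>x. cmod (F.G (Suc r) \<omega> z delta x)) (A (Suc r))
     = L2_set (\<lambda>x. cmod (F.G r \<omega> z delta x + k * F.G (Suc r) \<omega> z (\<lambda>_. 1) x)) (A (Suc r))"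
    by (intro L2_set_cong) auto
  also have "\<dots> \<le> L2_set (\<lambda>x. cmod (F.G r \<omega> z delta x)) (A (Suc r)) + cmod k * L2_set (\<lambda>x. cmod (F.G (Suc r) \<omega> z (\<lambda>_. 1) x)) (A (Suc r))"
    by (rule order_trans[OF L2_set_cmod_triangle]) (simp only: L2_set_cmod_cmult order_refl)
  also have "L2_set (\<lambda>x. cmod (F.G r \<omega> z delta x)) (A (Suc r)) = L2_set (\<lambda>x. cmod (F.G r \<omega> z delta x)) (A r)"
    unfolding L2_set_def using A_mono[of r "Suc r"]
    by (intro arg_cong[of _ _ sqrt] sum.mono_neutral_right) (auto simp: finite_Q G_outside)
  also have "cmod k \<le> p (Suc r) / NN n (Suc r) * L2_set (\<lambda>x. cmod (F.G r \<omega> z (\<lambda>_. 1) x)) (A r)"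
  proof -
    \<comment> \<open>Symmetry of the resolvent turns the total sum of G delta into the value of G 1
      at \<open>x0\<close>, which \<open>G_one_bound\<close> controls.\<close>
    have "(\<Sum>y\<in>A r. F.G r \<omega> z delta y) = F.G r \<omega> z (\<lambda>_. 1) x0"
      using F.G_symmetric[of "\<lambda>_. 1" r \<omega> z delta] by (simp add: sum_delta_A)
    then have "cmod k = p (Suc r) / NN n (Suc r) * cmod (F.G r \<omega> z (\<lambda>_. 1) x0)"
      using p_nonneg[of "Suc r"] N_pos[of "Suc r"] by (simp add: k_def norm_mult norm_divide)
    also have "\<dots> \<le> p (Suc r) / NN n (Suc r) * L2_set (\<lambda>x. cmod (F.G r \<omega> z (\<lambda>_. 1) x)) (A r)"
      using p_nonneg[of "Suc r"] N_pos[of "Suc r"]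
      by (intro mult_left_mono member_le_L2_set finite_Q x0_A) auto
    finally show ?thesis .
  qed
  finally show ?thesis by (simp add: mult_right_mono)
qed

text \<open>Outside the union of the exceptional sets of all ranks the norms of G_r delta grow by
  summable increments and stay below a constant \<open>D\<close>. Their squares tend to Im m /
  \<epsilon>.\<close>

lemma m_bound:
  assumes e: "e > 0"
  shows "\<exists>S\<in>sets borel. \<exists>C. emeasure lborel S \<le> ennreal e \<and> (\<forall>E \<epsilon>. E \<notin> S \<longrightarrow> \<epsilon> > 0 \<longrightarrow> Im (m \<omega> (Complex E \<epsilon>)) \<le> C * \<epsilon>)"
proof -
  \<comment> \<open>Rank 0 has an exceptional set as well, so the sum starts at index 0.\<close>
  have u_sum: "summable (\<lambda>r. 1 / u r)" using u_inv by (simp only: summable_Suc_iff[of "\<lambda>r. 1 / u r"])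
  define U where "U = (\<Sum>r. 1 / u r)"
  have U: "U > 0" unfolding U_def using u_sum u_pos by (intro suminf_pos) auto
  \<comment> \<open>Makes the total measure 10 U / c of the exceptional sets equal to
    \<open>e\<close>.\<close>
  define c where "c = 10 * U / e"
  have c: "c > 0" using U e by (simp add: c_def)
  have "\<forall>r. \<exists>S. S \<in> sets borel \<and> emeasure lborel S \<le> ennreal (10 / (c * u r)) \<and>
     (\<forall>E \<epsilon>. E \<notin> S \<longrightarrow> L2_set (\<lambda>x. cmod (F.G r \<omega> (Complex E \<epsilon>) (\<lambda>_. 1) x)) (A r) \<le> NN n r * (c * u r))"
    using G_one_bound[OF c] by blast
  from choice[OF this] obtain S where S: "\<And>r. S r \<in> sets borel" "\<And>r. emeasure lborel (S r) \<le> ennreal (10 / (c * u r))"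
    and b: "\<And>r E \<epsilon>. E \<notin> S r \<Longrightarrow> L2_set (\<lambda>x. cmod (F.G r \<omega> (Complex E \<epsilon>) (\<lambda>_. 1) x)) (A r) \<le> NN n r * (c * u r)" by blast
  have "emeasure lborel (\<Union>r. S r) \<le> (\<Sum>r. emeasure lborel (S r))"
    using S by (intro emeasure_subadditive_countably) auto
  also have "\<dots> \<le> (\<Sum>r. ennreal (10 / (c * u r)))" by (intro suminf_le S) auto
  also have "\<dots> = ennreal (\<Sum>r. 10 / c * (1 / u r))"
    using c u_pos summable_mult[OF u_sum, of "10 / c"] by (subst suminf_ennreal2) (auto simp: less_imp_le)
  also have "(\<Sum>r. 10 / c * (1 / u r)) = e"
    unfolding suminf_mult[OF u_sum] U_def[symmetric] using U e by (simp add: c_def)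
  finally have meas: "emeasure lborel (\<Union>r. S r) \<le> ennreal e" .
  define w where "w = (\<lambda>r. p (Suc r) * NN n r * u r * u (Suc r))"
  have w0: "w r \<ge> 0" for r unfolding w_def using p_nonneg N_pos u_pos by (simp add: less_imp_le)
  define D where "D = NN n 0 * (c * u 0) + c\<^sup>2 * (\<Sum>r. w r)"
  have Gb: "L2_set (\<lambda>x. cmod (F.G r \<omega> (Complex E \<epsilon>) delta x)) (A r) \<le> NN n 0 * (c * u 0) + c\<^sup>2 * (\<Sum>t<r. w t)"
    if E: "E \<notin> (\<Union>r. S r)" and \<epsilon>: "\<epsilon> > 0" for E \<epsilon> r
  proof (induction r)
    case 0
    \<comment> \<open>\<open>A 0\<close> is the single site \<open>x0\<close>, where
      \<open>delta\<close> agrees with the constant 1.\<close>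
    have "F.coef 0 \<omega> delta j = F.coef 0 \<omega> (\<lambda>_. 1) j" for j
      by (rule F.coef_cong) (auto simp: Q_0 delta_def)
    then have "F.G 0 \<omega> (Complex E \<epsilon>) delta x = F.G 0 \<omega> (Complex E \<epsilon>) (\<lambda>_. 1) x" for x
      by (simp add: F.G_def)
    then show ?case using b[of E 0 \<epsilon>] E by simp
  next
    case (Suc r)
    let ?z = "Complex E \<epsilon>"
    have "L2_set (\<lambda>x. cmod (F.G (Suc r) \<omega> ?z delta x)) (A (Suc r))
      \<le> L2_set (\<lambda>x. cmod (F.G r \<omega> ?z delta x)) (A r) + p (Suc r) / NN n (Suc r) * L2_set (\<lambda>x. cmod (F.G r \<omega> ?z (\<lambda>_. 1) x)) (A r) * L2_set (\<lambda>x. cmod (F.G (Suc r) \<omega> ?z (\<lambda>_. 1) x)) (A (Suc r))"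
      using \<epsilon> by (intro G_delta_step) simp
    also have "\<dots> \<le> (NN n 0 * (c * u 0) + c\<^sup>2 * (\<Sum>t<r. w t)) + p (Suc r) / NN n (Suc r) * (NN n r * (c * u r)) * (NN n (Suc r) * (c * u (Suc r)))"
      using p_nonneg[of "Suc r"] N_pos[of "Suc r"] N_pos[of r] u_pos[of r] c E
      by (intro add_mono Suc.IH mult_mono b mult_nonneg_nonneg) auto
    also have "p (Suc r) / NN n (Suc r) * (NN n r * (c * u r)) * (NN n (Suc r) * (c * u (Suc r))) = c\<^sup>2 * w r"
      using N_pos[of "Suc r"] by (simp add: w_def power2_eq_square)
    finally show ?case by (simp add: algebra_simps)
  qed
  have GD: "L2_set (\<lambda>x. cmod (F.G r \<omega> (Complex E \<epsilon>) delta x)) (A r) \<le> D" if "E \<notin> (\<Union>r. S r)" "\<epsilon> > 0" for E \<epsilon> r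
  proof -
    have "(\<Sum>t<r. w t) \<le> (\<Sum>r. w r)" using u_cond w0 by (intro sum_le_suminf) (auto simp: w_def)
    then have "c\<^sup>2 * (\<Sum>t<r. w t) \<le> c\<^sup>2 * (\<Sum>r. w r)" by (rule mult_left_mono) simp
    then show ?thesis using Gb[OF that, of r] unfolding D_def by linarith
  qed
  have "Im (m \<omega> (Complex E \<epsilon>)) \<le> D\<^sup>2 * \<epsilon>" if "E \<notin> (\<Union>r. S r)" "\<epsilon> > 0" for E \<epsilon>
  proof (rule LIMSEQ_le_const2)
    show "(\<lambda>r. Im (F.G r \<omega> (Complex E \<epsilon>) delta x0)) \<longlonglongrightarrow> Im (m \<omega> (Complex E \<epsilon>))"
      using that by (intro tendsto_intros m_tendsto) simp
    have "Im (F.G r \<omega> (Complex E \<epsilon>) delta x0) \<le> D\<^sup>2 * \<epsilon>" for r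
    proof -
      interpret f: finite_borel "F.smeas r \<omega> delta" by (rule finite_borel_smeas)
      have "Im (F.G r \<omega> (Complex E \<epsilon>) delta x0) = \<epsilon> * res2 (F.smeas r \<omega> delta) (Complex E \<epsilon>)"
        using that f.Im_stieltjes[of "Complex E \<epsilon>"] by (simp add: stieltjes_delta)
      also have "res2 (F.smeas r \<omega> delta) (Complex E \<epsilon>) = (L2_set (\<lambda>x. cmod (F.G r \<omega> (Complex E \<epsilon>) delta x)) (A r))\<^sup>2"
        unfolding res2_def F.norm_G_smeas[symmetric] by (simp add: L2_set_def sum_nonneg)
      also have "\<epsilon> * \<dots> \<le> \<epsilon> * D\<^sup>2" using that by (intro mult_left_mono power_mono GD) auto
      finally show ?thesis by (simp add: mult.commute)
    qed
    then show "\<exists>N. \<forall>r\<ge>N. Im (F.G r \<omega> (Complex E \<epsilon>) delta x0) \<le> D\<^sup>2 * \<epsilon>" by blast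
  qed
  moreover have "(\<Union>r. S r) \<in> sets borel" using S by blast
  ultimately show ?thesis using meas by blast
qed

section \<open>Mutual singularity and rank-one perturbations\<close>

lemma m_singular_null:
  assumes \<mu>: "finite_borel \<mu>" and st: "\<And>z. Im z > 0 \<Longrightarrow> stieltjes \<mu> z = m \<omega> z"
  shows "emeasure lborel (singular_part \<mu>) = 0"
proof -
  interpret finite_borel \<mu> by fact
  have le: "emeasure lborel (singular_part \<mu>) \<le> 0 + ennreal e" if e: "e > 0" for e
  proof -
    obtain S C where S: "S \<in> sets borel" "emeasure lborel S \<le> ennreal e"
      and C: "\<And>E \<epsilon>. E \<notin> S \<Longrightarrow> \<epsilon> > 0 \<Longrightarrow> Im (m \<omega> (Complex E \<epsilon>)) \<le> C * \<epsilon>"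
      using m_bound[OF e] by blast
    obtain k where k: "C \<le> real k" using real_arch_simple by blast
    have "singular_part \<mu> \<subseteq> S"
    proof (rule ccontr)
      assume "\<not> singular_part \<mu> \<subseteq> S"
      then obtain E where E: "E \<in> singular_part \<mu>" "E \<notin> S" by blast
      have "res2 \<mu> (Complex E (1 / Suc i)) \<le> real k" for i
      proof -
        have "1 / real (Suc i) * res2 \<mu> (Complex E (1 / Suc i)) = Im (m \<omega> (Complex E (1 / Suc i)))"
          using Im_stieltjes[of "Complex E (1 / Suc i)"] st[of "Complex E (1 / Suc i)"] by simp
        also have "\<dots> \<le> C * (1 / Suc i)" by (rule C[OF E(2)]) simp
        finally have "res2 \<mu> (Complex E (1 / Suc i)) \<le> C" by (simp add: field_simps del: of_nat_Suc)
        then show ?thesis using k by linarith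
      qed
      then show False using E(1) by (auto simp: singular_part_def)
    qed
    then show ?thesis using S by (simp add: order_trans[OF emeasure_mono])
  qed
  have "emeasure lborel (singular_part \<mu>) \<le> 0" by (rule ennreal_le_epsilon) (rule le)
  then show ?thesis by simp
qed

text \<open>In finite volume \<open>\<psi> x0\<close> is the total mass of the cross measure of \<open>delta\<close> and \<open>\<psi>\<close>. A cut-off
  \<open>f\<close> separating \<open>\<mu>\<close> from \<open>\<nu>\<close> splits that mass, and AM-GM bounds each half by the two spectral
  measures; only their vague convergence is needed to pass to the limit.\<close>
lemma orthogonal_of_mutually_singular:
  assumes \<mu>: "finite_borel \<mu>" "measure \<mu> UNIV = 1" "\<And>z. Im z > 0 \<Longrightarrow> stieltjes \<mu> z = m \<omega> z"
    and \<psi>: "l2 \<psi>" and \<nu>: "finite_borel \<nu>"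
    and lim\<nu>: "\<And>z. Im z > 0 \<Longrightarrow> (\<lambda>r. stieltjes (F.smeas r \<omega> \<psi>) z) \<longlonglongrightarrow> stieltjes \<nu> z"
    and T: "T \<in> sets borel" "emeasure \<mu> (- T) = 0" "emeasure \<nu> T = 0"
  shows "\<psi> x0 = 0"
proof -
  interpret \<mu>: finite_borel \<mu> by fact
  have bound: "cmod (\<psi> x0) \<le> \<tau> * (3 + (l2norm \<psi>)\<^sup>2)" if \<tau>: "\<tau> > 0" for \<tau>
  proof -
    have "\<tau>\<^sup>2 > 0" using \<tau> by simp
    \<comment> \<open>The tolerance is the square of \<tau> because the estimate below divides it by
      \<tau>.\<close>
    then obtain f D R where f: "\<And>x. 0 \<le> f x" "\<And>x. f x \<le> 1" and lip: "\<And>x y. \<bar>f x - f y\<bar> \<le> D * \<bar>x - y\<bar>"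
      and supp: "\<And>x. \<bar>x\<bar> > R \<Longrightarrow> f x = 0"
      and f\<mu>: "1 - \<tau>\<^sup>2 \<le> (\<integral>t. f t \<partial>\<mu>)" and f\<nu>: "(\<integral>t. f t \<partial>\<nu>) \<le> \<tau>\<^sup>2"
      using \<mu>.separating_function[OF \<nu> T, of "\<tau>\<^sup>2"] \<mu>(2) by auto
    have "continuous_on UNIV f"
    proof (rule lipschitz_on_continuous_on)
      show "\<bar>D\<bar>-lipschitz_on UNIV f"
        by (intro lipschitz_onI) (auto simp: dist_real_def intro!: order_trans[OF lip mult_right_mono])
    qed
    then have fm: "f \<in> borel_measurable borel" by (rule borel_measurable_continuous_onI)
    have L\<mu>: "(\<lambda>r. \<integral>t. f t \<partial>F.smeas r \<omega> delta) \<longlonglongrightarrow> (\<integral>t. f t \<partial>\<mu>)"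
    proof (rule stieltjes_imp_vague[OF finite_borel_smeas \<mu>(1) _ _ f lip supp fm])
      show "measure (F.smeas r \<omega> delta) UNIV \<le> 1" for r by (simp add: measure_smeas_delta)
      show "(\<lambda>r. stieltjes (F.smeas r \<omega> delta) z) \<longlonglongrightarrow> stieltjes \<mu> z" if "Im z > 0" for z
        using m_tendsto[OF that] \<mu>(3)[OF that] by (simp add: stieltjes_delta)
    qed
    have L\<nu>: "(\<lambda>r. \<integral>t. f t \<partial>F.smeas r \<omega> \<psi>) \<longlonglongrightarrow> (\<integral>t. f t \<partial>\<nu>)"
      by (rule stieltjes_imp_vague[OF finite_borel_smeas \<nu> _ lim\<nu> f lip supp fm, where L = "(l2norm \<psi>)\<^sup>2"])
        (simp_all add: measure_smeas sum_le_l2norm[OF \<psi> finite_Q])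
    have "cmod (\<psi> x0) \<le> \<tau> + (1 / \<tau>) * (\<integral>t. f t \<partial>F.smeas r \<omega> \<psi>)
        + (1 / \<tau>) * (1 - (\<integral>t. f t \<partial>F.smeas r \<omega> delta)) + \<tau> * (l2norm \<psi>)\<^sup>2" for r
    proof -
      define a c F where "a = (\<lambda>j. cmod (F.coef r \<omega> delta j))" and "c = (\<lambda>j. cmod (F.coef r \<omega> \<psi> j))"
        and "F = (\<lambda>j. f (F.l r \<omega> j))"
      have I: "(\<integral>t. f t \<partial>F.smeas r \<omega> delta) = (\<Sum>j<card (A r). (a j)\<^sup>2 * F j)"
        "(\<integral>t. f t \<partial>F.smeas r \<omega> \<psi>) = (\<Sum>j<card (A r). (c j)\<^sup>2 * F j)"
        by (simp_all add: F.integral_smeas[OF fm] a_def c_def F_def)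
      have one: "(\<Sum>j<card (A r). (a j)\<^sup>2) = 1"
        using measure_smeas_delta[of r \<omega>] by (simp add: measure_smeas F.parseval[of _ r \<omega>] a_def)
      have psi: "(\<Sum>j<card (A r). (c j)\<^sup>2) \<le> (l2norm \<psi>)\<^sup>2"
        using sum_le_l2norm[OF \<psi> finite_Q, of r x0] by (simp add: F.parseval[of _ r \<omega>] c_def)
      have amgm: "x * y \<le> t * x\<^sup>2 + (1 / t) * y\<^sup>2" if "x \<ge> 0" "y \<ge> 0" "t > 0" for x y t :: real
      proof -
        have "2 * (sqrt t * x) * (y / sqrt t) \<le> (sqrt t * x)\<^sup>2 + (y / sqrt t)\<^sup>2" by (rule sum_squares_bound)
        then have "2 * (x * y) \<le> t * x\<^sup>2 + (1 / t) * y\<^sup>2"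
          using that by (simp add: power_mult_distrib power_divide)
        moreover have "0 \<le> x * y" using that by simp
        ultimately show ?thesis by linarith
      qed
      \<comment> \<open>The value at \<open>x0\<close> is the pairing with \<open>delta\<close>,
        hence exact in every volume.\<close>
      have "cmod (\<psi> x0) = cmod (\<Sum>j<card (A r). F.coef r \<omega> delta j * F.coef r \<omega> \<psi> j)"
        by (simp add: coef_delta F.expansion x0_A)
      also have "\<dots> \<le> (\<Sum>j<card (A r). a j * c j)"
        by (rule sum_norm_le) (simp add: a_def c_def norm_mult)
      \<comment> \<open>Each term is split by \<open>F j\<close> and \<open>1 - F j\<close>. The
        factor 1 / \<tau> goes to \<open>c j\<close> in the first half, as \<open>f\<close> has
        small integral against \<nu>, and to \<open>a j\<close> in the second, as 1 - f has small
        integral against \<mu>.\<close>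
      also have "\<dots> \<le> (\<Sum>j<card (A r). \<tau> * (a j)\<^sup>2 + (1 / \<tau>) * ((c j)\<^sup>2 * F j) + (1 / \<tau>) * ((a j)\<^sup>2 - (a j)\<^sup>2 * F j) + \<tau> * (c j)\<^sup>2)"
      proof (rule sum_mono)
        fix j
        have F: "0 \<le> F j" "F j \<le> 1" using f by (auto simp: F_def)
        have ac: "a j \<ge> 0" "c j \<ge> 0" by (auto simp: a_def c_def)
        have "F j * (a j * c j) \<le> F j * (\<tau> * (a j)\<^sup>2 + (1 / \<tau>) * (c j)\<^sup>2)"
          using amgm[OF ac \<tau>] F by (intro mult_left_mono) auto
        moreover have "(1 - F j) * (a j * c j) \<le> (1 - F j) * (\<tau> * (c j)\<^sup>2 + (1 / \<tau>) * (a j)\<^sup>2)"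
          using amgm[OF ac(2,1) \<tau>] F by (intro mult_left_mono) (auto simp: mult.commute)
        moreover have "F j * (\<tau> * (a j)\<^sup>2) \<le> 1 * (\<tau> * (a j)\<^sup>2)" "(1 - F j) * (\<tau> * (c j)\<^sup>2) \<le> 1 * (\<tau> * (c j)\<^sup>2)"
          using F \<tau> by (intro mult_right_mono; simp)+
        moreover have "(F j) * (a j * c j) + (1 - F j) * (a j * c j) = a j * c j" by (simp add: algebra_simps)
        moreover have "F j * (\<tau> * (a j)\<^sup>2 + (1 / \<tau>) * (c j)\<^sup>2) = F j * (\<tau> * (a j)\<^sup>2) + (1 / \<tau>) * ((c j)\<^sup>2 * F j)"
          by (simp add: algebra_simps)
        moreover have "(1 - F j) * (\<tau> * (c j)\<^sup>2 + (1 / \<tau>) * (a j)\<^sup>2) = (1 - F j) * (\<tau> * (c j)\<^sup>2) + (1 / \<tau>) * ((a j)\<^sup>2 - (a j)\<^sup>2 * F j)"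
          by (simp add: algebra_simps diff_divide_distrib)
        ultimately show "a j * c j \<le> \<tau> * (a j)\<^sup>2 + (1 / \<tau>) * ((c j)\<^sup>2 * F j) + (1 / \<tau>) * ((a j)\<^sup>2 - (a j)\<^sup>2 * F j) + \<tau> * (c j)\<^sup>2"
          by linarith
      qed
      also have "\<dots> = \<tau> * (\<Sum>j<card (A r). (a j)\<^sup>2) + (1 / \<tau>) * (\<Sum>j<card (A r). (c j)\<^sup>2 * F j)
         + (1 / \<tau>) * ((\<Sum>j<card (A r). (a j)\<^sup>2) - (\<Sum>j<card (A r). (a j)\<^sup>2 * F j)) + \<tau> * (\<Sum>j<card (A r). (c j)\<^sup>2)"
        by (simp only: sum.distrib sum_distrib_left sum_subtractf right_diff_distrib)
      also have "\<dots> \<le> \<tau> + (1 / \<tau>) * (\<integral>t. f t \<partial>F.smeas r \<omega> \<psi>)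
        + (1 / \<tau>) * (1 - (\<integral>t. f t \<partial>F.smeas r \<omega> delta)) + \<tau> * (l2norm \<psi>)\<^sup>2"
        unfolding I one using psi \<tau> by simp
      finally show ?thesis .
    qed
    moreover have "(\<lambda>r. \<tau> + (1 / \<tau>) * (\<integral>t. f t \<partial>F.smeas r \<omega> \<psi>)
        + (1 / \<tau>) * (1 - (\<integral>t. f t \<partial>F.smeas r \<omega> delta)) + \<tau> * (l2norm \<psi>)\<^sup>2)
      \<longlonglongrightarrow> \<tau> + (1 / \<tau>) * (\<integral>t. f t \<partial>\<nu>) + (1 / \<tau>) * (1 - (\<integral>t. f t \<partial>\<mu>)) + \<tau> * (l2norm \<psi>)\<^sup>2"
      by (intro tendsto_intros L\<mu> L\<nu>)
    ultimately have "cmod (\<psi> x0) \<le> \<tau> + (1 / \<tau>) * (\<integral>t. f t \<partial>\<nu>) + (1 / \<tau>) * (1 - (\<integral>t. f t \<partial>\<mu>)) + \<tau> * (l2norm \<psi>)\<^sup>2"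
      by (intro LIMSEQ_le_const) auto
    also have "\<dots> \<le> \<tau> + (1 / \<tau>) * \<tau>\<^sup>2 + (1 / \<tau>) * \<tau>\<^sup>2 + \<tau> * (l2norm \<psi>)\<^sup>2"
      using f\<mu> f\<nu> \<tau> by (intro add_mono mult_left_mono) auto
    also have "\<dots> = \<tau> * (3 + (l2norm \<psi>)\<^sup>2)" using \<tau> by (simp add: power2_eq_square algebra_simps)
    finally show ?thesis .
  qed
  define M where "M = 3 + (l2norm \<psi>)\<^sup>2"
  have M: "M > 0" by (simp add: M_def add_pos_nonneg)
  have "cmod (\<psi> x0) \<le> 0"
  proof (rule field_le_epsilon)
    fix e :: real assume "e > 0"
    then show "cmod (\<psi> x0) \<le> 0 + e" using bound[of "e / M"] M by (simp add: M_def)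
  qed
  then show ?thesis by simp
qed

lemma spectral_measure_finite_borel: "spectral_measure H D \<psi> \<nu> \<Longrightarrow> finite_borel \<nu>"
  by (simp add: spectral_measure_def finite_borel_def finite_borel_axioms_def)

text \<open>The separating set is \<open>singular_part \<mu>\<close>: of full mass for
  \<open>\<mu>\<close>, Lebesgue null, and so null for \<open>\<nu>\<close>.\<close>

lemma ac_vanishes:
  assumes "\<psi> \<in> ac_subspace (Hop Q n p \<omega>) (Hdom \<omega>)" shows "\<psi> x0 = 0"
proof -
  obtain \<nu> where \<psi>: "l2 \<psi>" and \<nu>: "spectral_measure (Hop Q n p \<omega>) (Hdom \<omega>) \<psi> \<nu>" "absolutely_continuous lborel \<nu>"
    using assms by (auto simp: ac_subspace_def)
  obtain \<mu> where \<mu>: "finite_borel \<mu>" "measure \<mu> UNIV = 1" "\<And>z. Im z > 0 \<Longrightarrow> stieltjes \<mu> z = m \<omega> z"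
    using ex_delta_measure by blast
  interpret \<mu>: finite_borel \<mu> by fact
  have "singular_part \<mu> \<in> null_sets lborel" using m_singular_null[OF \<mu>(1,3)] by (simp add: null_sets_def)
  then have "emeasure \<nu> (singular_part \<mu>) = 0" using \<nu>(2) unfolding absolutely_continuous_def by blast
  then show ?thesis
    by (intro orthogonal_of_mutually_singular[OF \<mu> \<psi> spectral_measure_finite_borel[OF \<nu>(1)] spectral_measure_limit[OF \<nu>(1) \<psi>]
        \<mu>.singular_part_sets \<mu>.concentrated_on_singular_part])
qed

section \<open>Dependence on the potential and on the energy\<close>

text \<open>Changing the potential at \<open>x0\<close> alone leaves a multiple of
  \<open>delta\<close> on the right of the resolvent equation; uniqueness and linearity give the
  formula.\<close>

lemma G_rank_one:
  assumes z: "Im z > 0" and \<omega>: "\<And>x. x \<noteq> x0 \<Longrightarrow> \<omega>' x = \<omega> x"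
  shows "F.G r \<omega>' z delta x0 * (1 + of_real (\<omega>' x0 - \<omega> x0) * F.G r \<omega> z delta x0) = F.G r \<omega> z delta x0"
proof -
  define k where "k = 1 + of_real (\<omega>' x0 - \<omega> x0) * F.G r \<omega> z delta x0"
  have "F.G r \<omega> z delta x0 = F.G r \<omega>' z (\<lambda>x. k * delta x) x0"
  proof (rule F.G_unique[where g = "F.G r \<omega> z delta", OF _ _ x0_A])
    fix x assume x: "x \<in> A r"
    have "(\<Sum>y\<in>A r. of_real (K \<omega>' r x y) * F.G r \<omega> z delta y) - z * F.G r \<omega> z delta x
       = ((\<Sum>y\<in>A r. of_real (K \<omega> r x y) * F.G r \<omega> z delta y) - z * F.G r \<omega> z delta x) + of_real (\<omega>' x - \<omega> x) * F.G r \<omega> z delta x"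
      using x by (simp add: K_apply algebra_simps)
    also have "\<dots> = delta x + of_real (\<omega>' x - \<omega> x) * F.G r \<omega> z delta x"
      using F.G_solves[of z x r \<omega> delta] z x by simp
    also have "\<dots> = k * delta x" using \<omega>[of x] by (cases "x = x0") (auto simp: k_def delta_def)
    finally show "(\<Sum>y\<in>A r. of_real (K \<omega>' r x y) * F.G r \<omega> z delta y) - z * F.G r \<omega> z delta x = k * delta x" .
  qed (use z in simp)
  also have "\<dots> = k * F.G r \<omega>' z delta x0"
  proof -
    have "F.coef r \<omega>' (\<lambda>x. k * delta x) j = k * F.coef r \<omega>' delta j" for j
      by (simp add: F.coef_def sum_distrib_left mult_ac)
    then show ?thesis by (simp add: F.G_def sum_distrib_left mult_ac)
  qed
  finally show ?thesis by (simp add: k_def mult.commute)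
qed

lemma m_rank_one:
  assumes z: "Im z > 0" and \<omega>: "\<And>x. x \<noteq> x0 \<Longrightarrow> \<omega>' x = \<omega> x"
  shows "m \<omega>' z * (1 + of_real (\<omega>' x0 - \<omega> x0) * m \<omega> z) = m \<omega> z"
proof (rule LIMSEQ_unique)
  show "(\<lambda>r. F.G r \<omega> z delta x0) \<longlonglongrightarrow> m \<omega> z" by (rule m_tendsto[OF z])
  have "(\<lambda>r. F.G r \<omega>' z delta x0 * (1 + of_real (\<omega>' x0 - \<omega> x0) * F.G r \<omega> z delta x0)) \<longlonglongrightarrow> m \<omega>' z * (1 + of_real (\<omega>' x0 - \<omega> x0) * m \<omega> z)"
    by (intro tendsto_intros m_tendsto z)
  then show "(\<lambda>r. F.G r \<omega> z delta x0) \<longlonglongrightarrow> m \<omega>' z * (1 + of_real (\<omega>' x0 - \<omega> x0) * m \<omega> z)"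
    by (simp only: G_rank_one[OF z, where \<omega>' = \<omega>' and \<omega> = \<omega>] \<omega> not_False_eq_True simp_thms)
qed

text \<open>A vanishing integral of the positive kernel would make \<open>\<mu>\<close> zero, but
  its mass is 1. Strict positivity is what \<open>nn_integral_rank_one_average\<close>
  requires.\<close>

lemma Im_m_pos: assumes "Im z > 0" shows "Im (m \<omega> z) > 0"
proof -
  obtain \<mu> where \<mu>: "finite_borel \<mu>" "measure \<mu> UNIV = 1" "\<And>z. Im z > 0 \<Longrightarrow> stieltjes \<mu> z = m \<omega> z"
    using ex_delta_measure by blast
  interpret \<mu>: finite_borel \<mu> by fact
  have "res2 \<mu> z \<noteq> 0"
  proof
    assume "res2 \<mu> z = 0"
    then have "AE t in \<mu>. 1 / (cmod (of_real t - z))\<^sup>2 = 0"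
      unfolding res2_def using integral_nonneg_eq_0_iff_AE[OF \<mu>.integrable_kernel2[OF assms]] by simp
    moreover have "1 / (cmod (of_real t - z))\<^sup>2 \<noteq> 0" for t
      using Im_le_cmod_diff[OF assms, of t] assms by auto
    ultimately have "AE t in \<mu>. False" by simp
    then have "emeasure \<mu> UNIV = 0" using \<mu>.space_eq by (simp add: eventually_False ae_filter_eq_bot_iff)
    then show False using \<mu>(2) by (simp add: measure_def)
  qed
  then have "res2 \<mu> z > 0" using \<mu>.res2_nonneg[of z] by linarith
  then show ?thesis using \<mu>.Im_stieltjes[OF assms] \<mu>(3)[OF assms] assms by simp
qed

text \<open>Second resolvent identity for a change of potential and energy at once. At fixed r only
  finitely many sites enter, so this is continuity in the product topology; for equal potentials the
  bound is independent of r and passes to \<open>m\<close>.\<close>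

lemma G_perturb:
  assumes z: "Im z > 0" and z': "Im z' > 0"
  shows "cmod (F.G r \<omega> z delta x0 - F.G r \<omega>' z' delta x0) \<le> ((\<Sum>x\<in>A r. \<bar>\<omega>' x - \<omega> x\<bar>) + cmod (z - z')) / (Im z * Im z')"
proof -
  define k where "k = (\<lambda>x. (of_real (\<omega>' x - \<omega> x) + (z - z')) * F.G r \<omega>' z' delta x)"
  define c where "c = (\<Sum>x\<in>A r. \<bar>\<omega>' x - \<omega> x\<bar>) + cmod (z - z')"
  have c0: "c \<ge> 0" by (simp add: c_def sum_nonneg)
  have "F.G r \<omega> z delta x - F.G r \<omega>' z' delta x = F.G r \<omega> z k x" if x: "x \<in> A r" for x
  proof (rule F.G_unique[OF _ _ x])
    fix x assume x: "x \<in> A r"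
    have "(\<Sum>y\<in>A r. of_real (K \<omega> r x y) * (F.G r \<omega> z delta y - F.G r \<omega>' z' delta y)) - z * (F.G r \<omega> z delta x - F.G r \<omega>' z' delta x)
       = ((\<Sum>y\<in>A r. of_real (K \<omega> r x y) * F.G r \<omega> z delta y) - z * F.G r \<omega> z delta x)
       - ((\<Sum>y\<in>A r. of_real (K \<omega>' r x y) * F.G r \<omega>' z' delta y) - z' * F.G r \<omega>' z' delta x)
       + ((\<Sum>y\<in>A r. of_real (K \<omega>' r x y) * F.G r \<omega>' z' delta y) - (\<Sum>y\<in>A r. of_real (K \<omega> r x y) * F.G r \<omega>' z' delta y))
       + (z - z') * F.G r \<omega>' z' delta x"
      by (simp add: algebra_simps sum_subtractf)
    also have "\<dots> = k x"
      using F.G_solves[of z x r \<omega> delta] F.G_solves[of z' x r \<omega>' delta] z z' x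
      by (simp add: k_def) (simp add: K_apply algebra_simps)
    finally show "(\<Sum>y\<in>A r. of_real (K \<omega> r x y) * (F.G r \<omega> z delta y - F.G r \<omega>' z' delta y)) - z * (F.G r \<omega> z delta x - F.G r \<omega>' z' delta x) = k x" .
  qed (use z in simp)
  then have "cmod (F.G r \<omega> z delta x0 - F.G r \<omega>' z' delta x0) = cmod (F.G r \<omega> z k x0)" using x0_A by simp
  also have "\<dots> \<le> L2_set (\<lambda>x. cmod (F.G r \<omega> z k x)) (A r)" by (rule member_le_L2_set[OF finite_Q x0_A])
  also have "\<dots> \<le> L2_set (\<lambda>x. cmod (k x)) (A r) / Im z" by (rule F.norm_G_le[OF z])
  also have "\<dots> \<le> (c * (1 / Im z')) / Im z"
  proof (intro divide_right_mono)
    have "L2_set (\<lambda>x. cmod (k x)) (A r) \<le> L2_set (\<lambda>x. c * cmod (F.G r \<omega>' z' delta x)) (A r)"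
    proof (rule L2_set_mono)
      fix x assume "x \<in> A r"
      then have "\<bar>\<omega>' x - \<omega> x\<bar> \<le> (\<Sum>x\<in>A r. \<bar>\<omega>' x - \<omega> x\<bar>)" by (intro member_le_sum) (auto simp: finite_Q)
      then have "cmod (of_real (\<omega>' x - \<omega> x) + (z - z')) \<le> c"
        unfolding c_def by (intro order_trans[OF norm_triangle_ineq] add_mono) (auto simp del: of_real_diff)
      then show "cmod (k x) \<le> c * cmod (F.G r \<omega>' z' delta x)"
        unfolding k_def norm_mult by (rule mult_right_mono) simp
    qed simp
    also have "\<dots> = c * L2_set (\<lambda>x. cmod (F.G r \<omega>' z' delta x)) (A r)" using c0 by (simp add: L2_set_right_distrib)
    also have "\<dots> \<le> c * (1 / Im z')"
      using z' by (intro mult_left_mono c0 order_trans[OF F.norm_G_le[OF z']] divide_right_mono L2_delta_le finite_Q) auto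
    finally show "L2_set (\<lambda>x. cmod (k x)) (A r) \<le> c * (1 / Im z')" .
  qed (use z in simp)
  finally show ?thesis by (simp add: c_def mult.commute)
qed

lemma m_lipschitz:
  assumes z: "Im z > 0" and z': "Im z' > 0"
  shows "cmod (m \<omega> z - m \<omega> z') \<le> cmod (z - z') / (Im z * Im z')"
proof (rule LIMSEQ_le_const2)
  show "(\<lambda>r. cmod (F.G r \<omega> z delta x0 - F.G r \<omega> z' delta x0)) \<longlonglongrightarrow> cmod (m \<omega> z - m \<omega> z')"
    by (intro tendsto_intros m_tendsto z z')
  show "\<exists>N. \<forall>r\<ge>N. cmod (F.G r \<omega> z delta x0 - F.G r \<omega> z' delta x0) \<le> cmod (z - z') / (Im z * Im z')"
    using G_perturb[OF z z', of _ \<omega> \<omega>] by simp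
qed

lemma m_continuous_line: assumes "b > 0" shows "continuous_on UNIV (\<lambda>E. m \<omega> (Complex E b))"
proof (rule lipschitz_on_continuous_on)
  show "(1 / (b * b))-lipschitz_on UNIV (\<lambda>E. m \<omega> (Complex E b))"
  proof (rule lipschitz_onI)
    fix E E' :: real
    have "cmod (Complex E b - Complex E' b) = \<bar>E - E'\<bar>" by (simp add: cmod_def)
    then show "dist (m \<omega> (Complex E b)) (m \<omega> (Complex E' b)) \<le> 1 / (b * b) * dist E E'"
      using m_lipschitz[of "Complex E b" "Complex E' b" \<omega>] assms by (simp add: dist_norm)
  qed simp
qed

text \<open>\<open>m\<close> is a pointwise limit of functions jointly continuous in potential and
  energy. Countability of the sites identifies the product of the Borel algebras with the Borel
  algebra of the product.\<close>

lemma m_measurable: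
  assumes b: "b > 0"
  shows "(\<lambda>(\<omega>, E). m \<omega> (Complex E b)) \<in> borel_measurable (borel \<Otimes>\<^sub>M borel)"
proof (rule borel_measurable_LIMSEQ_metric)
  fix r
  have "continuous_on UNIV (\<lambda>q. F.G r (fst q) (Complex (snd q) b) delta x0)"
    unfolding continuous_on_def
  proof
    fix q :: "('a \<Rightarrow> real) \<times> real"
    let ?f = "\<lambda>q. F.G r (fst q) (Complex (snd q) b) delta x0"
    let ?h = "\<lambda>q'. ((\<Sum>x\<in>A r. \<bar>fst q x - fst q' x\<bar>) + cmod (Complex (snd q') b - Complex (snd q) b)) / (b * b)"
    have "continuous_on UNIV ?h"
      by (intro continuous_intros continuous_on_product_then_coordinatewise) (use b in auto)
    then have "isCont ?h q" by (simp add: continuous_on_eq_continuous_at del: split_paired_All)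
    then have "(?h \<longlongrightarrow> ?h q) (at q)" by (simp only: isCont_def)
    then have "(?h \<longlongrightarrow> 0) (at q)" by simp
    then have "((\<lambda>q'. ?f q' - ?f q) \<longlongrightarrow> 0) (at q)"
      by (rule Lim_null_comparison[rotated]) (use G_perturb[of "Complex _ b" "Complex _ b" r] b in simp)
    then show "(?f \<longlongrightarrow> ?f q) (at q within UNIV)" by (simp add: LIM_zero_iff)
  qed
  then have "(\<lambda>q. F.G r (fst q) (Complex (snd q) b) delta x0) \<in> borel_measurable borel"
    by (rule borel_measurable_continuous_onI)
  then show "(\<lambda>(\<omega>, E). F.G r \<omega> (Complex E b) delta x0) \<in> borel_measurable (borel \<Otimes>\<^sub>M borel)"
    by (simp add: borel_prod case_prod_beta')
next
  fix q :: "('a \<Rightarrow> real) \<times> real"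
  show "(\<lambda>r. (case q of (\<omega>, E) \<Rightarrow> F.G r \<omega> (Complex E b) delta x0)) \<longlonglongrightarrow> (case q of (\<omega>, E) \<Rightarrow> m \<omega> (Complex E b))"
    using b by (cases q) (simp add: m_tendsto)
qed

section \<open>Averaging over one site\<close>

text \<open>The condition \<open>good \<omega>\<close> forces the spectral measure of \<open>delta\<close> at \<open>\<omega>\<close> to give no mass to the
  singular part belonging to \<open>fun_upd \<omega> x0 0\<close>. It is phrased through \<open>m\<close> because in this form it is
  visibly measurable in \<open>\<omega>\<close>.\<close>
definition level_set :: "nat \<Rightarrow> ('a \<Rightarrow> real) \<Rightarrow> real set" where
  "level_set k \<omega> = {E. \<exists>i. real k < Im (m (fun_upd \<omega> x0 0) (Complex E (1 / Suc i))) * Suc i}"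

text \<open>By \<open>open_le_liminf_stieltjes\<close> this bounds the mass that the spectral
  measure of \<open>delta\<close> at \<open>\<omega>\<close> gives to the level set, without
  mentioning that measure.\<close>

definition poisson_mass :: "nat \<Rightarrow> ('a \<Rightarrow> real) \<Rightarrow> ennreal" where
  "poisson_mass k \<omega> = liminf (\<lambda>i. \<integral>\<^sup>+E. indicator (level_set k \<omega>) E * ennreal (Im (m \<omega> (Complex E (1 / Suc i))) / pi) \<partial>lborel)"

definition good :: "('a \<Rightarrow> real) \<Rightarrow> bool" where
  "good \<omega> \<longleftrightarrow> (INF k. poisson_mass k \<omega>) = 0"

lemma open_level_set: "open (level_set k \<omega>)"
proof -
  have "level_set k \<omega> = (\<Union>i. {E. real k < Im (m (fun_upd \<omega> x0 0) (Complex E (1 / Suc i))) * Suc i})"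
    by (auto simp: level_set_def)
  then show ?thesis
    by (auto intro!: open_UN open_Collect_less continuous_intros m_continuous_line)
qed

text \<open>The level set only sees the potential with value 0 at \<open>x0\<close>, so it stays
  fixed while that value is averaged.\<close>

lemma level_set_upd: "level_set k (fun_upd \<omega> x0 \<xi>) = level_set k \<omega>"
  by (simp add: level_set_def)

text \<open>By \<open>m_bound\<close> the quotients Im m / \<epsilon> stay below some k outside a
  set of measure e, which then contains the level set of that k.\<close>

lemma level_set_small: "(INF k. emeasure lborel (level_set k \<omega>)) = 0"
proof -
  have "(INF k. emeasure lborel (level_set k \<omega>)) \<le> 0"
  proof (rule ennreal_le_epsilon)
    fix e :: real assume e: "e > 0"
    obtain S C where S: "S \<in> sets borel" "emeasure lborel S \<le> ennreal e"
      and C: "\<And>E \<epsilon>. E \<notin> S \<Longrightarrow> \<epsilon> > 0 \<Longrightarrow> Im (m (fun_upd \<omega> x0 0) (Complex E \<epsilon>)) \<le> C * \<epsilon>"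
      using m_bound[OF e] by blast
    obtain k where k: "C \<le> real k" using real_arch_simple by blast
    have "level_set k \<omega> \<subseteq> S"
    proof (rule ccontr)
      assume "\<not> level_set k \<omega> \<subseteq> S"
      then obtain E i where E: "E \<notin> S" "real k < Im (m (fun_upd \<omega> x0 0) (Complex E (1 / Suc i))) * Suc i"
        by (auto simp: level_set_def)
      have "Im (m (fun_upd \<omega> x0 0) (Complex E (1 / Suc i))) * Suc i \<le> C * (1 / Suc i) * Suc i"
        by (intro mult_right_mono C E(1)) auto
      then show False using E(2) k by simp
    qed
    then have "emeasure lborel (level_set k \<omega>) \<le> ennreal e"
      using S by (intro order_trans[OF emeasure_mono S(2)]) auto
    then show "(INF k. emeasure lborel (level_set k \<omega>)) \<le> 0 + ennreal e"
      by (simp add: INF_lower2)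
  qed
  then show ?thesis by simp
qed

lemma measurable_upd_param: "(\<lambda>\<omega>. fun_upd \<omega> x0 c) \<in> borel \<rightarrow>\<^sub>M (borel :: ('a \<Rightarrow> real) measure)"
proof (intro borel_measurable_continuous_onI continuous_on_coordinatewise_then_product)
  show "continuous_on UNIV (\<lambda>\<omega>. (fun_upd \<omega> x0 c) i)" for i
    by (cases "i = x0") (auto intro!: continuous_on_product_coordinates)
qed

lemma measurable_upd: "(\<lambda>\<xi>. fun_upd \<omega> x0 \<xi>) \<in> borel \<rightarrow>\<^sub>M (borel :: ('a \<Rightarrow> real) measure)"
proof (intro borel_measurable_continuous_onI continuous_on_coordinatewise_then_product)
  show "continuous_on UNIV (\<lambda>\<xi>. (fun_upd \<omega> x0 \<xi>) i)" for i
    by (cases "i = x0") auto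
qed

lemma m_measurable_comp:
  assumes b: "b > 0" and f: "f \<in> N \<rightarrow>\<^sub>M (borel :: ('a \<Rightarrow> real) measure)"
  shows "(\<lambda>(x, E). m (f x) (Complex E b)) \<in> borel_measurable (N \<Otimes>\<^sub>M lborel)"
proof -
  have "(\<lambda>q. (f (fst q), snd q)) \<in> N \<Otimes>\<^sub>M lborel \<rightarrow>\<^sub>M (borel :: ('a \<Rightarrow> real) measure) \<Otimes>\<^sub>M (borel :: real measure)"
    using f by measurable
  from measurable_compose[OF this m_measurable[OF b]] show ?thesis by (simp add: case_prod_beta')
qed

lemma level_set_measurable:
  "{q. snd q \<in> level_set k (fst q)} \<in> sets ((borel :: ('a \<Rightarrow> real) measure) \<Otimes>\<^sub>M lborel)"
proof -
  have 1: "{q. snd q \<in> level_set k (fst q)}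
     = (\<Union>i. {q \<in> space ((borel :: ('a \<Rightarrow> real) measure) \<Otimes>\<^sub>M lborel). real k < Im ((\<lambda>(\<omega>, E). m (fun_upd \<omega> x0 0) (Complex E (1 / Suc i))) q) * Suc i})"
    by (auto simp: level_set_def space_pair_measure)
  have [measurable]: "(\<lambda>(\<omega>, E). m (fun_upd \<omega> x0 0) (Complex E (1 / Suc i))) \<in> borel_measurable ((borel :: ('a \<Rightarrow> real) measure) \<Otimes>\<^sub>M lborel)" for i
    by (rule m_measurable_comp[OF _ measurable_upd_param]) simp
  show ?thesis unfolding 1 by measurable
qed

lemma poisson_mass_measurable: "poisson_mass k \<in> borel_measurable borel"
proof -
  have [measurable]: "(\<lambda>(\<omega>, E). m \<omega> (Complex E (1 / Suc i))) \<in> borel_measurable ((borel :: ('a \<Rightarrow> real) measure) \<Otimes>\<^sub>M lborel)" for i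
    using m_measurable_comp[OF _ measurable_ident] by simp
  have [measurable]: "{q. snd q \<in> level_set k (fst q)} \<in> sets ((borel :: ('a \<Rightarrow> real) measure) \<Otimes>\<^sub>M lborel)"
    by (rule level_set_measurable)
  have "(\<lambda>\<omega>. \<integral>\<^sup>+E. indicator {q. snd q \<in> level_set k (fst q)} (\<omega>, E) * ennreal (Im ((\<lambda>(\<omega>, E). m \<omega> (Complex E (1 / Suc i))) (\<omega>, E)) / pi) \<partial>lborel) \<in> borel_measurable borel" for i
    by measurable
  then show ?thesis unfolding poisson_mass_def by (intro borel_measurable_liminf) (simp add: indicator_def)
qed

lemma good_sets: "{\<omega>. \<not> good \<omega>} \<in> sets borel"
proof -
  have "(\<lambda>\<omega>. INF k. poisson_mass k \<omega>) \<in> borel_measurable borel" by (intro borel_measurable_INF poisson_mass_measurable) auto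
  then have "{\<omega> \<in> space borel. (INF k. poisson_mass k \<omega>) \<noteq> 0} \<in> sets borel" by measurable
  then show ?thesis by (simp add: good_def)
qed

text \<open>At each energy Im m / pi averages to 1 over the potential at \<open>x0\<close>, so by
  Fubini every height contributes the Lebesgue measure of the level set; Fatou handles the limit
  inferior.\<close>

lemma poisson_mass_average: "(\<integral>\<^sup>+\<xi>. poisson_mass k (fun_upd \<omega> x0 \<xi>) \<partial>lborel) \<le> emeasure lborel (level_set k \<omega>)"
proof -
  let ?F = "\<lambda>i \<xi> E. indicator (level_set k \<omega>) E * ennreal (Im (m (fun_upd \<omega> x0 \<xi>) (Complex E (1 / Suc i))) / pi)"
  have [measurable]: "level_set k \<omega> \<in> sets borel" using open_level_set by simp
  have [measurable]: "(\<lambda>(\<xi>, E). m (fun_upd \<omega> x0 \<xi>) (Complex E (1 / Suc i))) \<in> borel_measurable (lborel \<Otimes>\<^sub>M lborel)" for i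
    by (rule m_measurable_comp) (use measurable_upd in simp_all)
  have Fm: "(\<lambda>(\<xi>, E). ?F i \<xi> E) \<in> borel_measurable (lborel \<Otimes>\<^sub>M lborel)" for i
    by measurable
  have int: "(\<integral>\<^sup>+\<xi>. \<integral>\<^sup>+E. ?F i \<xi> E \<partial>lborel \<partial>lborel) = emeasure lborel (level_set k \<omega>)" for i
  proof -
    have "(\<integral>\<^sup>+\<xi>. \<integral>\<^sup>+E. ?F i \<xi> E \<partial>lborel \<partial>lborel) = (\<integral>\<^sup>+E. \<integral>\<^sup>+\<xi>. ?F i \<xi> E \<partial>lborel \<partial>lborel)"
      by (rule lborel_pair.Fubini'[symmetric, OF Fm])
    also have "\<dots> = (\<integral>\<^sup>+E. indicator (level_set k \<omega>) E * (\<integral>\<^sup>+\<xi>. ennreal (Im (m (fun_upd \<omega> x0 \<xi>) (Complex E (1 / Suc i))) / pi) \<partial>lborel) \<partial>lborel)"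
      by (intro nn_integral_cong nn_integral_cmult) measurable
    also have "\<dots> = (\<integral>\<^sup>+E. indicator (level_set k \<omega>) E \<partial>lborel)"
    proof (intro nn_integral_cong)
      fix E
      let ?z = "Complex E (1 / Suc i)"
      have "(\<integral>\<^sup>+\<xi>. ennreal (Im (m (fun_upd \<omega> x0 \<xi>) ?z) / pi) \<partial>lborel) = 1"
      proof (rule nn_integral_rank_one_average[where g = "m (fun_upd \<omega> x0 0) ?z"])
        show "Im (m (fun_upd \<omega> x0 0) ?z) > 0" by (rule Im_m_pos) simp
        show "m (fun_upd \<omega> x0 \<xi>) ?z * (1 + of_real \<xi> * m (fun_upd \<omega> x0 0) ?z) = m (fun_upd \<omega> x0 0) ?z" for \<xi>
          using m_rank_one[of ?z "fun_upd \<omega> x0 \<xi>" "fun_upd \<omega> x0 0"] by simp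
      qed
      then show "indicator (level_set k \<omega>) E * (\<integral>\<^sup>+\<xi>. ennreal (Im (m (fun_upd \<omega> x0 \<xi>) ?z) / pi) \<partial>lborel) = indicator (level_set k \<omega>) E"
        by simp
    qed
    finally show ?thesis by simp
  qed
  have "(\<integral>\<^sup>+\<xi>. poisson_mass k (fun_upd \<omega> x0 \<xi>) \<partial>lborel) = (\<integral>\<^sup>+\<xi>. liminf (\<lambda>i. \<integral>\<^sup>+E. ?F i \<xi> E \<partial>lborel) \<partial>lborel)"
    by (simp add: poisson_mass_def level_set_upd)
  also have "\<dots> \<le> liminf (\<lambda>i. \<integral>\<^sup>+\<xi>. \<integral>\<^sup>+E. ?F i \<xi> E \<partial>lborel \<partial>lborel)"
    by (rule nn_integral_liminf) measurable
  also have "\<dots> = emeasure lborel (level_set k \<omega>)" by (simp only: int Liminf_const sequentially_bot not_False_eq_True)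
  finally show ?thesis .
qed

lemma bad_null: "emeasure lborel {\<xi>. \<not> good (fun_upd \<omega> x0 \<xi>)} = 0"
proof -
  let ?g = "\<lambda>\<xi>. INF k. poisson_mass k (fun_upd \<omega> x0 \<xi>)"
  have "(\<lambda>\<xi>. poisson_mass k (fun_upd \<omega> x0 \<xi>)) \<in> borel_measurable lborel" for k
    using measurable_compose[OF measurable_upd poisson_mass_measurable] by simp
  then have gm: "?g \<in> borel_measurable lborel" by (intro borel_measurable_INF) auto
  have "(\<integral>\<^sup>+\<xi>. ?g \<xi> \<partial>lborel) \<le> (INF k. emeasure lborel (level_set k \<omega>))"
  proof (rule INF_greatest)
    fix k
    have "(\<integral>\<^sup>+\<xi>. ?g \<xi> \<partial>lborel) \<le> (\<integral>\<^sup>+\<xi>. poisson_mass k (fun_upd \<omega> x0 \<xi>) \<partial>lborel)"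
      by (intro nn_integral_mono INF_lower) auto
    then show "(\<integral>\<^sup>+\<xi>. ?g \<xi> \<partial>lborel) \<le> emeasure lborel (level_set k \<omega>)" using poisson_mass_average by (rule order_trans)
  qed
  then have "(\<integral>\<^sup>+\<xi>. ?g \<xi> \<partial>lborel) = 0" by (simp add: level_set_small)
  then show ?thesis using nn_integral_0_iff[OF gm] by (simp add: good_def)
qed

text \<open>The separating set is the set of atoms of \<open>\<mu>\<close>: countable, hence null
  for a measure without atoms, and of full mass for \<open>\<mu>\<close> once \<open>good\<close>
  holds.\<close>

lemma cont_vanishes:
  assumes good: "good \<omega>" and \<psi>c: "\<psi> \<in> cont_subspace (Hop Q n p \<omega>) (Hdom \<omega>)" shows "\<psi> x0 = 0"
proof -
  obtain \<nu> where \<psi>: "l2 \<psi>" and \<nu>: "spectral_measure (Hop Q n p \<omega>) (Hdom \<omega>) \<psi> \<nu>" "\<And>t. emeasure \<nu> {t} = 0"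
    using \<psi>c by (auto simp: cont_subspace_def)
  obtain \<mu> where \<mu>: "finite_borel \<mu>" "measure \<mu> UNIV = 1" "\<And>z. Im z > 0 \<Longrightarrow> stieltjes \<mu> z = m \<omega> z"
    using ex_delta_measure by blast
  obtain \<mu>0 where \<mu>0: "finite_borel \<mu>0" "\<And>z. Im z > 0 \<Longrightarrow> stieltjes \<mu>0 z = m (fun_upd \<omega> x0 0) z"
    using ex_delta_measure by blast
  interpret \<mu>: finite_borel \<mu> by fact
  interpret \<mu>0: finite_borel \<mu>0 by fact
  interpret \<nu>: finite_borel \<nu> by (rule spectral_measure_finite_borel[OF \<nu>(1)])
  \<comment> \<open>Every level set is an open set around \<open>singular_part \<mu>0\<close>, so
    its \<open>poisson_mass\<close> is an upper bound.\<close>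
  have "emeasure \<mu> (singular_part \<mu>0) \<le> (INF k. poisson_mass k \<omega>)"
  proof (rule INF_greatest)
    fix k
    have "singular_part \<mu>0 \<subseteq> level_set k \<omega>"
    proof
      fix E assume "E \<in> singular_part \<mu>0"
      then obtain i where i: "real k < res2 \<mu>0 (Complex E (1 / Suc i))" by (auto simp: singular_part_def not_le)
      have "Im (m (fun_upd \<omega> x0 0) (Complex E (1 / Suc i))) = 1 / Suc i * res2 \<mu>0 (Complex E (1 / Suc i))"
        using \<mu>0.Im_stieltjes[of "Complex E (1 / Suc i)"] \<mu>0(2)[of "Complex E (1 / Suc i)"] by simp
      then show "E \<in> level_set k \<omega>" using i by (auto simp: level_set_def simp del: of_nat_Suc intro!: exI[of _ i])
    qed
    then have "emeasure \<mu> (singular_part \<mu>0) \<le> emeasure \<mu> (level_set k \<omega>)"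
      using open_level_set by (intro emeasure_mono) auto
    also have "\<dots> \<le> poisson_mass k \<omega>"
      using \<mu>.open_le_liminf_stieltjes[OF open_level_set, of k \<omega>] by (simp add: poisson_mass_def \<mu>(3))
    finally show "emeasure \<mu> (singular_part \<mu>0) \<le> poisson_mass k \<omega>" .
  qed
  then have sing: "emeasure \<mu> (singular_part \<mu>0) = 0" using good by (simp add: good_def)
  define T where "T = {t. measure \<mu> {t} \<noteq> 0}"
  have cT: "countable T" unfolding T_def by (rule \<mu>.countable_support)
  have T: "T \<in> sets borel" by (rule sets.countable[OF _ cT]) simp
  have "(\<Union>t\<in>T. {t}) \<in> null_sets \<nu>"
    using \<nu>(2) by (intro null_sets_UN' cT) (simp add: null_sets_def)
  then have "emeasure \<nu> T = 0" by auto
  moreover have "emeasure \<mu> (- T) = 0"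
  proof -
    \<comment> \<open>By \<open>simon_wolff\<close> a point that is neither an atom nor in
      \<open>singular_part \<mu>0\<close> lies off \<open>singular_part \<mu>\<close>, where
      \<open>\<mu>\<close> has no mass.\<close>
    have "- T \<subseteq> singular_part \<mu>0 \<union> - singular_part \<mu>"
    proof
      fix E assume "E \<in> - T"
      then have "emeasure \<mu> {E} = 0" by (simp add: T_def \<mu>.emeasure_eq_measure)
      then show "E \<in> singular_part \<mu>0 \<union> - singular_part \<mu>"
        using \<mu>.simon_wolff[OF \<mu>0(1), of "\<omega> x0" E] m_rank_one[of _ \<omega> "fun_upd \<omega> x0 0"] by (auto simp: \<mu>(3) \<mu>0(2))
    qed
    then have "emeasure \<mu> (- T) \<le> emeasure \<mu> (singular_part \<mu>0 \<union> - singular_part \<mu>)"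
      by (intro emeasure_mono) auto
    also have "\<dots> \<le> emeasure \<mu> (singular_part \<mu>0) + emeasure \<mu> (- singular_part \<mu>)"
      by (intro emeasure_subadditive) auto
    also have "\<dots> = 0" using sing \<mu>.concentrated_on_singular_part by simp
    finally show ?thesis by simp
  qed
  ultimately show ?thesis
    by (intro orthogonal_of_mutually_singular[OF \<mu> \<psi> \<nu>.finite_borel_axioms spectral_measure_limit[OF \<nu>(1) \<psi>] T])
qed

text \<open>Disintegration at \<open>x0\<close>: on every fibre the bad values are Lebesgue null by
  \<open>bad_null\<close>, hence null for an absolutely continuous conditional law.\<close>

lemma AE_good:
  assumes M: "sets M = sets (borel :: ('a \<Rightarrow> real) measure)" and c: "cond_abs_cont M"
  shows "AE \<omega> in M. good \<omega>"
proof -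
  obtain \<kappa> :: "('a \<Rightarrow> real) \<Rightarrow> real measure" where \<kappa>: "\<And>A. A \<in> sets M \<Longrightarrow>
      emeasure M A = (\<integral>\<^sup>+ \<omega>. emeasure (\<kappa> \<omega>) {\<xi>. fun_upd \<omega> x0 \<xi> \<in> A} \<partial>M)"
    and ac: "AE \<omega> in M. absolutely_continuous lborel (\<kappa> \<omega>)"
    using c unfolding cond_abs_cont_def by blast
  have bad: "{\<omega>. \<not> good \<omega>} \<in> sets M" using good_sets by (simp add: M)
  have "{\<xi>. \<not> good (fun_upd \<omega> x0 \<xi>)} \<in> null_sets lborel" for \<omega>
  proof -
    have "{\<xi>. \<not> good (fun_upd \<omega> x0 \<xi>)} \<in> sets borel"
      using measurable_sets[OF measurable_upd good_sets, of \<omega>] by (simp add: vimage_def)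
    then show ?thesis using bad_null by (simp add: null_sets_def)
  qed
  then have "emeasure (\<kappa> \<omega>) {\<xi>. \<not> good (fun_upd \<omega> x0 \<xi>)} = 0" if "absolutely_continuous lborel (\<kappa> \<omega>)" for \<omega>
    using that unfolding absolutely_continuous_def by blast
  then have "AE \<omega> in M. emeasure (\<kappa> \<omega>) {\<xi>. fun_upd \<omega> x0 \<xi> \<in> {\<omega>. \<not> good \<omega>}} = 0"
    by (intro eventually_mono[OF ac]) simp
  then have "emeasure M {\<omega>. \<not> good \<omega>} = (\<integral>\<^sup>+ \<omega>. 0 \<partial>M)"
    unfolding \<kappa>[OF bad] by (rule nn_integral_cong_AE)
  then show ?thesis using bad by (intro AE_I[of _ _ "{\<omega>. \<not> good \<omega>}"]) auto
qed

end

text \<open>Puts the zero vector into both subspaces: the null measure is absolutely continuous and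
  has no atoms.\<close>

lemma spectral_measure_zero: "spectral_measure H D (\<lambda>_. 0) (null_measure borel)"
  by (auto simp: spectral_measure_def l2inner_def finite_measure.intro intro!: finite_measureI)

theorem theorem4:
  fixes Q :: "nat \<Rightarrow> 'a::countable \<Rightarrow> 'a set"
    and n :: "nat \<Rightarrow> nat"
    and p :: "nat \<Rightarrow> real"
    and u :: "nat \<Rightarrow> real"
    and M :: "('a \<Rightarrow> real) measure"
  assumes hier: "hier_structure Q n"
    and p_pos: "\<forall>r\<ge>1. p r > 0" and p0: "p 0 = 0" and p_sum: "p sums 1"
    and M_prob: "prob_space M" and M_sets: "sets M = sets (borel :: ('a \<Rightarrow> real) measure)"
    and u_pos: "\<forall>r. u r > 0"
    and u_inv: "summable (\<lambda>r. 1 / u (Suc r))"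
    and u_cond: "summable (\<lambda>r. p (Suc r) * NN n r * u r * u (Suc r))"
  shows "(\<forall>\<omega>. ac_subspace (Hop Q n p \<omega>) (Hdom \<omega>) = {\<lambda>_. 0})
       \<and> (cond_abs_cont M \<longrightarrow> (AE \<omega> in M. cont_subspace (Hop Q n p \<omega>) (Hdom \<omega>) = {\<lambda>_. 0}))"
proof -
  \<comment> \<open>No assumption of the locale mentions the site, so \<open>H\<close> serves all
    sites at once.\<close>
  have H: "hierarchical Q n p u"
    using assms by (intro hierarchical.intro) auto
  have 0: "l2 (\<lambda>_::'a. 0)" by (simp add: l2_def)
  have ac0: "(\<lambda>_. 0) \<in> ac_subspace (Hop Q n p \<omega>) (Hdom \<omega>)" for \<omega>
    using 0 spectral_measure_zero by (auto simp: ac_subspace_def absolutely_continuous_def null_sets_def intro!: exI[of _ "null_measure borel"])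
  have cont0: "(\<lambda>_. 0) \<in> cont_subspace (Hop Q n p \<omega>) (Hdom \<omega>)" for \<omega>
    using 0 spectral_measure_zero by (auto simp: cont_subspace_def intro!: exI[of _ "null_measure borel"])
  have "ac_subspace (Hop Q n p \<omega>) (Hdom \<omega>) = {\<lambda>_. 0}" for \<omega>
    using ac0 hierarchical.ac_vanishes[OF H] by (auto simp: fun_eq_iff)
  moreover have "AE \<omega> in M. cont_subspace (Hop Q n p \<omega>) (Hdom \<omega>) = {\<lambda>_. 0}" if "cond_abs_cont M"
  proof -
    \<comment> \<open>One null set is discarded for each of the countably many sites.\<close>
    have "AE \<omega> in M. \<forall>x. hierarchical.good Q n p x \<omega>"
      unfolding AE_all_countable using hierarchical.AE_good[OF H M_sets that] by blast
    then show ?thesis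
    proof eventually_elim
      case (elim \<omega>)
      have "\<psi> x = 0" if "\<psi> \<in> cont_subspace (Hop Q n p \<omega>) (Hdom \<omega>)" for \<psi> x
        using elim that by (intro hierarchical.cont_vanishes[OF H]) auto
      then show ?case using cont0 by blast
    qed
  qed
  ultimately show ?thesis by blast
qed

end
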